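(* Let $W_4$ be a $4$-web on a two-dimensional manifold $M$, represented by $\omega_1=-f_x\,dx$, $\omega_2=-f_y\,dy$, $\omega_3=df$, $\omega_4=-(a\,\omega_1+\omega_2)$, where $f$ is the web function of the $3$-subweb $\langle\omega_1,\omega_2,\omega_3\rangle$ and $a$ is the basic invariant of $W_4$. Then $W_4$ is linearizable if and only if $$I_1^0(f,a)=0\quad\text{and}\quad I_2^0(f,a)=0 .$$
   Context: All objects are smooth and the considerations are local: $M$ is a simply connected domain in $\mathbb R^2$ with coordinates $x,y$. A $4$-web on $M$ is given by four differential $1$-forms $\omega_1,\omega_2,\omega_3,\omega_4$, any two of which are linearly independent at every point; its foliations are $\{\omega_p=0\}$. Each form may be multiplied by a nowhere vanishing function without changing the web. One can choose coordinates $x,y$, a function $f$ (web function) and normalize the forms so that $\omega_1=-f_x\,dx$, $\omega_2=-f_y\,dy$, $\omega_3=df$ (hence $\omega_1+\omega_2+\omega_3=0$), $f_x,f_y\ne 0$, and $\omega_4+a\,\omega_1+\omega_2=0$ for a function $a$ (the basic invariant), which takes neither the value $0$ nor the value $1$. The web is linearizable if it is (locally) equivalent to a linear web, i.e. every point has a neighborhood that admits a diffeomorphism onto an open subset of the projective plane taking the leaves of all the foliations of the web into straight lines. Notation: $$\partial_1=-\frac1{f_x}\frac{\partial}{\partial x},\qquad \partial_2=-\frac1{f_y}\frac{\partial}{\partial y},\qquad H=\frac{f_{xy}}{f_xf_y},\qquad K=\partial_1(H)-\partial_2(H).$$ For a smooth function $\mu$ put $$I_1(\mu)=-\partial_1^2(\mu)+2\partial_1\partial_2(\mu)+(\mu+H)\partial_1(\mu)-2(2H+\mu)\partial_2(\mu)+H\mu^2+(2H^2-\partial_2(H))\mu-\partial_1(K)+2HK,$$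 $$I_2(\mu)=-\partial_2^2(\mu)+2\partial_1\partial_2(\mu)+2(\mu-H)\partial_1(\mu)-(H+\mu)\partial_2(\mu)-H\mu^2+(2H^2-\partial_1(H))\mu-\partial_2(K)+2HK,$$ where $\partial_1\partial_2(\mu)=\partial_1(\partial_2(\mu))$. Finally, for $i=1,2$, $$I_i^0(f,a)=I_i\!\left(\frac{\partial_1(a)-a\,\partial_2(a)}{a-a^2}\right).$$ *)

theory Defs
  imports "HOL-Analysis.Analysis"
begin

(* C_infinity functions on an open set. Quantifying over all directions v is the usual C^k notion
   for finite-dimensional domains; values outside the open set U are irrelevant. *)

primrec Ck_on :: "nat \<Rightarrow> 'a::real_normed_vector set \<Rightarrow> ('a \<Rightarrow> 'b::real_normed_vector) \<Rightarrow> bool"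
where
  "Ck_on 0 U = (\<lambda>f. continuous_on U f)"
| "Ck_on (Suc k) U = (\<lambda>f. (\<forall>p\<in>U. f differentiable (at p)) \<and>
     (\<forall>v. Ck_on k U (\<lambda>p. frechet_derivative f (at p) v)))"

definition smooth_on :: "'a::real_normed_vector set \<Rightarrow> ('a \<Rightarrow> 'b::real_normed_vector) \<Rightarrow> bool"
  where "smooth_on U f \<longleftrightarrow> (\<forall>k. Ck_on k U f)"

definition ddx :: "(real \<times> real \<Rightarrow> real) \<Rightarrow> real \<times> real \<Rightarrow> real"
  where "ddx u p = frechet_derivative u (at p) (1, 0)"

definition ddy :: "(real \<times> real \<Rightarrow> real) \<Rightarrow> real \<times> real \<Rightarrow> real"
  where "ddy u p = frechet_derivative u (at p) (0, 1)"

(* A differential 1-form is given by its value on a tangent vector v at a point p: \<omega> p v.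
   A web is given by the list of forms defining its foliations. *)

type_synonym one_form = "real \<times> real \<Rightarrow> real \<times> real \<Rightarrow> real"

definition is_web :: "(real \<times> real) set \<Rightarrow> one_form list \<Rightarrow> bool" where
  "is_web M W \<longleftrightarrow> (\<forall>p\<in>M. \<forall>i j. i < j \<and> j < length W \<longrightarrow>
     (\<forall>c d. (\<forall>v. c * (W ! i) p v + d * (W ! j) p v = 0) \<longrightarrow> c = 0 \<and> d = 0))"

(* The leaf through q of the foliation {\<omega> = 0} restricted to U. *)
definition leaf :: "one_form \<Rightarrow> (real \<times> real) set \<Rightarrow> real \<times> real \<Rightarrow> (real \<times> real) set" where
  "leaf \<omega> U q = {\<gamma> 1 | \<gamma>. \<gamma> C1_differentiable_on {0..1} \<and> \<gamma> ` {0..1} \<subseteq> U \<and> \<gamma> 0 = q \<and>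
     (\<forall>t\<in>{0..1}. \<omega> (\<gamma> t) (vector_derivative \<gamma> (at t)) = 0)}"

(* The real projective plane: points are the one-dimensional subspaces of R^3, with the quotient
   topology and quotient smooth structure of R^3 - {0}: maps into it are smooth iff they have
   smooth local lifts, and functions on it are smooth iff their pullback to R^3 - {0} is. *)

definition proj_plane :: "(real^3) set set"
  where "proj_plane = {span {v} | v. v \<noteq> 0}"

definition proj_line :: "(real^3) set set \<Rightarrow> bool"
  where "proj_line L \<longleftrightarrow> (\<exists>l. l \<noteq> 0 \<and> L = {span {v} | v. v \<noteq> 0 \<and> l \<bullet> v = 0})"

definition cone_over :: "(real^3) set set \<Rightarrow> (real^3) set"
  where "cone_over V = {v. v \<noteq> 0 \<and> span {v} \<in> V}"

definition proj_open :: "(real^3) set set \<Rightarrow> bool"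
  where "proj_open V \<longleftrightarrow> V \<subseteq> proj_plane \<and> open (cone_over V)"

definition smooth_into_proj :: "(real \<times> real) set \<Rightarrow> (real \<times> real \<Rightarrow> (real^3) set) \<Rightarrow> bool" where
  "smooth_into_proj U \<phi> \<longleftrightarrow> (\<forall>p\<in>U. \<exists>N F. open N \<and> p \<in> N \<and> N \<subseteq> U \<and> smooth_on N F \<and>
     (\<forall>q\<in>N. F q \<noteq> 0 \<and> \<phi> q = span {F q}))"

definition smooth_from_proj :: "(real^3) set set \<Rightarrow> ((real^3) set \<Rightarrow> real \<times> real) \<Rightarrow> bool"
  where "smooth_from_proj V \<psi> \<longleftrightarrow> smooth_on (cone_over V) (\<lambda>v. \<psi> (span {v}))"

definition diffeo_onto_proj ::
  "(real \<times> real) set \<Rightarrow> (real \<times> real \<Rightarrow> (real^3) set) \<Rightarrow> (real^3) set set \<Rightarrow> bool" where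
  "diffeo_onto_proj U \<phi> V \<longleftrightarrow> open U \<and> proj_open V \<and> bij_betw \<phi> U V \<and>
     smooth_into_proj U \<phi> \<and> smooth_from_proj V (inv_into U \<phi>)"

definition linearizable :: "(real \<times> real) set \<Rightarrow> one_form list \<Rightarrow> bool" where
  "linearizable M W \<longleftrightarrow> (\<forall>p\<in>M. \<exists>U \<phi> V. p \<in> U \<and> U \<subseteq> M \<and> diffeo_onto_proj U \<phi> V \<and>
     (\<forall>\<omega>\<in>set W. \<forall>q\<in>U. \<exists>L. proj_line L \<and> \<phi> ` leaf \<omega> U q \<subseteq> L))"

definition omega1 :: "(real \<times> real \<Rightarrow> real) \<Rightarrow> one_form"
  where "omega1 f p v = - ddx f p * fst v"

definition omega2 :: "(real \<times> real \<Rightarrow> real) \<Rightarrow> one_form"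
  where "omega2 f p v = - ddy f p * snd v"

definition omega3 :: "(real \<times> real \<Rightarrow> real) \<Rightarrow> one_form"
  where "omega3 f p v = frechet_derivative f (at p) v"

definition omega4 :: "(real \<times> real \<Rightarrow> real) \<Rightarrow> (real \<times> real \<Rightarrow> real) \<Rightarrow> one_form"
  where "omega4 f a p v = - (a p * omega1 f p v + omega2 f p v)"

definition web4 :: "(real \<times> real \<Rightarrow> real) \<Rightarrow> (real \<times> real \<Rightarrow> real) \<Rightarrow> one_form list"
  where "web4 f a = [omega1 f, omega2 f, omega3 f, omega4 f a]"

lemma omega_sum_zero:
  assumes "f differentiable (at p)"
  shows "omega1 f p v + omega2 f p v + omega3 f p v = 0"
proof -
  interpret D: linear "frechet_derivative f (at p)"
    using assms by (rule linear_frechet_derivative)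
  have "frechet_derivative f (at p) v
      = frechet_derivative f (at p) (fst v *\<^sub>R (1, 0) + snd v *\<^sub>R (0, 1))"
    by simp
  also have "\<dots> = fst v * ddx f p + snd v * ddy f p"
    by (simp only: D.add D.scale ddx_def ddy_def real_scaleR_def)
  finally show ?thesis
    by (simp add: omega1_def omega2_def omega3_def)
qed

lemma is_web_web4_iff:
  assumes "\<And>p. p \<in> M \<Longrightarrow> f differentiable (at p)"
  shows "is_web M (web4 f a) \<longleftrightarrow>
    (\<forall>p\<in>M. ddx f p \<noteq> 0 \<and> ddy f p \<noteq> 0 \<and> a p \<noteq> 0 \<and> a p \<noteq> 1)"
proof -
  have o3: "omega3 f p v = ddx f p * fst v + ddy f p * snd v" if "p \<in> M" for p v
    using omega_sum_zero[OF assms[OF that], of v] by (simp add: omega1_def omega2_def)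
  have "(\<forall>i j. i < j \<and> j < length (web4 f a) \<longrightarrow>
       (\<forall>c d. (\<forall>v. c * (web4 f a ! i) p v + d * (web4 f a ! j) p v = 0) \<longrightarrow> c = 0 \<and> d = 0))
     \<longleftrightarrow> ddx f p \<noteq> 0 \<and> ddy f p \<noteq> 0 \<and> a p \<noteq> 0 \<and> a p \<noteq> 1" (is "?L \<longleftrightarrow> ?R")
    if p: "p \<in> M" for p
  proof
    assume L: ?L
    have ind: "c = 0 \<and> d = 0"
      if "i < j" "j < 4" "\<forall>v. c * (web4 f a ! i) p v + d * (web4 f a ! j) p v = 0" for i j c d
    proof -
      have len: "length (web4 f a) = 4"
        by (simp add: web4_def)
      show ?thesis
        using L[unfolded len] that by blast
    qed
    have "ddx f p \<noteq> 0"
      using ind[of 0 1 1 0] by (auto simp: web4_def omega1_def)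
    moreover have "ddy f p \<noteq> 0"
      using ind[of 0 1 0 1] by (auto simp: web4_def omega2_def)
    moreover have "a p \<noteq> 0"
      using ind[of 1 3 1 1] by (auto simp: web4_def omega4_def)
    moreover have "a p \<noteq> 1"
      using ind[of 2 3 "-1" 1] by (auto simp: web4_def o3[OF p] omega1_def omega2_def omega4_def)
    ultimately show ?R
      by blast
  next
    assume R: ?R
    show ?L
    proof (intro allI impI)
      fix i j c d
      assume ij: "i < j \<and> j < length (web4 f a)"
        and v: "\<forall>v. c * (web4 f a ! i) p v + d * (web4 f a ! j) p v = 0"
      have aux: "c = 0 \<and> d = 0"
        if "c * ddx f p + d * (a p * ddx f p) = 0" "c * ddy f p + d * ddy f p = 0"
      proof -
        have "(c + d * a p) * ddx f p = 0" "(c + d) * ddy f p = 0"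
          using that by (simp_all only: distrib_right mult.assoc)
        with R have 1: "c + d * a p = 0" and 2: "c + d = 0"
          by (simp_all only: mult_eq_0_iff simp_thms)
        have "d * a p - d = 0"
          using 1 2 by linarith
        then have "d * (a p - 1) = 0"
          by (simp only: right_diff_distrib mult_1_right)
        with R have "d = 0"
          by simp
        with 2 show ?thesis
          by simp
      qed
      have "(i, j) \<in> {(0,1), (0,2), (0,3), (1,2), (1,3)} \<or> i = 2 \<and> j = 3"
        using ij by (auto simp: web4_def)
      then show "c = 0 \<and> d = 0"
      proof
        assume "(i, j) \<in> {(0,1), (0,2), (0,3), (1,2), (1,3)}"
        then show ?thesis
          using R spec[OF v, of "(1,0)"] spec[OF v, of "(0,1)"]
          by (auto simp: web4_def o3[OF p] omega1_def omega2_def omega4_def)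
      next
        assume "i = 2 \<and> j = 3"
        then show ?thesis
          using spec[OF v, of "(1,0)"] spec[OF v, of "(0,1)"]
          by (intro aux) (simp_all add: web4_def o3[OF p] omega1_def omega2_def omega4_def)
      qed
    qed
  qed
  then show ?thesis
    unfolding is_web_def by (rule ball_cong[OF refl])
qed

definition d1 :: "(real \<times> real \<Rightarrow> real) \<Rightarrow> (real \<times> real \<Rightarrow> real) \<Rightarrow> real \<times> real \<Rightarrow> real"
  where "d1 f u p = - (1 / ddx f p) * ddx u p"

definition d2 :: "(real \<times> real \<Rightarrow> real) \<Rightarrow> (real \<times> real \<Rightarrow> real) \<Rightarrow> real \<times> real \<Rightarrow> real"
  where "d2 f u p = - (1 / ddy f p) * ddy u p"

definition web_H :: "(real \<times> real \<Rightarrow> real) \<Rightarrow> real \<times> real \<Rightarrow> real"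
  where "web_H f p = ddy (ddx f) p / (ddx f p * ddy f p)"

definition web_K :: "(real \<times> real \<Rightarrow> real) \<Rightarrow> real \<times> real \<Rightarrow> real"
  where "web_K f p = d1 f (web_H f) p - d2 f (web_H f) p"

definition I1 :: "(real \<times> real \<Rightarrow> real) \<Rightarrow> (real \<times> real \<Rightarrow> real) \<Rightarrow> real \<times> real \<Rightarrow> real" where
  "I1 f \<mu> p =
     - d1 f (d1 f \<mu>) p + 2 * d1 f (d2 f \<mu>) p
     + (\<mu> p + web_H f p) * d1 f \<mu> p - 2 * (2 * web_H f p + \<mu> p) * d2 f \<mu> p
     + web_H f p * (\<mu> p)^2 + (2 * (web_H f p)^2 - d2 f (web_H f) p) * \<mu> p
     - d1 f (web_K f) p + 2 * web_H f p * web_K f p"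

definition I2 :: "(real \<times> real \<Rightarrow> real) \<Rightarrow> (real \<times> real \<Rightarrow> real) \<Rightarrow> real \<times> real \<Rightarrow> real" where
  "I2 f \<mu> p =
     - d2 f (d2 f \<mu>) p + 2 * d1 f (d2 f \<mu>) p
     + 2 * (\<mu> p - web_H f p) * d1 f \<mu> p - (web_H f p + \<mu> p) * d2 f \<mu> p
     - web_H f p * (\<mu> p)^2 + (2 * (web_H f p)^2 - d1 f (web_H f) p) * \<mu> p
     - d2 f (web_K f) p + 2 * web_H f p * web_K f p"

definition mu0 :: "(real \<times> real \<Rightarrow> real) \<Rightarrow> (real \<times> real \<Rightarrow> real) \<Rightarrow> real \<times> real \<Rightarrow> real"
  where "mu0 f a p = (d1 f a p - a p * d2 f a p) / (a p - (a p)^2)"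

definition I1_0 :: "(real \<times> real \<Rightarrow> real) \<Rightarrow> (real \<times> real \<Rightarrow> real) \<Rightarrow> real \<times> real \<Rightarrow> real"
  where "I1_0 f a = I1 f (mu0 f a)"

definition I2_0 :: "(real \<times> real \<Rightarrow> real) \<Rightarrow> (real \<times> real \<Rightarrow> real) \<Rightarrow> real \<times> real \<Rightarrow> real"
  where "I2_0 f a = I2 f (mu0 f a)"

end

theory Submission
  imports Defs
begin

text \<open>The four foliations of the web consist of geodesics of \<open>y'' = P y' + Q y'^2\<close>, where
  \<open>P = f_xx / f_x - f_x (H + \<mu>)\<close> and \<open>Q = f_y (H - \<mu>) - f_yy / f_y\<close> with
  \<open>\<mu> = (d1 a - a d2 a) / (a - a^2)\<close>, and this determines \<open>P\<close> and \<open>Q\<close>.  The equation can be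
  straightened iff two expressions in the second derivatives of \<open>P\<close> and \<open>Q\<close> vanish, and these are
  \<open>- f_x^2 f_y I1 f \<mu>\<close> and \<open>f_x f_y^2 I2 f \<mu>\<close>.

  If they vanish, the overdetermined system \<open>u_xx = (P/3) u_x + r u\<close>,
  \<open>u_xy = (Q/3) u_x - (P/3) u_y + s u\<close>, \<open>u_yy = - (Q/3) u_y + t u\<close> is compatible for suitable \<open>r, s, t\<close>.
  Three independent solutions are the homogeneous coordinates of a chart: a solution restricted to a
  geodesic satisfies a linear second order equation, so the combination that vanishes to first order at
  a point of the leaf vanishes on the whole leaf.

  Conversely, let \<open>R, S\<close> be affine coordinates in which the leaves are straight.  Differentiating twice
  along the integral curves of the four foliations gives \<open>R_xx = g1 R_x\<close>,
  \<open>R_xy = g2 R_x + g3 R_y\<close>, \<open>R_yy = g4 R_y\<close>, the same for \<open>S\<close>, and \<open>P = g1 - 2 g3\<close>, \<open>Q = 2 g2 - g4\<close>.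
  Equality of mixed third derivatives then makes the two expressions vanish.\<close>

section \<open>Smooth functions\<close>

text \<open>In general a projective structure has a geodesic equation cubic in \<open>y'\<close>.
  Straight vertical and horizontal lines remove the cubic and the constant term; the other two
  foliations give two linear equations for \<open>P\<close>, \<open>Q\<close> with determinant
  \<open>(1 - a) f_x f_y\<close>. The two expressions tested are, up to constant factors,
  Liouville's invariants of \<open>y'' = P y' + Q y'^2\<close>. The weights \<open>P/3\<close>,
  \<open>Q/3\<close> come from the trace-free connection with these geodesics. The values of
  \<open>r, s, t\<close> are forced: in the compatibility identities the coefficients of
  \<open>u_x\<close> and \<open>u_y\<close> determine them, and the coefficients of \<open>u\<close>
  then become Liouville's invariants. Because of the terms \<open>r u, s u, t u\<close> the
  solutions are homogeneous rather than affine coordinates. The system is overdetermined, so its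
  solvability is a Frobenius theorem, obtained here by Picard iteration. A \<open>leaf\<close> is
  reached by arbitrary C1 paths tangent to the foliation, which may pause or turn back. Vanishing is
  therefore carried along such a path by a growth estimate; the converse needs only integral curves,
  which are particular paths of this kind.\<close>

lemma Ck_on_subset: "Ck_on k U f \<Longrightarrow> V \<subseteq> U \<Longrightarrow> Ck_on k V f"
  by (induction k arbitrary: f) (auto intro: continuous_on_subset)

lemma Ck_on_SucD: "Ck_on (Suc k) U f \<Longrightarrow> Ck_on k U f"
proof (induction k arbitrary: f)
  case 0
  then show ?case
    by (auto intro!: continuous_at_imp_continuous_on differentiable_imp_continuous_within)
next
  case (Suc k)
  have "Ck_on k U (\<lambda>p. frechet_derivative f (at p) v)" for v
    by (rule Suc.IH) (use Suc.prems in auto)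
  then show ?case
    using Suc.prems by auto
qed

text \<open>\<open>Ck_on\<close> refers to \<open>frechet_derivative\<close>, so a derivative known
  by a formula has to be transferred along equality on \<open>U\<close>. This transfer at level
  \<open>k\<close> is a hypothesis because it is itself proved by induction with the present
  rule.\<close>

lemma Ck_on_SucI:
  fixes f :: "'a::real_normed_vector \<Rightarrow> 'b::real_normed_vector"
  assumes "open U" and "\<And>p. p \<in> U \<Longrightarrow> (f has_derivative f' p) (at p)"
    and "\<And>v. Ck_on k U (\<lambda>p. f' p v)"
    and cong: "\<And>g h :: 'a \<Rightarrow> 'b. (\<And>p. p \<in> U \<Longrightarrow> g p = h p) \<Longrightarrow> Ck_on k U g \<Longrightarrow> Ck_on k U h"
  shows "Ck_on (Suc k) U f"
proof -
  have "f' p = frechet_derivative f (at p)" if "p \<in> U" for p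
    by (rule frechet_derivative_at) (rule assms(2)[OF that])
  then have "Ck_on k U (\<lambda>p. frechet_derivative f (at p) v)" for v
    using cong[of "\<lambda>p. f' p v" "\<lambda>p. frechet_derivative f (at p) v"] assms(3) by simp
  moreover have "\<forall>p\<in>U. f differentiable (at p)"
    using assms(2) by (auto simp: differentiable_def)
  ultimately show ?thesis
    by simp
qed

text \<open>On an open set a derivative depends only on nearby values, so the derivative of
  \<open>g\<close> is also one of \<open>h\<close>, whatever happens outside
  \<open>U\<close>.\<close>

lemma Ck_on_cong:
  assumes "open U" and "\<And>p. p \<in> U \<Longrightarrow> g p = h p" and "Ck_on k U g"
  shows "Ck_on k U h"
  using assms(2,3)
proof (induction k arbitrary: g h)
  case 0
  then show ?case
    by (auto cong: continuous_on_cong)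
next
  case (Suc k)
  show ?case
  proof (rule Ck_on_SucI[OF \<open>open U\<close>])
    fix p assume p: "p \<in> U"
    have "(g has_derivative frechet_derivative g (at p)) (at p)"
      using Suc.prems(2) p by (simp add: frechet_derivative_works)
    then show "(h has_derivative frechet_derivative g (at p)) (at p)"
      by (rule has_derivative_transform_within_open) (use p \<open>open U\<close> Suc.prems(1) in auto)
  next
    show "Ck_on k U (\<lambda>p. frechet_derivative g (at p) v)" for v
      using Suc.prems(2) by simp
  qed (rule Suc.IH)
qed

lemma Ck_on_Suc_has_derivativeI:
  assumes "open U" and "\<And>p. p \<in> U \<Longrightarrow> (f has_derivative f' p) (at p)"
    and "\<And>v. Ck_on k U (\<lambda>p. f' p v)"
  shows "Ck_on (Suc k) U f"
  by (rule Ck_on_SucI[OF assms Ck_on_cong[OF \<open>open U\<close>]])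

lemma Ck_on_Suc_has_derivative:
  "Ck_on (Suc k) U f \<Longrightarrow> p \<in> U \<Longrightarrow> (f has_derivative frechet_derivative f (at p)) (at p)"
  by (simp add: frechet_derivative_works)

lemma Ck_on_Suc_derivative: "Ck_on (Suc k) U f \<Longrightarrow> Ck_on k U (\<lambda>p. frechet_derivative f (at p) v)"
  by simp

lemma Ck_on_const: "open U \<Longrightarrow> Ck_on k U (\<lambda>p. c)"
proof (induction k arbitrary: c)
  case (Suc k)
  show ?case
    by (rule Ck_on_Suc_has_derivativeI[OF Suc.prems has_derivative_const]) (rule Suc.IH[OF Suc.prems])
qed simp

lemma Ck_on_bounded_linear:
  assumes "bounded_linear h" "open U" "Ck_on k U f"
  shows "Ck_on k U (\<lambda>p. h (f p))"
  using assms(3)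
proof (induction k arbitrary: f)
  case 0
  then show ?case
    by (auto intro: bounded_linear.continuous_on[OF assms(1)])
next
  case (Suc k)
  show ?case
    by (rule Ck_on_Suc_has_derivativeI[OF assms(2)
          bounded_linear.has_derivative[OF assms(1) Ck_on_Suc_has_derivative[OF Suc.prems]]
          Suc.IH[OF Ck_on_Suc_derivative[OF Suc.prems]]])
qed

lemma Ck_on_add:
  assumes "open U" "Ck_on k U f" "Ck_on k U g"
  shows "Ck_on k U (\<lambda>p. f p + g p)"
  using assms(2,3)
proof (induction k arbitrary: f g)
  case 0
  then show ?case
    by (auto intro: continuous_on_add)
next
  case (Suc k)
  show ?case
    by (rule Ck_on_Suc_has_derivativeI[OF assms(1)
          has_derivative_add[OF Ck_on_Suc_has_derivative[OF Suc.prems(1)]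
            Ck_on_Suc_has_derivative[OF Suc.prems(2)]]
          Suc.IH[OF Ck_on_Suc_derivative[OF Suc.prems(1)] Ck_on_Suc_derivative[OF Suc.prems(2)]]])
qed

text \<open>The product rule writes the derivative as a sum of two values of the same
  \<open>b\<close>, so a single induction covers products, scalar multiples and operators applied to
  vectors.\<close>

lemma Ck_on_bounded_bilinear:
  assumes "bounded_bilinear b" "open U" "Ck_on k U f" "Ck_on k U g"
  shows "Ck_on k U (\<lambda>p. b (f p) (g p))"
  using assms(3,4)
proof (induction k arbitrary: f g)
  case 0
  then show ?case
    by (auto intro: bounded_bilinear.continuous_on[OF assms(1)])
next
  case (Suc k)
  show ?case
    by (rule Ck_on_Suc_has_derivativeI[OF assms(2)
          bounded_bilinear.FDERIV[OF assms(1) Ck_on_Suc_has_derivative[OF Suc.prems(1)]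
            Ck_on_Suc_has_derivative[OF Suc.prems(2)]]
          Ck_on_add[OF assms(2) Suc.IH[OF Ck_on_SucD[OF Suc.prems(1)] Ck_on_Suc_derivative[OF Suc.prems(2)]]
            Suc.IH[OF Ck_on_Suc_derivative[OF Suc.prems(1)] Ck_on_SucD[OF Suc.prems(2)]]]])
qed

lemma Ck_on_sum:
  assumes "open U" "\<And>i. i \<in> I \<Longrightarrow> Ck_on k U (f i)"
  shows "Ck_on k U (\<lambda>p. \<Sum>i\<in>I. f i p)"
  using assms(2)
proof (induction I rule: infinite_finite_induct)
  case (insert i I)
  then show ?case
    by (simp add: Ck_on_add[OF assms(1)])
qed (simp_all add: Ck_on_const[OF assms(1)])

lemma Ck_on_inverse:
  fixes f :: "'a::real_normed_vector \<Rightarrow> real"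
  assumes "open U" "Ck_on k U f" "\<And>p. p \<in> U \<Longrightarrow> f p \<noteq> 0"
  shows "Ck_on k U (\<lambda>p. inverse (f p))"
  using assms(2)
proof (induction k)
  case 0
  then show ?case
    using assms(3) by (auto intro: continuous_on_inverse)
next
  case (Suc k)
  \<comment> \<open>The derivative of the inverse contains the inverse again, but needs it only one
    order lower.\<close>
  have 1: "Ck_on k U (\<lambda>p. inverse (f p))"
    by (rule Suc.IH[OF Ck_on_SucD[OF Suc.prems]])
  show ?case
  proof (rule Ck_on_Suc_has_derivativeI[OF assms(1)])
    fix p assume "p \<in> U"
    then show "((\<lambda>p. inverse (f p)) has_derivative
        (\<lambda>v. - (inverse (f p) * frechet_derivative f (at p) v * inverse (f p)))) (at p)"
      by (intro Deriv.has_derivative_inverse assms(3) Ck_on_Suc_has_derivative[OF Suc.prems])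
  next
    have 2: "bounded_linear (uminus :: real \<Rightarrow> real)"
      by (rule bounded_linear_minus[OF bounded_linear_ident])
    show "Ck_on k U (\<lambda>p. - (inverse (f p) * frechet_derivative f (at p) v * inverse (f p)))" for v
      by (rule Ck_on_bounded_linear[OF 2 assms(1)
            Ck_on_bounded_bilinear[OF bounded_bilinear_mult assms(1)
              Ck_on_bounded_bilinear[OF bounded_bilinear_mult assms(1) 1 Ck_on_Suc_derivative[OF Suc.prems]] 1]])
  qed
qed

lemma Ck_on_compose:
  fixes f :: "'a::real_normed_vector \<Rightarrow> 'b::euclidean_space"
  assumes "open U" "open V" "f ` U \<subseteq> V" "Ck_on k U f" "Ck_on k V g"
  shows "Ck_on k U (\<lambda>p. g (f p))"
  using assms(4,5)
proof (induction k arbitrary: g)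
  case 0
  then show ?case
    using assms(3) by (auto intro: continuous_on_compose2)
next
  case (Suc k)
  let ?f' = "\<lambda>p v. frechet_derivative f (at p) v" and ?g' = "\<lambda>p v. frechet_derivative g (at p) v"
  show ?case
  proof (rule Ck_on_Suc_has_derivativeI[OF assms(1)])
    fix p assume p: "p \<in> U"
    have g: "(g has_derivative ?g' (f p)) (at (f p))"
      by (rule Ck_on_Suc_has_derivative[OF Suc.prems(2)]) (use p assms(3) in auto)
    have "((\<lambda>p. g (f p)) has_derivative (\<lambda>v. ?g' (f p) (?f' p v))) (at p)"
      using diff_chain_at[OF Ck_on_Suc_has_derivative[OF Suc.prems(1) p] g] by (simp add: o_def)
    \<comment> \<open>The chain rule evaluates the derivative of \<open>g\<close> in a direction
      that varies with \<open>p\<close>, whereas \<open>Ck_on\<close> controls it in fixed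
      directions only. Expanding that direction in \<open>Basis\<close> separates the two
      dependences.\<close>
    moreover have expand: "?g' (f p) w = (\<Sum>i\<in>Basis. (w \<bullet> i) *\<^sub>R ?g' (f p) i)" for w
    proof -
      interpret linear "?g' (f p)"
        by (rule has_derivative_linear[OF g])
      have "?g' (f p) (\<Sum>i\<in>Basis. (w \<bullet> i) *\<^sub>R i) = (\<Sum>i\<in>Basis. (w \<bullet> i) *\<^sub>R ?g' (f p) i)"
        by (simp only: sum scale)
      then show ?thesis
        by (simp only: euclidean_representation)
    qed
    ultimately show "((\<lambda>p. g (f p)) has_derivative
        (\<lambda>v. \<Sum>i\<in>Basis. (?f' p v \<bullet> i) *\<^sub>R ?g' (f p) i)) (at p)"
      by (subst expand[symmetric])
  next
    fix v
    show "Ck_on k U (\<lambda>p. \<Sum>i\<in>Basis. (?f' p v \<bullet> i) *\<^sub>R ?g' (f p) i)"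
      by (intro Ck_on_sum assms(1) Ck_on_bounded_bilinear[OF bounded_bilinear_scaleR assms(1)]
            Ck_on_bounded_linear[OF bounded_linear_inner_left assms(1) Ck_on_Suc_derivative[OF Suc.prems(1)]]
            Suc.IH Ck_on_SucD[OF Suc.prems(1)] Ck_on_Suc_derivative[OF Suc.prems(2)])
  qed
qed

lemma smooth_on_subset: "smooth_on U f \<Longrightarrow> V \<subseteq> U \<Longrightarrow> smooth_on V f"
  by (simp add: smooth_on_def Ck_on_subset[of _ U f V])

lemma smooth_on_cong: "open U \<Longrightarrow> (\<And>p. p \<in> U \<Longrightarrow> g p = h p) \<Longrightarrow> smooth_on U g \<Longrightarrow> smooth_on U h"
  unfolding smooth_on_def by (intro allI Ck_on_cong[of U g h]) auto

lemma smooth_on_has_derivative: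
  "smooth_on U f \<Longrightarrow> p \<in> U \<Longrightarrow> (f has_derivative frechet_derivative f (at p)) (at p)"
  unfolding smooth_on_def by (rule Ck_on_Suc_has_derivative[of 0]) (drule spec[of _ "Suc 0"], assumption)

lemma smooth_on_differentiable: "smooth_on U f \<Longrightarrow> p \<in> U \<Longrightarrow> f differentiable (at p)"
  unfolding differentiable_def by (intro exI) (rule smooth_on_has_derivative)

lemma smooth_on_continuous_on: "smooth_on U f \<Longrightarrow> continuous_on U f"
  unfolding smooth_on_def by (drule spec[of _ 0]) simp

lemma smooth_on_derivative: "smooth_on U f \<Longrightarrow> smooth_on U (\<lambda>p. frechet_derivative f (at p) v)"
  unfolding smooth_on_def by (intro allI Ck_on_Suc_derivative) (erule spec)

lemma smooth_on_const: "open U \<Longrightarrow> smooth_on U (\<lambda>p. c)"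
  by (simp add: smooth_on_def Ck_on_const)

lemma smooth_on_bounded_linear:
  "bounded_linear h \<Longrightarrow> open U \<Longrightarrow> smooth_on U f \<Longrightarrow> smooth_on U (\<lambda>p. h (f p))"
  by (simp add: smooth_on_def Ck_on_bounded_linear)

lemma smooth_on_bounded_bilinear:
  "bounded_bilinear b \<Longrightarrow> open U \<Longrightarrow> smooth_on U f \<Longrightarrow> smooth_on U g \<Longrightarrow> smooth_on U (\<lambda>p. b (f p) (g p))"
  by (simp add: smooth_on_def Ck_on_bounded_bilinear)

lemma smooth_on_add:
  "open U \<Longrightarrow> smooth_on U f \<Longrightarrow> smooth_on U g \<Longrightarrow> smooth_on U (\<lambda>p. f p + g p)"
  by (simp add: smooth_on_def Ck_on_add)

lemma smooth_on_uminus: "open U \<Longrightarrow> smooth_on U f \<Longrightarrow> smooth_on U (\<lambda>p. - f p)"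
  by (rule smooth_on_bounded_linear[OF bounded_linear_minus[OF bounded_linear_ident]])

lemma smooth_on_diff:
  "open U \<Longrightarrow> smooth_on U f \<Longrightarrow> smooth_on U g \<Longrightarrow> smooth_on U (\<lambda>p. f p - g p)"
  using smooth_on_add[OF _ _ smooth_on_uminus, of U f g] by simp

lemma smooth_on_scaleR:
  "open U \<Longrightarrow> smooth_on U f \<Longrightarrow> smooth_on U g \<Longrightarrow> smooth_on U (\<lambda>p. f p *\<^sub>R g p)"
  by (rule smooth_on_bounded_bilinear[OF bounded_bilinear_scaleR])

lemma smooth_on_mult:
  fixes f g :: "'a::real_normed_vector \<Rightarrow> real"
  shows "open U \<Longrightarrow> smooth_on U f \<Longrightarrow> smooth_on U g \<Longrightarrow> smooth_on U (\<lambda>p. f p * g p)"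
  by (rule smooth_on_bounded_bilinear[OF bounded_bilinear_mult])

lemma smooth_on_inverse:
  fixes f :: "'a::real_normed_vector \<Rightarrow> real"
  shows "open U \<Longrightarrow> smooth_on U f \<Longrightarrow> (\<And>p. p \<in> U \<Longrightarrow> f p \<noteq> 0) \<Longrightarrow> smooth_on U (\<lambda>p. inverse (f p))"
  by (simp add: smooth_on_def Ck_on_inverse)

lemma smooth_on_divide:
  fixes f g :: "'a::real_normed_vector \<Rightarrow> real"
  shows "open U \<Longrightarrow> smooth_on U f \<Longrightarrow> smooth_on U g \<Longrightarrow> (\<And>p. p \<in> U \<Longrightarrow> g p \<noteq> 0) \<Longrightarrow>
    smooth_on U (\<lambda>p. f p / g p)"
  by (simp add: divide_inverse smooth_on_mult smooth_on_inverse)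

lemma smooth_on_power:
  fixes f :: "'a::real_normed_vector \<Rightarrow> real"
  shows "open U \<Longrightarrow> smooth_on U f \<Longrightarrow> smooth_on U (\<lambda>p. f p ^ n)"
  by (induction n) (simp_all add: smooth_on_const smooth_on_mult)

lemma smooth_on_compose:
  fixes f :: "'a::real_normed_vector \<Rightarrow> 'b::euclidean_space"
  shows "open U \<Longrightarrow> open V \<Longrightarrow> f ` U \<subseteq> V \<Longrightarrow> smooth_on U f \<Longrightarrow> smooth_on V g \<Longrightarrow>
    smooth_on U (\<lambda>p. g (f p))"
  by (simp add: smooth_on_def Ck_on_compose)

lemma Ck_on_Pair:
  assumes "open U" "Ck_on k U f" "Ck_on k U g"
  shows "Ck_on k U (\<lambda>p. (f p, g p))"
proof -
  have "Ck_on k U (\<lambda>p. (f p, 0) + (0, g p))"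
    by (intro Ck_on_add assms Ck_on_bounded_linear[OF bounded_linear_Pair[OF bounded_linear_ident bounded_linear_zero]]
        Ck_on_bounded_linear[OF bounded_linear_Pair[OF bounded_linear_zero bounded_linear_ident]])
  then show ?thesis
    by simp
qed

lemma smooth_on_Pair:
  "open U \<Longrightarrow> smooth_on U f \<Longrightarrow> smooth_on U g \<Longrightarrow> smooth_on U (\<lambda>p. (f p, g p))"
  by (simp add: smooth_on_def Ck_on_Pair)

lemma smooth_on_ident: "open U \<Longrightarrow> smooth_on U (\<lambda>p. p)"
  unfolding smooth_on_def
proof
  fix k assume "open U"
  then show "Ck_on k U (\<lambda>p. p)"
    by (cases k) (auto intro!: Ck_on_Suc_has_derivativeI has_derivative_ident Ck_on_const simp del: Ck_on.simps(2))
qed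

lemma smooth_on_fst: "open U \<Longrightarrow> smooth_on U f \<Longrightarrow> smooth_on U (\<lambda>p. fst (f p))"
  by (rule smooth_on_bounded_linear[OF bounded_linear_fst])

lemma smooth_on_snd: "open U \<Longrightarrow> smooth_on U f \<Longrightarrow> smooth_on U (\<lambda>p. snd (f p))"
  by (rule smooth_on_bounded_linear[OF bounded_linear_snd])

section \<open>Partial derivatives in the plane\<close>

lemma frechet_derivative_plane:
  fixes u :: "real \<times> real \<Rightarrow> 'b::real_normed_vector"
  assumes "u differentiable (at p)"
  shows "frechet_derivative u (at p) v
    = fst v *\<^sub>R frechet_derivative u (at p) (1, 0) + snd v *\<^sub>R frechet_derivative u (at p) (0, 1)"
proof -
  interpret linear "frechet_derivative u (at p)"
    using assms by (rule linear_frechet_derivative)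
  have "frechet_derivative u (at p) v
      = frechet_derivative u (at p) (fst v *\<^sub>R (1, 0) + snd v *\<^sub>R (0, 1))"
    by simp
  then show ?thesis
    by (simp only: add scale)
qed

lemma frechet_derivative_dd:
  "u differentiable (at p) \<Longrightarrow> frechet_derivative u (at p) v = fst v * ddx u p + snd v * ddy u p"
  using frechet_derivative_plane[of u p v] by (simp add: ddx_def ddy_def)

lemma has_derivative_dd:
  assumes "u differentiable (at p)"
  shows "(u has_derivative (\<lambda>v. fst v * ddx u p + snd v * ddy u p)) (at p)"
proof -
  have "frechet_derivative u (at p) = (\<lambda>v. fst v * ddx u p + snd v * ddy u p)"
    by (rule ext) (rule frechet_derivative_dd[OF assms])
  then show ?thesis
    using assms unfolding frechet_derivative_works by simp
qed

lemma dd_eqI: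
  assumes "(u has_derivative u') (at p)"
  shows "ddx u p = u' (1, 0)" "ddy u p = u' (0, 1)"
  using frechet_derivative_at[OF assms] by (simp_all add: ddx_def ddy_def)

lemma has_real_derivative_ddx:
  assumes "u differentiable (at (x, y))"
  shows "((\<lambda>s. u (s, y)) has_real_derivative ddx u (x, y)) (at x)"
proof -
  have "((\<lambda>s. (s, y)) has_derivative (\<lambda>h. (h, 0))) (at x)"
    by (auto intro!: derivative_eq_intros)
  from diff_chain_at[OF this has_derivative_dd[OF assms]] show ?thesis
    by (simp add: has_field_derivative_def o_def mult.commute[of _ "ddx u (x, y)"])
qed

lemma has_real_derivative_ddy:
  assumes "u differentiable (at (x, y))"
  shows "((\<lambda>s. u (x, s)) has_real_derivative ddy u (x, y)) (at y)"
proof -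
  have "((\<lambda>s. (x, s)) has_derivative (\<lambda>h. (0, h))) (at y)"
    by (auto intro!: derivative_eq_intros)
  from diff_chain_at[OF this has_derivative_dd[OF assms]] show ?thesis
    by (simp add: has_field_derivative_def o_def mult.commute[of _ "ddy u (x, y)"])
qed

lemma smooth_on_ddx: "smooth_on U u \<Longrightarrow> smooth_on U (ddx u)"
  using smooth_on_derivative[of U u "(1, 0)"] by (simp add: ddx_def[abs_def])

lemma smooth_on_ddy: "smooth_on U u \<Longrightarrow> smooth_on U (ddy u)"
  using smooth_on_derivative[of U u "(0, 1)"] by (simp add: ddy_def[abs_def])

lemma dd_cong:
  assumes "open U" "p \<in> U" "\<And>q. q \<in> U \<Longrightarrow> u q = w q" "u differentiable (at p)"
  shows "ddx u p = ddx w p" "ddy u p = ddy w p"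
proof -
  have "(w has_derivative (\<lambda>v. fst v * ddx u p + snd v * ddy u p)) (at p)"
    by (rule has_derivative_transform_within_open[OF has_derivative_dd[OF assms(4)] assms(1,2,3)])
  from dd_eqI[OF this] show "ddx u p = ddx w p" "ddy u p = ddy w p"
    by simp_all
qed

text \<open>The mean value theorem, first in \<open>x\<close> and then in \<open>y\<close>. The left
  side does not depend on the order of the variables, which is what allows a comparison of the two
  mixed partials.\<close>

lemma second_difference_xy:
  assumes u: "smooth_on U u" and h: "h > 0" and sub: "{x..x+h} \<times> {y..y+h} \<subseteq> U"
  shows "\<exists>s t. s \<in> {x..x+h} \<and> t \<in> {y..y+h} \<and>
    u (x+h, y+h) - u (x+h, y) - u (x, y+h) + u (x, y) = h * h * ddy (ddx u) (s, t)"
proof -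
  have d: "u differentiable (at q)" "ddx u differentiable (at q)" if "q \<in> {x..x+h} \<times> {y..y+h}" for q
    using smooth_on_differentiable[OF u] smooth_on_differentiable[OF smooth_on_ddx[OF u]] that sub by auto
  have "\<exists>s. x < s \<and> s < x + h \<and> (u (x+h, y+h) - u (x+h, y)) - (u (x, y+h) - u (x, y))
      = (x + h - x) * (ddx u (s, y+h) - ddx u (s, y))"
    using h by (intro MVT2 DERIV_diff has_real_derivative_ddx d) auto
  then obtain s where s: "x < s" "s < x + h" "(u (x+h, y+h) - u (x+h, y)) - (u (x, y+h) - u (x, y))
      = h * (ddx u (s, y+h) - ddx u (s, y))"
    by auto
  have "\<exists>t. y < t \<and> t < y + h \<and> ddx u (s, y+h) - ddx u (s, y) = (y + h - y) * ddy (ddx u) (s, t)"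
    using h s(1,2) by (intro MVT2 has_real_derivative_ddy d) auto
  then obtain t where "y < t" "t < y + h" "ddx u (s, y+h) - ddx u (s, y) = h * ddy (ddx u) (s, t)"
    by auto
  with s show ?thesis
    by (intro exI[of _ s] exI[of _ t]) auto
qed

lemma second_difference_yx:
  assumes u: "smooth_on U u" and h: "h > 0" and sub: "{x..x+h} \<times> {y..y+h} \<subseteq> U"
  shows "\<exists>s t. s \<in> {x..x+h} \<and> t \<in> {y..y+h} \<and>
    u (x+h, y+h) - u (x+h, y) - u (x, y+h) + u (x, y) = h * h * ddx (ddy u) (s, t)"
proof -
  have d: "u differentiable (at q)" "ddy u differentiable (at q)" if "q \<in> {x..x+h} \<times> {y..y+h}" for q
    using smooth_on_differentiable[OF u] smooth_on_differentiable[OF smooth_on_ddy[OF u]] that sub by auto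
  have "\<exists>t. y < t \<and> t < y + h \<and> (u (x+h, y+h) - u (x, y+h)) - (u (x+h, y) - u (x, y))
      = (y + h - y) * (ddy u (x+h, t) - ddy u (x, t))"
    using h by (intro MVT2 DERIV_diff has_real_derivative_ddy d) auto
  then obtain t where t: "y < t" "t < y + h" "(u (x+h, y+h) - u (x, y+h)) - (u (x+h, y) - u (x, y))
      = h * (ddy u (x+h, t) - ddy u (x, t))"
    by auto
  have "\<exists>s. x < s \<and> s < x + h \<and> ddy u (x+h, t) - ddy u (x, t) = (x + h - x) * ddx (ddy u) (s, t)"
    using h t(1,2) by (intro MVT2 has_real_derivative_ddx d) auto
  then obtain s where "x < s" "s < x + h" "ddy u (x+h, t) - ddy u (x, t) = h * ddx (ddy u) (s, t)"
    by auto
  with t show ?thesis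
    by (intro exI[of _ s] exI[of _ t]) auto
qed

lemma ddx_ddy_commute:
  assumes U: "open U" and u: "smooth_on U u" and p: "p \<in> U"
  shows "ddx (ddy u) p = ddy (ddx u) p"
proof (rule ccontr)
  assume ne: "ddx (ddy u) p \<noteq> ddy (ddx u) p"
  \<comment> \<open>Half the gap: two numbers within \<open>e\<close> of the two mixed partials at
    \<open>p\<close> cannot coincide.\<close>
  define e where "e = \<bar>ddx (ddy u) p - ddy (ddx u) p\<bar> / 2"
  have e: "e > 0"
    using ne by (simp add: e_def)
  have c: "continuous_on U (ddx (ddy u))" "continuous_on U (ddy (ddx u))"
    by (intro smooth_on_continuous_on smooth_on_ddx smooth_on_ddy u)+
  obtain r1 where r1: "r1 > 0" "\<And>q. q \<in> U \<Longrightarrow> dist q p < r1 \<Longrightarrow> dist (ddx (ddy u) q) (ddx (ddy u) p) < e"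
    using c(1) p e unfolding continuous_on_iff by meson
  obtain r2 where r2: "r2 > 0" "\<And>q. q \<in> U \<Longrightarrow> dist q p < r2 \<Longrightarrow> dist (ddy (ddx u) q) (ddy (ddx u) p) < e"
    using c(2) p e unfolding continuous_on_iff by meson
  obtain r3 where r3: "r3 > 0" "ball p r3 \<subseteq> U"
    using U p open_contains_ball by blast
  \<comment> \<open>Points of the square of side \<open>h\<close> are at distance at most
    \<open>2 * h\<close> from \<open>p\<close>, hence within all three radii.\<close>
  define h where "h = min (min r1 r2) r3 / 3"
  have h: "h > 0" "3 * h \<le> r1" "3 * h \<le> r2" "3 * h \<le> r3"
    using r1 r2 r3 by (auto simp: h_def)
  obtain x y where xy: "p = (x, y)"
    by (cases p)
  have near: "dist q p < 3 * h" if "q \<in> {x..x+h} \<times> {y..y+h}" for q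
  proof -
    have "dist q p \<le> \<bar>fst q - x\<bar> + \<bar>snd q - y\<bar>"
      unfolding xy dist_prod_def by (cases q) (simp add: dist_real_def sqrt_sum_squares_le_sum_abs)
    also have "\<dots> \<le> h + h"
      using that by auto
    finally show ?thesis
      using h(1) by linarith
  qed
  have sub: "{x..x+h} \<times> {y..y+h} \<subseteq> U"
  proof
    fix q assume "q \<in> {x..x+h} \<times> {y..y+h}"
    from near[OF this] have "q \<in> ball p r3"
      using h(4) by (simp add: dist_commute)
    with r3(2) show "q \<in> U"
      by blast
  qed
  obtain s t where 1: "s \<in> {x..x+h}" "t \<in> {y..y+h}"
    "u (x+h, y+h) - u (x+h, y) - u (x, y+h) + u (x, y) = h * h * ddy (ddx u) (s, t)"
    using second_difference_xy[OF u h(1) sub] by blast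
  obtain s' t' where 2: "s' \<in> {x..x+h}" "t' \<in> {y..y+h}"
    "u (x+h, y+h) - u (x+h, y) - u (x, y+h) + u (x, y) = h * h * ddx (ddy u) (s', t')"
    using second_difference_yx[OF u h(1) sub] by blast
  have q: "(s, t) \<in> {x..x+h} \<times> {y..y+h}" "(s', t') \<in> {x..x+h} \<times> {y..y+h}"
    using 1 2 by auto
  have "h * h * ddy (ddx u) (s, t) = h * h * ddx (ddy u) (s', t')"
    using 1(3) 2(3) by linarith
  then have "ddy (ddx u) (s, t) = ddx (ddy u) (s', t')"
    using h(1) by simp
  moreover have "\<bar>ddy (ddx u) (s, t) - ddy (ddx u) p\<bar> < e"
    using r2(2)[of "(s, t)"] near[OF q(1)] q(1) sub h(3) unfolding dist_real_def by force
  moreover have "\<bar>ddx (ddy u) (s', t') - ddx (ddy u) p\<bar> < e"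
    using r1(2)[of "(s', t')"] near[OF q(2)] q(2) sub h(2) unfolding dist_real_def by force
  ultimately show False
    unfolding e_def by (auto simp: abs_if split: if_splits)
qed

section \<open>Picard iteration\<close>

text \<open>Banach's fixed point theorem for the supremum distance on continuous maps from
  \<open>K\<close> to \<open>C\<close>. Stating the contraction with a pointwise bound
  \<open>d\<close> avoids a separate function space.\<close>

lemma contraction_fixed_point_on_compact:
  fixes \<Phi> :: "('a::topological_space \<Rightarrow> 'b::banach) \<Rightarrow> 'a \<Rightarrow> 'b"
  assumes K: "compact K" and C: "closed C" and c: "c \<in> C"
    and cont: "\<And>g. continuous_on K g \<Longrightarrow> g ` K \<subseteq> C \<Longrightarrow> continuous_on K (\<Phi> g)"
    and into: "\<And>g. continuous_on K g \<Longrightarrow> g ` K \<subseteq> C \<Longrightarrow> \<Phi> g ` K \<subseteq> C"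
    and contr: "\<And>g h d x. continuous_on K g \<Longrightarrow> g ` K \<subseteq> C \<Longrightarrow> continuous_on K h \<Longrightarrow> h ` K \<subseteq> C \<Longrightarrow>
      (\<And>x. x \<in> K \<Longrightarrow> norm (g x - h x) \<le> d) \<Longrightarrow> x \<in> K \<Longrightarrow> norm (\<Phi> g x - \<Phi> h x) \<le> d / 2"
  shows "\<exists>g. continuous_on K g \<and> g ` K \<subseteq> C \<and> (\<forall>x\<in>K. \<Phi> g x = g x)"
proof -
  define G where "G n = (\<Phi> ^^ n) (\<lambda>_. c)" for n
  have G0: "G 0 = (\<lambda>_. c)" and GS: "G (Suc n) = \<Phi> (G n)" for n
    by (simp_all add: G_def)
  have G: "continuous_on K (G n) \<and> G n ` K \<subseteq> C" for n
    by (induction n) (use c cont into in \<open>auto simp: G0 GS\<close>)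
  have "bounded ((\<lambda>x. G 1 x - G 0 x) ` K)"
    using G by (intro compact_imp_bounded compact_continuous_image K continuous_intros) auto
  then obtain D where D: "\<And>x. x \<in> K \<Longrightarrow> norm (G 1 x - G 0 x) \<le> D"
    unfolding bounded_iff by auto
  have step: "norm (G (Suc n) x - G n x) \<le> D / 2 ^ n" if "x \<in> K" for n x
    using that
  proof (induction n arbitrary: x)
    case 0
    then show ?case
      using D by simp
  next
    case (Suc n)
    have "norm (\<Phi> (G (Suc n)) x - \<Phi> (G n) x) \<le> D / 2 ^ n / 2"
      by (rule contr) (use G Suc in auto)
    then show ?case
      by (simp add: GS[of "Suc n"] GS[of n] field_simps)
  qed
  have "summable (\<lambda>n. D * (1/2) ^ n)"
    by (intro summable_mult summable_geometric) simp
  then have sm: "summable (\<lambda>n. D / 2 ^ n)"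
    by (simp add: power_one_over)
  \<comment> \<open>The iterates are partial sums of a telescoping series whose terms decay
    geometrically, so they converge uniformly and the limit is continuous.\<close>
  define l where "l x = suminf (\<lambda>i. G (Suc i) x - G i x)" for x
  have "uniform_limit K (\<lambda>n x. \<Sum>i<n. G (Suc i) x - G i x) l sequentially"
    unfolding l_def by (rule Weierstrass_m_test[OF _ sm]) (rule step)
  then have ul: "uniform_limit K (\<lambda>n x. G n x - c) l sequentially"
    by (simp only: sum_lessThan_telescope[of "\<lambda>i. G i _"] G0)
  have close: "\<exists>N. \<forall>n\<ge>N. \<forall>x\<in>K. norm (G n x - (l x + c)) < e" if "e > 0" for e
  proof -
    from uniform_limitD[OF ul that] obtain N where "\<forall>n\<ge>N. \<forall>x\<in>K. dist (G n x - c) (l x) < e"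
      unfolding eventually_sequentially by blast
    then show ?thesis
      by (intro exI[of _ N]) (simp add: dist_norm algebra_simps)
  qed
  have lim: "(\<lambda>n. G n x) \<longlonglongrightarrow> l x + c" if "x \<in> K" for x
  proof (rule LIMSEQ_I)
    show "\<exists>N. \<forall>n\<ge>N. norm (G n x - (l x + c)) < e" if "e > 0" for e
      using close[OF that] \<open>x \<in> K\<close> by blast
  qed
  have "continuous_on K l"
    by (rule uniform_limit_theorem[OF _ ul])
      (use G in \<open>auto intro!: always_eventually continuous_intros\<close>)
  then have gc: "continuous_on K (\<lambda>x. l x + c)"
    by (intro continuous_intros)
  have gC: "(\<lambda>x. l x + c) ` K \<subseteq> C"
  proof
    fix y assume "y \<in> (\<lambda>x. l x + c) ` K"
    then obtain x where x: "x \<in> K" "y = l x + c"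
      by auto
    show "y \<in> C"
      unfolding x(2) by (rule closed_sequentially[OF C _ lim[OF x(1)]]) (use G x(1) in auto)
  qed
  have "\<Phi> (\<lambda>x. l x + c) x = l x + c" if x: "x \<in> K" for x
  proof (rule LIMSEQ_unique)
    show "(\<lambda>n. G (Suc n) x) \<longlonglongrightarrow> l x + c"
      using lim[OF x] by (rule LIMSEQ_Suc)
    show "(\<lambda>n. G (Suc n) x) \<longlonglongrightarrow> \<Phi> (\<lambda>x. l x + c) x"
    proof (rule LIMSEQ_I)
      fix e :: real assume e: "e > 0"
      obtain N where N: "\<And>n x. n \<ge> N \<Longrightarrow> x \<in> K \<Longrightarrow> norm (G n x - (l x + c)) < e"
        using close[OF e] by blast
      have "norm (G (Suc n) x - \<Phi> (\<lambda>x. l x + c) x) < e" if "n \<ge> N" for n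
      proof -
        have "norm (\<Phi> (G n) x - \<Phi> (\<lambda>x. l x + c) x) \<le> e / 2"
          by (rule contr) (use G gc gC x N[OF that] in \<open>auto intro: less_imp_le\<close>)
        then show ?thesis
          using e by (simp add: GS)
      qed
      then show "\<exists>N. \<forall>n\<ge>N. norm (G (Suc n) x - \<Phi> (\<lambda>x. l x + c) x) < e"
        by blast
    qed
  qed
  with gc gC show ?thesis
    by blast
qed

text \<open>The integral of \<open>g\<close> from \<open>c\<close> to \<open>x\<close>, written so that \<open>x < c\<close> needs no separate treatment and
  parameters can be handled by integrating over the fixed interval \<open>{0..1}\<close>.\<close>

definition integral_from :: "real \<Rightarrow> (real \<Rightarrow> 'b::banach) \<Rightarrow> real \<Rightarrow> 'b"
  where "integral_from c g x = (x - c) *\<^sub>R integral {0..1} (\<lambda>t. g (c + t * (x - c)))"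

lemma segment_in_interval:
  fixes a b c x t :: real
  assumes "c \<in> {a..b}" "x \<in> {a..b}" "t \<in> {0..1}"
  shows "c + t * (x - c) \<in> {a..b}"
proof -
  have "convex {a..b}"
    by simp
  from convexD_alt[OF this assms(1,2)] assms(3) have "(1 - t) * c + t * x \<in> {a..b}"
    by auto
  then show ?thesis
    by (simp add: algebra_simps)
qed

lemma continuous_on_segment:
  fixes a b c x :: real
  assumes "continuous_on {a..b} g" "c \<in> {a..b}" "x \<in> {a..b}"
  shows "continuous_on {0..1} (\<lambda>t. g (c + t * (x - c)))"
  by (rule continuous_on_compose2[OF assms(1)])
    (auto intro!: continuous_intros simp del: atLeastAtMost_iff simp: segment_in_interval assms)

lemma integral_from_self [simp]: "integral_from c g c = 0"
  by (simp add: integral_from_def)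

lemma integral_from_diff:
  assumes "continuous_on {a..b} g" "continuous_on {a..b} h" "c \<in> {a..b}" "x \<in> {a..b}"
  shows "integral_from c (\<lambda>t. g t - h t) x = integral_from c g x - integral_from c h x"
  unfolding integral_from_def scaleR_diff_right[symmetric]
  by (subst Henstock_Kurzweil_Integration.integral_diff)
    (intro integrable_continuous_real continuous_on_segment[of a b] assms refl)+

lemma integral_from_cong:
  assumes "\<And>t. t \<in> {a..b} \<Longrightarrow> g t = h t" "c \<in> {a..b}" "x \<in> {a..b}"
  shows "integral_from c g x = integral_from c h x"
  unfolding integral_from_def
  by (intro arg_cong[of _ _ "\<lambda>y. (x - c) *\<^sub>R y"] Henstock_Kurzweil_Integration.integral_cong
      assms(1) segment_in_interval assms)

lemma norm_integral_from_le:
  assumes "continuous_on {a..b} g" "c \<in> {a..b}" "x \<in> {a..b}" "\<And>t. t \<in> {a..b} \<Longrightarrow> norm (g t) \<le> B"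
  shows "norm (integral_from c g x) \<le> \<bar>x - c\<bar> * B"
proof -
  have "norm (integral {0..1} (\<lambda>t. g (c + t * (x - c)))) \<le> B * (1 - 0)"
    by (rule integral_bound) (auto intro!: continuous_on_segment[OF assms(1-3)] assms(4)
        segment_in_interval[OF assms(2,3)] simp del: atLeastAtMost_iff)
  then show ?thesis
    by (simp add: integral_from_def mult_left_mono)
qed

lemma integral_from_antiderivative:
  assumes G: "\<And>t. t \<in> {a..b} \<Longrightarrow> (G has_vector_derivative g t) (at t within {a..b})"
    and "c \<in> {a..b}" "x \<in> {a..b}"
  shows "integral_from c g x = G x - G c"
proof -
  have "((\<lambda>t. (x - c) *\<^sub>R g (c + t * (x - c))) has_integral
      (G (c + 1 * (x - c)) - G (c + 0 * (x - c)))) {0..1}"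
  proof (rule fundamental_theorem_of_calculus)
    fix t :: real assume t: "t \<in> {0..1}"
    have sub: "(\<lambda>t. c + t * (x - c)) ` {0..1} \<subseteq> {a..b}"
      using segment_in_interval assms by blast
    have "((\<lambda>t. c + t * (x - c)) has_vector_derivative (x - c)) (at t within {0..1})"
      by (auto intro!: derivative_eq_intros)
    from vector_diff_chain_within[OF this has_vector_derivative_within_subset[OF G sub]]
    show "((\<lambda>t. G (c + t * (x - c))) has_vector_derivative (x - c) *\<^sub>R g (c + t * (x - c)))
        (at t within {0..1})"
      using segment_in_interval[OF assms(2,3) t] by (simp add: o_def)
  qed simp
  then show ?thesis
    by (simp add: integral_from_def integral_unique flip: integral_cmul)
qed

lemma has_vector_derivative_integral_from:
  assumes g: "continuous_on {a..b} g" and "c \<in> {a..b}" "x \<in> {a..b}"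
  shows "(integral_from c g has_vector_derivative g x) (at x within {a..b})"
proof -
  let ?G = "\<lambda>u. integral {a..u} g"
  have "((\<lambda>u. ?G u - ?G c) has_vector_derivative g x - 0) (at x within {a..b})"
    by (intro has_vector_derivative_diff has_vector_derivative_const
        integral_has_vector_derivative[OF g assms(3)])
  moreover have "integral_from c g u = ?G u - ?G c" if "u \<in> {a..b}" for u
    by (rule integral_from_antiderivative[OF integral_has_vector_derivative[OF g] assms(2) that])
  ultimately show ?thesis
    using has_vector_derivative_transform[of x "{a..b}" "integral_from c g" "\<lambda>u. ?G u - ?G c" "g x"]
      assms(3) by (simp del: atLeastAtMost_iff)
qed

lemma continuous_on_integral_from:
  "continuous_on {a..b} g \<Longrightarrow> c \<in> {a..b} \<Longrightarrow> continuous_on {a..b} (integral_from c g)"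
  by (rule continuous_on_vector_derivative) (rule has_vector_derivative_integral_from)

text \<open>The Picard-Lindelof theorem: the curve is a fixed point of the integral operator on a
  short symmetric time interval.\<close>

lemma integral_curve_exists:
  fixes T :: "'a::banach \<Rightarrow> 'a"
  assumes d: "d > 0" and L: "L > 0"
    and lip: "\<And>p p'. p \<in> cball q d \<Longrightarrow> p' \<in> cball q d \<Longrightarrow> norm (T p - T p') \<le> L * norm (p - p')"
  shows "\<exists>r \<gamma>. r > 0 \<and> \<gamma> 0 = q \<and> (\<forall>t\<in>{-r..r}. \<gamma> t \<in> cball q d \<and>
    (\<gamma> has_vector_derivative T (\<gamma> t)) (at t within {-r..r}))"
proof -
  define B where "B = norm (T q) + L * d"
  have T_bound: "norm (T p) \<le> B" if "p \<in> cball q d" for p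
  proof -
    have "norm (T p) \<le> norm (T q) + norm (T p - T q)"
      by (metis add.commute diff_add_cancel norm_triangle_ineq)
    also have "norm (T p - T q) \<le> L * norm (p - q)"
      by (rule lip) (use that d in auto)
    also have "L * norm (p - q) \<le> L * d"
      using that L by (intro mult_left_mono) (auto simp: dist_norm norm_minus_commute)
    finally show ?thesis
      by (simp add: B_def)
  qed
  have B: "B > 0"
    unfolding B_def using L d by (intro add_nonneg_pos) auto
  have Tc: "continuous_on (cball q d) T"
  proof (rule lipschitz_on_continuous_on)
    show "L-lipschitz_on (cball q d) T"
      by (rule lipschitz_onI) (use lip L in \<open>auto simp: dist_norm\<close>)
  qed
  \<comment> \<open>The first bound keeps the iterates in the ball, since \<open>B\<close> bounds
    the speed there; the second makes the integral operator halve distances.\<close>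
  define r where "r = min (d / B) (1 / (2 * L))"
  have r: "r > 0" "r * B \<le> d" "r * L \<le> 1 / 2"
    using d B L by (auto simp: r_def min_def field_simps)
  let ?K = "{-r..r}" and ?C = "cball q d"
  have 0: "0 \<in> ?K"
    using r by simp
  have Tg: "continuous_on ?K (\<lambda>t. T (g t))" if "continuous_on ?K g" "g ` ?K \<subseteq> ?C" for g
    by (rule continuous_on_compose2[OF Tc that])
  let ?\<Phi> = "\<lambda>g t. q + integral_from 0 (\<lambda>s. T (g s)) t"
  have "\<exists>g. continuous_on ?K g \<and> g ` ?K \<subseteq> ?C \<and> (\<forall>t\<in>?K. ?\<Phi> g t = g t)"
  proof (rule contraction_fixed_point_on_compact)
    show "q \<in> ?C"
      using d by simp
    show "continuous_on ?K (?\<Phi> g)" if g: "continuous_on ?K g" "g ` ?K \<subseteq> ?C" for g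
      by (intro continuous_on_add continuous_on_const continuous_on_integral_from[OF Tg[OF g] 0])
    show "?\<Phi> g ` ?K \<subseteq> ?C" if g: "continuous_on ?K g" "g ` ?K \<subseteq> ?C" for g
    proof
      fix p assume "p \<in> ?\<Phi> g ` ?K"
      then obtain t where t: "t \<in> ?K" "p = ?\<Phi> g t"
        by blast
      have "norm (integral_from 0 (\<lambda>s. T (g s)) t) \<le> \<bar>t - 0\<bar> * B"
        by (rule norm_integral_from_le[OF Tg[OF g] 0 t(1) T_bound]) (use g in blast)
      also have "\<dots> \<le> r * B"
        using t(1) B by (intro mult_right_mono) auto
      finally show "p \<in> ?C"
        using r(2) t(2) by (simp add: dist_norm)
    qed
    show "norm (?\<Phi> g t - ?\<Phi> h t) \<le> e / 2"
      if g: "continuous_on ?K g" "g ` ?K \<subseteq> ?C" and h: "continuous_on ?K h" "h ` ?K \<subseteq> ?C"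
        and e: "\<And>t. t \<in> ?K \<Longrightarrow> norm (g t - h t) \<le> e" and t: "t \<in> ?K" for g h e t
    proof -
      have e0: "0 \<le> e"
        using e[OF 0] norm_ge_zero order_trans by blast
      have "?\<Phi> g t - ?\<Phi> h t = integral_from 0 (\<lambda>s. T (g s) - T (h s)) t"
        by (simp add: integral_from_diff[OF Tg[OF g] Tg[OF h] 0 t])
      also have "norm \<dots> \<le> \<bar>t - 0\<bar> * (L * e)"
      proof (rule norm_integral_from_le[OF _ 0 t])
        show "continuous_on ?K (\<lambda>s. T (g s) - T (h s))"
          by (intro continuous_intros Tg g h)
        show "norm (T (g s) - T (h s)) \<le> L * e" if s: "s \<in> ?K" for s
        proof -
          have "norm (T (g s) - T (h s)) \<le> L * norm (g s - h s)"
            by (rule lip) (use g(2) h(2) s in blast)+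
          also have "\<dots> \<le> L * e"
            using L e[OF s] by (intro mult_left_mono) auto
          finally show ?thesis .
        qed
      qed
      also have "\<dots> \<le> r * (L * e)"
        using t e0 L by (intro mult_right_mono) auto
      also have "\<dots> \<le> 1 / 2 * e"
        using mult_right_mono[OF r(3) e0] by (simp add: mult.assoc)
      finally show ?thesis
        by simp
    qed
  qed auto
  then obtain g where g: "continuous_on ?K g" "g ` ?K \<subseteq> ?C" "\<And>t. t \<in> ?K \<Longrightarrow> ?\<Phi> g t = g t"
    by blast
  have "(g has_vector_derivative T (g t)) (at t within ?K)" if t: "t \<in> ?K" for t
  proof (rule has_vector_derivative_transform[OF t])
    have "(?\<Phi> g has_vector_derivative 0 + T (g t)) (at t within ?K)"
      by (rule has_vector_derivative_add[OF has_vector_derivative_const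
          has_vector_derivative_integral_from[OF Tg[OF g(1,2)] 0 t]])
    then show "(?\<Phi> g has_vector_derivative T (g t)) (at t within ?K)"
      by simp
  qed (simp add: g(3))
  moreover have "g 0 = q"
    using g(3)[OF 0] by simp
  ultimately show ?thesis
    using r(1) g(2) by (intro exI[of _ r] exI[of _ g]) auto
qed

text \<open>A Gronwall argument: the weight \<open>exp (- 2 * C * t)\<close> makes the squared norm
  of \<open>w\<close> nonincreasing, and it starts at zero.\<close>

lemma linear_growth_zero:
  fixes w :: "real \<Rightarrow> 'a::real_inner"
  assumes w: "\<And>t. t \<in> {0..1} \<Longrightarrow> (w has_vector_derivative w' t) (at t)"
    and bound: "\<And>t. t \<in> {0..1} \<Longrightarrow> norm (w' t) \<le> C * norm (w t)"
    and "w 0 = 0" and t: "t \<in> {0..1}"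
  shows "w t = 0"
proof -
  let ?n = "\<lambda>t. exp (- 2 * C * t) * (w t \<bullet> w t)"
  have "?n t \<le> ?n 0"
  proof (rule DERIV_nonpos_imp_nonincreasing[of 0 t ?n])
    fix s assume "0 \<le> s" "s \<le> t"
    then have s: "s \<in> {0..1}"
      using t by simp
    have "((\<lambda>t. w t \<bullet> w t) has_real_derivative 2 * (w s \<bullet> w' s)) (at s)"
    proof -
      have "((\<lambda>t. w t \<bullet> w t) has_derivative (\<lambda>h. w s \<bullet> (h *\<^sub>R w' s) + (h *\<^sub>R w' s) \<bullet> w s)) (at s)"
        using w[OF s] unfolding has_vector_derivative_def by (intro has_derivative_inner)
      moreover have "(\<lambda>h. w s \<bullet> (h *\<^sub>R w' s) + (h *\<^sub>R w' s) \<bullet> w s) = (*) (2 * (w s \<bullet> w' s))"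
        by (rule ext) (simp add: inner_commute)
      ultimately show ?thesis
        by (simp add: has_field_derivative_def)
    qed
    then have deriv: "(?n has_real_derivative
        exp (- 2 * C * s) * (2 * (w s \<bullet> w' s)) + exp (- 2 * C * s) * (- 2 * C) * (w s \<bullet> w s)) (at s)"
      by (auto intro!: derivative_eq_intros)
    have "w s \<bullet> w' s \<le> norm (w s) * norm (w' s)"
      by (rule norm_cauchy_schwarz)
    also have "\<dots> \<le> norm (w s) * (C * norm (w s))"
      by (intro mult_left_mono bound s) auto
    finally have "w s \<bullet> w' s - C * (w s \<bullet> w s) \<le> 0"
      by (simp add: dot_square_norm power2_eq_square mult_ac)
    then have "exp (- 2 * C * s) * 2 * (w s \<bullet> w' s - C * (w s \<bullet> w s)) \<le> 0"
      by (intro mult_nonneg_nonpos) simp_all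
    then have "exp (- 2 * C * s) * (2 * (w s \<bullet> w' s)) + exp (- 2 * C * s) * (- 2 * C) * (w s \<bullet> w s) \<le> 0"
      by (simp add: algebra_simps)
    with deriv show "\<exists>y. (?n has_real_derivative y) (at s) \<and> y \<le> 0"
      by blast
  qed (use t in simp)
  then have "w t \<bullet> w t \<le> 0"
    using \<open>w 0 = 0\<close> by (simp add: mult_le_0_iff)
  from order_antisym[OF this inner_ge_zero] show ?thesis
    by simp
qed

section \<open>Compatible linear systems in the plane\<close>

lemma continuous_on_slice_x:
  assumes "continuous_on (X \<times> Y) g" "y \<in> Y"
  shows "continuous_on X (\<lambda>x. g (x, y))"
  by (rule continuous_on_compose2[OF assms(1)]) (use assms(2) in \<open>auto intro!: continuous_intros\<close>)

lemma continuous_on_slice_y: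
  assumes "continuous_on (X \<times> Y) g" "x \<in> X"
  shows "continuous_on Y (\<lambda>y. g (x, y))"
  by (rule continuous_on_compose2[OF assms(1)]) (use assms(2) in \<open>auto intro!: continuous_intros\<close>)

lemma continuous_on_integral_from_x:
  fixes g :: "real \<times> real \<Rightarrow> 'b::banach"
  assumes g: "continuous_on ({a..b} \<times> Y) g" and c: "c \<in> {a..b}"
  shows "continuous_on ({a..b} \<times> Y) (\<lambda>p. integral_from c (\<lambda>s. g (s, snd p)) (fst p))"
proof -
  have "continuous_on (({a..b} \<times> Y) \<times> cbox 0 1) (\<lambda>(p, t). g (c + t * (fst p - c), snd p))"
    unfolding split_beta
    by (rule continuous_on_compose2[OF g])
      (auto intro!: continuous_intros simp del: atLeastAtMost_iff simp: segment_in_interval[OF c])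
  from integral_continuous_on_param[OF this] show ?thesis
    unfolding integral_from_def by (auto intro!: continuous_intros)
qed

lemma continuous_on_integral_from_y:
  fixes g :: "real \<times> real \<Rightarrow> 'b::banach"
  assumes g: "continuous_on (X \<times> {a..b}) g" and c: "c \<in> {a..b}"
  shows "continuous_on (X \<times> {a..b}) (\<lambda>p. integral_from c (\<lambda>s. g (fst p, s)) (snd p))"
proof -
  have "continuous_on ((X \<times> {a..b}) \<times> cbox 0 1) (\<lambda>(p, t). g (fst p, c + t * (snd p - c)))"
    unfolding split_beta
    by (rule continuous_on_compose2[OF g])
      (auto intro!: continuous_intros simp del: atLeastAtMost_iff simp: segment_in_interval[OF c])
  from integral_continuous_on_param[OF this] show ?thesis
    unfolding integral_from_def by (auto intro!: continuous_intros)
qed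

lemma has_vector_derivative_integral_from_param:
  fixes g :: "real \<times> real \<Rightarrow> 'b::banach"
  assumes gx: "\<And>x y. x \<in> X \<Longrightarrow> y \<in> {a..b} \<Longrightarrow>
      ((\<lambda>x. g (x, y)) has_vector_derivative gx (x, y)) (at x within X)"
    and g: "continuous_on (X \<times> {a..b}) g" and cgx: "continuous_on (X \<times> {a..b}) gx"
    and X: "convex X" "x \<in> X" and c: "c \<in> {a..b}" and y: "y \<in> {a..b}"
  shows "((\<lambda>x. integral_from c (\<lambda>s. g (x, s)) y) has_vector_derivative
    integral_from c (\<lambda>s. gx (x, s)) y) (at x within X)"
proof -
  have 1: "((\<lambda>x. g (x, c + t * (y - c))) has_vector_derivative gx (x, c + t * (y - c))) (at x within X)"
    if "x \<in> X" "t \<in> cbox 0 1" for x t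
    using gx[OF that(1) segment_in_interval[OF c y]] that(2) by simp
  have 2: "(\<lambda>t. g (x, c + t * (y - c))) integrable_on cbox 0 1" if "x \<in> X" for x
    unfolding cbox_interval
    by (intro integrable_continuous_real continuous_on_segment[OF _ c y] continuous_on_slice_y[OF g that])
  have 3: "continuous_on (X \<times> cbox 0 1) (\<lambda>(x, t). gx (x, c + t * (y - c)))"
    unfolding split_beta
    by (rule continuous_on_compose2[OF cgx])
      (auto intro!: continuous_intros simp del: atLeastAtMost_iff simp: segment_in_interval[OF c y])
  have "((\<lambda>x. integral (cbox 0 1) (\<lambda>t. g (x, c + t * (y - c)))) has_vector_derivative
      integral (cbox 0 1) (\<lambda>t. gx (x, c + t * (y - c)))) (at x within X)"
    by (rule leibniz_rule_vector_derivative[OF 1 2 3 X(2,1)])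
  then show ?thesis
    unfolding integral_from_def cbox_interval
    by (rule bounded_linear.has_vector_derivative[OF bounded_linear_scaleR_right])
qed

lemma has_vector_derivative_ddx:
  fixes u :: "real \<times> real \<Rightarrow> 'b::real_normed_vector"
  assumes "(u has_derivative u') (at (x, y))"
  shows "((\<lambda>s. u (s, y)) has_vector_derivative u' (1, 0)) (at x)"
proof -
  have "((\<lambda>s. (s, y)) has_vector_derivative (1, 0)) (at x)"
    by (auto intro!: derivative_eq_intros)
  from vector_derivative_diff_chain_within[OF this has_derivative_at_withinI[OF assms]]
  show ?thesis
    by (simp add: o_def)
qed

lemma has_vector_derivative_ddy:
  fixes u :: "real \<times> real \<Rightarrow> 'b::real_normed_vector"
  assumes "(u has_derivative u') (at (x, y))"
  shows "((\<lambda>s. u (x, s)) has_vector_derivative u' (0, 1)) (at y)"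
proof -
  have "((\<lambda>s. (x, s)) has_vector_derivative (0, 1)) (at y)"
    by (auto intro!: derivative_eq_intros)
  from vector_derivative_diff_chain_within[OF this has_derivative_at_withinI[OF assms]]
  show ?thesis
    by (simp add: o_def)
qed

lemma has_vector_derivative_blinfun_apply:
  assumes "(A has_vector_derivative A') (at t within S)" "(u has_vector_derivative u') (at t within S)"
  shows "((\<lambda>t. blinfun_apply (A t) (u t)) has_vector_derivative
    blinfun_apply (A t) u' + blinfun_apply A' (u t)) (at t within S)"
  using bounded_bilinear.has_vector_derivative[OF bounded_bilinear_blinfun_apply assms] .

text \<open>Integrating first along the vertical line through the base point and then horizontally gives a
  solution \<open>\<psi>\<close> of the \<open>x\<close>-equation.  Its vertical continuation \<open>\<rho>\<close> from the line \<open>y = y0\<close> solves the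
  \<open>y\<close>-equation, and by compatibility \<open>\<psi> - \<rho>\<close> satisfies a homogeneous linear integral equation.\<close>

locale linear_system_rectangle =
  fixes A B Ay Bx :: "real \<times> real \<Rightarrow> 'v::banach \<Rightarrow>\<^sub>L 'v" and x0 y0 r m :: real
  assumes r: "0 < r" "r \<le> 1" and m: "0 \<le> m" "4 * m * r \<le> 1"
    and cont: "continuous_on ({x0-r..x0+r} \<times> {y0-r..y0+r}) A" "continuous_on ({x0-r..x0+r} \<times> {y0-r..y0+r}) B"
      "continuous_on ({x0-r..x0+r} \<times> {y0-r..y0+r}) Ay" "continuous_on ({x0-r..x0+r} \<times> {y0-r..y0+r}) Bx"
    and bound: "\<And>q. q \<in> {x0-r..x0+r} \<times> {y0-r..y0+r} \<Longrightarrow> norm (A q) \<le> m \<and> norm (B q) \<le> m \<and> norm (Ay q) \<le> m"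
    and Ay: "\<And>x y. x \<in> {x0-r..x0+r} \<Longrightarrow> y \<in> {y0-r..y0+r} \<Longrightarrow>
      ((\<lambda>y. A (x, y)) has_vector_derivative Ay (x, y)) (at y within {y0-r..y0+r})"
    and Bx: "\<And>x y. x \<in> {x0-r..x0+r} \<Longrightarrow> y \<in> {y0-r..y0+r} \<Longrightarrow>
      ((\<lambda>x. B (x, y)) has_vector_derivative Bx (x, y)) (at x within {x0-r..x0+r})"
    and compat: "\<And>q w. q \<in> {x0-r..x0+r} \<times> {y0-r..y0+r} \<Longrightarrow>
      blinfun_apply (Ay q) w + blinfun_apply (A q) (blinfun_apply (B q) w)
      = blinfun_apply (Bx q) w + blinfun_apply (B q) (blinfun_apply (A q) w)"
begin

abbreviation "X \<equiv> {x0-r..x0+r}"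
abbreviation "Y \<equiv> {y0-r..y0+r}"

lemma base: "x0 \<in> X" "y0 \<in> Y"
  using r by auto

lemma apply_continuous:
  "continuous_on (X \<times> Y) F \<Longrightarrow> continuous_on (X \<times> Y) g \<Longrightarrow>
    continuous_on (X \<times> Y) (\<lambda>p. blinfun_apply (F p) (g p))"
  by (rule bounded_bilinear.continuous_on[OF bounded_bilinear_blinfun_apply])

lemma apply_bound:
  assumes "norm (F :: 'v \<Rightarrow>\<^sub>L 'v) \<le> m" "norm w \<le> d"
  shows "norm (blinfun_apply F w) \<le> m * d"
  by (rule order_trans[OF norm_blinfun]) (intro mult_mono assms m norm_ge_zero)

text \<open>The assumption \<open>4 * m * r \<le> 1\<close> enters here. The Picard operator below
  contains two such integrals, and two quarters give the required contraction by one half.\<close>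

lemma integral_bound_quarter:
  assumes "continuous_on {c-r..c+r} g" "x \<in> {c-r..c+r}" "0 \<le> d"
    "\<And>t. t \<in> {c-r..c+r} \<Longrightarrow> norm (g t) \<le> m * d"
  shows "norm (integral_from c g x) \<le> d / 4"
proof -
  have "norm (integral_from c g x) \<le> \<bar>x - c\<bar> * (m * d)"
    by (rule norm_integral_from_le[OF assms(1) _ assms(2,4)]) (use r in auto)
  also have "\<dots> \<le> r * (m * d)"
    by (intro mult_right_mono mult_nonneg_nonneg m assms(3)) (use assms(2) in auto)
  also have "\<dots> \<le> d / 4"
    using mult_right_mono[OF m(2) assms(3)] by (simp add: mult_ac)
  finally show ?thesis .
qed

text \<open>The vertical and the horizontal integration are combined into one fixed point problem on
  the whole rectangle, so joint continuity in both variables comes with the fixed point.\<close>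

lemma integral_equation_solution:
  "\<exists>\<psi>. continuous_on (X \<times> Y) \<psi> \<and> (\<forall>x\<in>X. \<forall>y\<in>Y. \<psi> (x, y)
    = v + integral_from y0 (\<lambda>t. blinfun_apply (B (x0, t)) (\<psi> (x0, t))) y
        + integral_from x0 (\<lambda>s. blinfun_apply (A (s, y)) (\<psi> (s, y))) x)"
proof -
  let ?Iy = "\<lambda>g p. integral_from y0 (\<lambda>t. blinfun_apply (B (x0, t)) (g (x0, t))) (snd p)"
  let ?Ix = "\<lambda>g p. integral_from x0 (\<lambda>s. blinfun_apply (A (s, snd p)) (g (s, snd p))) (fst p)"
  let ?\<Phi> = "\<lambda>g p. v + ?Iy g p + ?Ix g p"
  have cx: "continuous_on X (\<lambda>s. blinfun_apply (A (s, y)) (g (s, y)))"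
    if "continuous_on (X \<times> Y) g" "y \<in> Y" for g y
    by (rule continuous_on_slice_x[OF apply_continuous[OF cont(1) that(1)] that(2)])
  have cy: "continuous_on Y (\<lambda>t. blinfun_apply (B (x0, t)) (g (x0, t)))"
    if "continuous_on (X \<times> Y) g" for g
    by (rule continuous_on_slice_y[OF apply_continuous[OF cont(2) that] base(1)])
  have "\<exists>\<psi>. continuous_on (X \<times> Y) \<psi> \<and> \<psi> ` (X \<times> Y) \<subseteq> UNIV \<and> (\<forall>p\<in>X \<times> Y. ?\<Phi> \<psi> p = \<psi> p)"
  proof (rule contraction_fixed_point_on_compact)
    show "compact (X \<times> Y)"
      by (intro compact_Times compact_Icc)
    show "continuous_on (X \<times> Y) (?\<Phi> g)" if g: "continuous_on (X \<times> Y) g" for g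
    proof (intro continuous_on_add continuous_on_const)
      show "continuous_on (X \<times> Y) (?Ix g)"
        by (rule continuous_on_integral_from_x[OF apply_continuous[OF cont(1) g] base(1)])
      show "continuous_on (X \<times> Y) (?Iy g)"
        by (rule continuous_on_compose2[OF continuous_on_integral_from[OF cy[OF g] base(2)]])
          (auto intro!: continuous_intros)
    qed
    show "norm (?\<Phi> g p - ?\<Phi> h p) \<le> d / 2"
      if g: "continuous_on (X \<times> Y) g" and h: "continuous_on (X \<times> Y) h"
        and d: "\<And>p. p \<in> X \<times> Y \<Longrightarrow> norm (g p - h p) \<le> d" and p: "p \<in> X \<times> Y" for g h d p
    proof -
      obtain x y where xy: "p = (x, y)" "x \<in> X" "y \<in> Y"
        using p by auto
      have d0: "0 \<le> d"
        using d[OF p] norm_ge_zero order_trans by blast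
      have gh: "continuous_on (X \<times> Y) (\<lambda>p. g p - h p)"
        by (intro continuous_on_diff g h)
      have 1: "?Iy g p - ?Iy h p = integral_from y0 (\<lambda>t. blinfun_apply (B (x0, t)) (g (x0, t) - h (x0, t))) y"
        using integral_from_diff[OF cy[OF g] cy[OF h] base(2) xy(3)]
        by (simp add: xy(1) blinfun.diff_right)
      have 2: "?Ix g p - ?Ix h p = integral_from x0 (\<lambda>s. blinfun_apply (A (s, y)) (g (s, y) - h (s, y))) x"
        using integral_from_diff[OF cx[OF g xy(3)] cx[OF h xy(3)] base(1) xy(2)]
        by (simp add: xy(1) blinfun.diff_right)
      have "norm (?Iy g p - ?Iy h p) \<le> d / 4"
        unfolding 1 using bound base(1)
        by (intro integral_bound_quarter cy[OF gh] xy(3) d0 apply_bound d) (auto simp del: atLeastAtMost_iff)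
      moreover have "norm (?Ix g p - ?Ix h p) \<le> d / 4"
        unfolding 2 using bound xy(3)
        by (intro integral_bound_quarter cx[OF gh] xy(2,3) d0 apply_bound d) (auto simp del: atLeastAtMost_iff)
      moreover have split: "?\<Phi> g p - ?\<Phi> h p = (?Iy g p - ?Iy h p) + (?Ix g p - ?Ix h p)"
        by (simp add: algebra_simps)
      moreover have "norm (?\<Phi> g p - ?\<Phi> h p) \<le> norm (?Iy g p - ?Iy h p) + norm (?Ix g p - ?Ix h p)"
        unfolding split by (rule norm_triangle_ineq)
      ultimately show ?thesis
        by linarith
    qed
  qed auto
  then obtain \<psi> where \<psi>: "continuous_on (X \<times> Y) \<psi>" "\<And>p. p \<in> X \<times> Y \<Longrightarrow> ?\<Phi> \<psi> p = \<psi> p"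
    by blast
  have "\<psi> (x, y) = ?\<Phi> \<psi> (x, y)" if "x \<in> X" "y \<in> Y" for x y
    by (rule \<psi>(2)[symmetric]) (use that in blast)
  with \<psi>(1) show ?thesis
    by (intro exI[of _ \<psi>]) simp
qed

lemma solution_on_rectangle:
  "\<exists>\<psi>. \<psi> (x0, y0) = v \<and> continuous_on (X \<times> Y) \<psi> \<and> (\<forall>x\<in>X. \<forall>y\<in>Y.
    ((\<lambda>x. \<psi> (x, y)) has_vector_derivative blinfun_apply (A (x, y)) (\<psi> (x, y))) (at x within X) \<and>
    ((\<lambda>y. \<psi> (x, y)) has_vector_derivative blinfun_apply (B (x, y)) (\<psi> (x, y))) (at y within Y))"
proof -
  obtain \<psi> where \<psi>c: "continuous_on (X \<times> Y) \<psi>" and eq: "\<And>x y. x \<in> X \<Longrightarrow> y \<in> Y \<Longrightarrow> \<psi> (x, y)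
    = v + integral_from y0 (\<lambda>t. blinfun_apply (B (x0, t)) (\<psi> (x0, t))) y
        + integral_from x0 (\<lambda>s. blinfun_apply (A (s, y)) (\<psi> (s, y))) x"
    using integral_equation_solution[of v] by blast
  let ?A = "\<lambda>p. blinfun_apply (A p)" and ?B = "\<lambda>p. blinfun_apply (B p)"
    and ?Ay = "\<lambda>p. blinfun_apply (Ay p)" and ?Bx = "\<lambda>p. blinfun_apply (Bx p)"
  have \<psi>x: "((\<lambda>x. \<psi> (x, y)) has_vector_derivative ?A (x, y) (\<psi> (x, y))) (at x within X)"
    if "x \<in> X" "y \<in> Y" for x y
  proof -
    let ?k = "v + integral_from y0 (\<lambda>t. ?B (x0, t) (\<psi> (x0, t))) y"
      and ?I = "integral_from x0 (\<lambda>s. ?A (s, y) (\<psi> (s, y)))"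
    have "((\<lambda>x. ?k + ?I x) has_vector_derivative 0 + ?A (x, y) (\<psi> (x, y))) (at x within X)"
      by (rule has_vector_derivative_add[OF has_vector_derivative_const has_vector_derivative_integral_from])
        (rule continuous_on_slice_x[OF apply_continuous[OF cont(1) \<psi>c] that(2)] base that)+
    then show ?thesis
      using has_vector_derivative_transform[of x X "\<lambda>x. \<psi> (x, y)" "\<lambda>x. ?k + ?I x"] that eq
      by (simp del: atLeastAtMost_iff)
  qed
  define \<rho> where "\<rho> p = \<psi> (fst p, y0) + integral_from y0 (\<lambda>t. ?B (fst p, t) (\<psi> (fst p, t))) (snd p)" for p
  have \<rho>c: "continuous_on (X \<times> Y) \<rho>"
    unfolding \<rho>_def
    by (intro continuous_on_add continuous_on_integral_from_y[OF apply_continuous[OF cont(2) \<psi>c] base(2)]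
        continuous_on_compose2[OF continuous_on_slice_x[OF \<psi>c base(2)] continuous_on_fst[OF continuous_on_id]]) auto
  have \<rho>y: "((\<lambda>y. \<rho> (x, y)) has_vector_derivative ?B (x, y) (\<psi> (x, y))) (at y within Y)"
    if "x \<in> X" "y \<in> Y" for x y
  proof -
    have "((\<lambda>y. \<psi> (x, y0) + integral_from y0 (\<lambda>t. ?B (x, t) (\<psi> (x, t))) y) has_vector_derivative
        0 + ?B (x, y) (\<psi> (x, y))) (at y within Y)"
      by (rule has_vector_derivative_add[OF has_vector_derivative_const has_vector_derivative_integral_from])
        (rule continuous_on_slice_y[OF apply_continuous[OF cont(2) \<psi>c] that(1)] base that)+
    then show ?thesis
      by (simp add: \<rho>_def)
  qed
  \<comment> \<open>The \<open>x\<close>-derivative of \<open>B \<psi>\<close>, in which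
    \<open>\<psi>_x = A \<psi>\<close> is already known.\<close>
  define D where "D p = ?B p (?A p (\<psi> p)) + ?Bx p (\<psi> p)" for p
  have Dc: "continuous_on (X \<times> Y) D"
    unfolding D_def by (intro continuous_on_add apply_continuous cont \<psi>c)
  have \<rho>x: "((\<lambda>x. \<rho> (x, y)) has_vector_derivative ?A (x, y0) (\<psi> (x, y0)) + integral_from y0 (\<lambda>t. D (x, t)) y)
      (at x within X)" if "x \<in> X" "y \<in> Y" for x y
  proof -
    have "((\<lambda>x. ?B (x, y) (\<psi> (x, y))) has_vector_derivative D (x, y)) (at x within X)"
      if "x \<in> X" "y \<in> Y" for x y
      using has_vector_derivative_blinfun_apply[OF Bx[OF that] \<psi>x[OF that]] by (simp add: D_def)
    from has_vector_derivative_integral_from_param[OF this apply_continuous[OF cont(2) \<psi>c] Dc _ that(1) base(2) that(2)]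
    have "((\<lambda>x. integral_from y0 (\<lambda>t. ?B (x, t) (\<psi> (x, t))) y) has_vector_derivative
        integral_from y0 (\<lambda>t. D (x, t)) y) (at x within X)"
      by simp
    from has_vector_derivative_add[OF \<psi>x[OF that(1) base(2)] this] show ?thesis
      by (simp add: \<rho>_def)
  qed
  define e where "e p = \<psi> p - \<rho> p" for p
  have ec: "continuous_on (X \<times> Y) e"
    unfolding e_def by (intro continuous_on_diff \<psi>c \<rho>c)
  \<comment> \<open>The \<open>x\<close>-derivative of the defect \<open>e\<close>, expressed
    through \<open>e\<close> alone; this is what makes the integral equation for \<open>e\<close>
    homogeneous.\<close>
  define E where "E p = ?A p (e p) - integral_from y0 (\<lambda>t. ?Ay (fst p, t) (e (fst p, t))) (snd p)" for p
  have ex: "((\<lambda>x. e (x, y)) has_vector_derivative E (x, y)) (at x within X)" if xy: "x \<in> X" "y \<in> Y" for x y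
  proof -
    \<comment> \<open>The \<open>y\<close>-derivative of \<open>\<rho>\<close> is
      \<open>B \<psi>\<close>, not \<open>B \<rho>\<close>, so \<open>A \<rho>\<close>
      differentiates to \<open>A B \<psi> + Ay \<rho>\<close>. By compatibility \<open>D\<close>
      equals \<open>A B \<psi> + Ay \<psi>\<close>, and the difference of the two is
      \<open>Ay e\<close>.\<close>
    have "((\<lambda>y. ?A (x, y) (\<rho> (x, y))) has_vector_derivative
        ?A (x, t) (?B (x, t) (\<psi> (x, t))) + ?Ay (x, t) (\<rho> (x, t))) (at t within Y)" if "t \<in> Y" for t
      by (rule has_vector_derivative_blinfun_apply[OF Ay[OF xy(1) that] \<rho>y[OF xy(1) that]])
    from integral_from_antiderivative[OF this base(2) xy(2)]
    have 1: "integral_from y0 (\<lambda>t. ?A (x, t) (?B (x, t) (\<psi> (x, t))) + ?Ay (x, t) (\<rho> (x, t))) y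
        = ?A (x, y) (\<rho> (x, y)) - ?A (x, y0) (\<rho> (x, y0))"
      by simp
    have "integral_from y0 (\<lambda>t. ?Ay (x, t) (e (x, t))) y
        = integral_from y0 (\<lambda>t. D (x, t) - (?A (x, t) (?B (x, t) (\<psi> (x, t))) + ?Ay (x, t) (\<rho> (x, t)))) y"
    proof (rule integral_from_cong[OF _ base(2) xy(2)])
      fix t assume t: "t \<in> Y"
      have "?Ay (x, t) (\<psi> (x, t)) + ?A (x, t) (?B (x, t) (\<psi> (x, t))) = D (x, t)"
        unfolding D_def using compat[of "(x, t)" "\<psi> (x, t)"] xy(1) t by (simp add: add.commute)
      then show "?Ay (x, t) (e (x, t)) = D (x, t) - (?A (x, t) (?B (x, t) (\<psi> (x, t))) + ?Ay (x, t) (\<rho> (x, t)))"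
        unfolding e_def blinfun.diff_right by (simp add: algebra_simps)
    qed
    also have "\<dots> = integral_from y0 (\<lambda>t. D (x, t)) y
        - integral_from y0 (\<lambda>t. ?A (x, t) (?B (x, t) (\<psi> (x, t))) + ?Ay (x, t) (\<rho> (x, t))) y"
      by (rule integral_from_diff[OF _ _ base(2) xy(2)])
        (rule continuous_on_slice_y[OF Dc xy(1)] continuous_on_add
          continuous_on_slice_y[OF apply_continuous[OF cont(1) apply_continuous[OF cont(2) \<psi>c]] xy(1)]
          continuous_on_slice_y[OF apply_continuous[OF cont(3) \<rho>c] xy(1)])+
    finally have 2: "integral_from y0 (\<lambda>t. ?Ay (x, t) (e (x, t))) y = integral_from y0 (\<lambda>t. D (x, t)) y
        - (?A (x, y) (\<rho> (x, y)) - ?A (x, y0) (\<rho> (x, y0)))"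
      by (simp only: 1)
    have 3: "\<rho> (x, y0) = \<psi> (x, y0)"
      by (simp add: \<rho>_def)
    have 4: "?A (x, y) (e (x, y)) = ?A (x, y) (\<psi> (x, y)) - ?A (x, y) (\<rho> (x, y))"
      by (simp add: e_def blinfun.diff_right)
    have "?A (x, y) (\<psi> (x, y)) - (?A (x, y0) (\<psi> (x, y0)) + integral_from y0 (\<lambda>t. D (x, t)) y) = E (x, y)"
      unfolding E_def fst_conv snd_conv 2 3 4 by simp
    with has_vector_derivative_diff[OF \<psi>x[OF xy] \<rho>x[OF xy]] show ?thesis
      by (simp add: e_def)
  qed
  have e0: "e (x0, y) = 0" if "y \<in> Y" for y
    using eq[OF base(1) that] eq[OF base] by (simp add: e_def \<rho>_def)
  have "X \<times> Y \<noteq> {}"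
    using base by blast
  moreover have "compact (X \<times> Y)"
    by (intro compact_Times compact_Icc)
  ultimately obtain q where q: "q \<in> X \<times> Y" "\<And>p. p \<in> X \<times> Y \<Longrightarrow> norm (e p) \<le> norm (e q)"
    using continuous_attains_sup[OF _ _ continuous_on_norm[OF ec]] by blast
  have Ec: "continuous_on (X \<times> Y) E"
    unfolding E_def
    by (intro continuous_on_diff apply_continuous cont ec
        continuous_on_integral_from_y[OF apply_continuous[OF cont(3) ec] base(2)])
  have E_bound: "norm (E p) \<le> m * norm (e q) + norm (e q) / 4" if p: "p \<in> X \<times> Y" for p
  proof -
    obtain x y where xy: "p = (x, y)" "x \<in> X" "y \<in> Y"
      using p by auto
    have "norm (?A p (e p)) \<le> m * norm (e q)"
      using bound[OF p] q(2)[OF p] by (intro apply_bound) auto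
    moreover have "norm (integral_from y0 (\<lambda>t. ?Ay (x, t) (e (x, t))) y) \<le> norm (e q) / 4"
      using bound q(2) xy(2)
      by (intro integral_bound_quarter continuous_on_slice_y[OF apply_continuous[OF cont(3) ec] xy(2)]
          xy(3) norm_ge_zero apply_bound) (auto simp del: atLeastAtMost_iff)
    ultimately show ?thesis
      unfolding E_def xy(1) fst_conv snd_conv by (intro order_trans[OF norm_triangle_ineq4 add_mono]) auto
  qed
  \<comment> \<open>At the maximum point \<open>q\<close> of the defect, integrating
    \<open>E\<close> from \<open>x0\<close> contributes one quarter by
    \<open>4 * m * r \<le> 1\<close> and another by \<open>r \<le> 1\<close>. So the maximum is at
    most half of itself and the defect vanishes.\<close>
  have "norm (e q) \<le> norm (e q) / 2"
  proof -
    obtain x y where xy: "q = (x, y)" "x \<in> X" "y \<in> Y"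
      using q by auto
    have "integral_from x0 (\<lambda>s. E (s, y)) x = e (x, y) - e (x0, y)"
      by (rule integral_from_antiderivative[OF ex[OF _ xy(3)] base(1) xy(2)])
    then have "norm (e q) = norm (integral_from x0 (\<lambda>s. E (s, y)) x)"
      using e0[OF xy(3)] xy(1) by simp
    also have "\<dots> \<le> \<bar>x - x0\<bar> * (m * norm (e q) + norm (e q) / 4)"
      by (rule norm_integral_from_le[OF continuous_on_slice_x[OF Ec xy(3)] base(1) xy(2) E_bound])
        (use xy(3) in blast)
    also have "\<dots> \<le> r * (m * norm (e q) + norm (e q) / 4)"
      using xy(2) m(1) by (intro mult_right_mono add_nonneg_nonneg mult_nonneg_nonneg) auto
    also have "\<dots> = (4 * m * r) * norm (e q) / 4 + r * norm (e q) / 4"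
      by (simp add: algebra_simps)
    also have "\<dots> \<le> 1 * norm (e q) / 4 + 1 * norm (e q) / 4"
      by (intro add_mono divide_right_mono mult_right_mono m(2) r(2)) auto
    finally show ?thesis
      by simp
  qed
  then have "norm (e q) \<le> 0"
    by simp
  then have "\<psi> p = \<rho> p" if "p \<in> X \<times> Y" for p
    using q(2)[OF that] by (simp add: e_def)
  then have \<psi>y: "((\<lambda>y. \<psi> (x, y)) has_vector_derivative ?B (x, y) (\<psi> (x, y))) (at y within Y)"
    if "x \<in> X" "y \<in> Y" for x y
    using has_vector_derivative_transform[of y Y "\<lambda>y. \<psi> (x, y)" "\<lambda>y. \<rho> (x, y)", OF that(2) _ \<rho>y[OF that]] that
    by (simp del: atLeastAtMost_iff)
  have "\<psi> (x0, y0) = v"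
    using eq[OF base] by simp
  with \<psi>c \<psi>x \<psi>y show ?thesis
    by blast
qed

end

section \<open>Local solvability and smoothness of compatible systems\<close>

lemma square_neighbourhood:
  assumes "open U" "(x0, y0) \<in> (U :: (real \<times> real) set)"
  shows "\<exists>R>0. {x0-R..x0+R} \<times> {y0-R..y0+R} \<subseteq> U"
proof -
  obtain e where e: "e > 0" "ball (x0, y0) e \<subseteq> U"
    using assms open_contains_ball by blast
  have "{x0-e/3..x0+e/3} \<times> {y0-e/3..y0+e/3} \<subseteq> ball (x0, y0) e"
  proof
    fix q assume q: "q \<in> {x0-e/3..x0+e/3} \<times> {y0-e/3..y0+e/3}"
    have "dist (x0, y0) q \<le> \<bar>fst q - x0\<bar> + \<bar>snd q - y0\<bar>"
      by (cases q) (simp add: dist_commute dist_prod_def dist_real_def sqrt_sum_squares_le_sum_abs abs_minus_commute)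
    also have "\<dots> \<le> e/3 + e/3"
      using q unfolding mem_Times_iff atLeastAtMost_iff by linarith
    finally show "q \<in> ball (x0, y0) e"
      using e(1) by simp
  qed
  with e show ?thesis
    by (intro exI[of _ "e/3"]) auto
qed

text \<open>The derivative of \<open>\<psi>\<close> is bilinear in the smooth coefficients and
  \<open>\<psi>\<close> itself, so each order of smoothness yields the next.\<close>

lemma smooth_solution:
  fixes A B :: "real \<times> real \<Rightarrow> 'v::real_normed_vector \<Rightarrow>\<^sub>L 'v"
  assumes N: "open N" and A: "smooth_on N A" and B: "smooth_on N B"
    and \<psi>: "\<And>q. q \<in> N \<Longrightarrow> (\<psi> has_derivative
      (\<lambda>h. fst h *\<^sub>R blinfun_apply (A q) (\<psi> q) + snd h *\<^sub>R blinfun_apply (B q) (\<psi> q))) (at q)"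
  shows "smooth_on N \<psi>"
  unfolding smooth_on_def
proof
  fix k show "Ck_on k N \<psi>"
  proof (induction k)
    case 0
    have "isCont \<psi> q" if "q \<in> N" for q
      by (rule has_derivative_continuous[OF \<psi>[OF that]])
    then show ?case
      by (simp add: continuous_at_imp_continuous_on)
  next
    case (Suc k)
    have "Ck_on k N A" "Ck_on k N B"
      using A B by (simp_all add: smooth_on_def)
    then show ?case
      by (intro Ck_on_Suc_has_derivativeI[OF N \<psi>] Ck_on_add[OF N]
          Ck_on_bounded_linear[OF bounded_linear_scaleR_right N]
          Ck_on_bounded_bilinear[OF bounded_bilinear_blinfun_apply N] Suc.IH) assumption+
  qed
qed

text \<open>The Frobenius theorem for linear systems. The neighbourhood is fixed before the initial
  value \<open>v\<close>, so that several solutions share one domain.\<close>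

proposition compatible_linear_system_solvable:
  fixes A B :: "real \<times> real \<Rightarrow> 'v::banach \<Rightarrow>\<^sub>L 'v"
  assumes U: "open U" and p: "p \<in> U" and A: "smooth_on U A" and B: "smooth_on U B"
    and compat: "\<And>q w. q \<in> U \<Longrightarrow>
      blinfun_apply (frechet_derivative A (at q) (0, 1)) w + blinfun_apply (A q) (blinfun_apply (B q) w)
      = blinfun_apply (frechet_derivative B (at q) (1, 0)) w + blinfun_apply (B q) (blinfun_apply (A q) w)"
  shows "\<exists>N. open N \<and> p \<in> N \<and> N \<subseteq> U \<and> (\<forall>v. \<exists>\<psi>. \<psi> p = v \<and> smooth_on N \<psi> \<and> (\<forall>q\<in>N. (\<psi> has_derivative
    (\<lambda>h. fst h *\<^sub>R blinfun_apply (A q) (\<psi> q) + snd h *\<^sub>R blinfun_apply (B q) (\<psi> q))) (at q)))"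
proof -
  obtain x0 y0 where p0: "p = (x0, y0)"
    by (cases p)
  let ?Ay = "\<lambda>q. frechet_derivative A (at q) (0, 1)" and ?Bx = "\<lambda>q. frechet_derivative B (at q) (1, 0)"
  obtain R where R: "R > 0" "{x0-R..x0+R} \<times> {y0-R..y0+R} \<subseteq> U"
    using square_neighbourhood[OF U p[unfolded p0]] by blast
  let ?S = "{x0-R..x0+R} \<times> {y0-R..y0+R}"
  have c: "continuous_on U A" "continuous_on U B" "continuous_on U ?Ay" "continuous_on U ?Bx"
    by (intro smooth_on_continuous_on smooth_on_derivative A B)+
  have "compact ?S"
    by (intro compact_Times compact_Icc)
  then have "\<exists>m. \<forall>q\<in>?S. norm (F q) \<le> m" if "continuous_on U F" for F :: "real \<times> real \<Rightarrow> 'v \<Rightarrow>\<^sub>L 'v"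
    using compact_imp_bounded[OF compact_continuous_image[OF continuous_on_subset[OF that R(2)]]]
    unfolding bounded_iff by blast
  from this[OF c(1)] this[OF c(2)] this[OF c(3)]
  obtain m1 m2 m3 where ms: "\<And>q. q \<in> ?S \<Longrightarrow> norm (A q) \<le> m1" "\<And>q. q \<in> ?S \<Longrightarrow> norm (B q) \<le> m2"
    "\<And>q. q \<in> ?S \<Longrightarrow> norm (?Ay q) \<le> m3"
    by blast
  define m where "m = max 1 (max m1 (max m2 m3))"
  have m: "m \<ge> 1" "m1 \<le> m" "m2 \<le> m" "m3 \<le> m"
    by (auto simp: m_def)
  \<comment> \<open>These are the size conditions of the rectangle locale: the rectangle stays in
    \<open>U\<close>, \<open>r \<le> 1\<close>, and \<open>4 * m * r \<le> 1\<close>.\<close>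
  define r where "r = min R (min 1 (1 / (4 * m)))"
  have r: "0 < r" "r \<le> 1" "r \<le> R" "r \<le> 1 / (4 * m)"
    using R(1) m(1) by (auto simp: r_def min_le_iff_disj divide_le_eq)
  have mr: "4 * m * r \<le> 1"
    using r(4) m(1) by (simp add: field_simps)
  let ?X = "{x0-r..x0+r}" and ?Y = "{y0-r..y0+r}"
  have XS: "?X \<times> ?Y \<subseteq> ?S"
    using r(3) by (auto simp del: atLeastAtMost_iff) auto
  have XU: "?X \<times> ?Y \<subseteq> U"
    using XS R(2) by (rule order_trans)
  interpret linear_system_rectangle A B ?Ay ?Bx x0 y0 r m
  proof
    show "norm (A q) \<le> m \<and> norm (B q) \<le> m \<and> norm (?Ay q) \<le> m" if "q \<in> ?X \<times> ?Y" for q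
      using ms[OF subsetD[OF XS that]] m by linarith
    show "((\<lambda>y. A (x, y)) has_vector_derivative ?Ay (x, y)) (at y within ?Y)"
      if "x \<in> ?X" "y \<in> ?Y" for x y
      by (rule has_vector_derivative_at_within[OF has_vector_derivative_ddy[OF
            smooth_on_has_derivative[OF A subsetD[OF XU SigmaI[OF that]]]]])
    show "((\<lambda>x. B (x, y)) has_vector_derivative ?Bx (x, y)) (at x within ?X)"
      if "x \<in> ?X" "y \<in> ?Y" for x y
      by (rule has_vector_derivative_at_within[OF has_vector_derivative_ddx[OF
            smooth_on_has_derivative[OF B subsetD[OF XU SigmaI[OF that]]]]])
  qed (use r mr m XU compat continuous_on_subset[OF c(1) XU] continuous_on_subset[OF c(2) XU]
      continuous_on_subset[OF c(3) XU] continuous_on_subset[OF c(4) XU] in auto)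
  define N where "N = {x0-r<..<x0+r} \<times> {y0-r<..<y0+r}"
  have N: "open N" "p \<in> N" "N \<subseteq> ?X \<times> ?Y"
    using r(1) by (auto simp: N_def p0 open_Times)
  have NU: "N \<subseteq> U"
    using N(3) XU by (rule order_trans)
  have "\<exists>\<psi>. \<psi> p = v \<and> smooth_on N \<psi> \<and> (\<forall>q\<in>N. (\<psi> has_derivative
    (\<lambda>h. fst h *\<^sub>R blinfun_apply (A q) (\<psi> q) + snd h *\<^sub>R blinfun_apply (B q) (\<psi> q))) (at q))" for v
  proof -
    obtain \<psi> where \<psi>: "\<psi> (x0, y0) = v" "continuous_on (?X \<times> ?Y) \<psi>"
      and x: "\<And>x y. x \<in> ?X \<Longrightarrow> y \<in> ?Y \<Longrightarrow>
        ((\<lambda>x. \<psi> (x, y)) has_vector_derivative blinfun_apply (A (x, y)) (\<psi> (x, y))) (at x within ?X)"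
      and y: "\<And>x y. x \<in> ?X \<Longrightarrow> y \<in> ?Y \<Longrightarrow>
        ((\<lambda>y. \<psi> (x, y)) has_vector_derivative blinfun_apply (B (x, y)) (\<psi> (x, y))) (at y within ?Y)"
      using solution_on_rectangle[of v] by blast
    have deriv: "(\<psi> has_derivative
      (\<lambda>h. fst h *\<^sub>R blinfun_apply (A q) (\<psi> q) + snd h *\<^sub>R blinfun_apply (B q) (\<psi> q))) (at q)"
      if q: "q \<in> N" for q
    proof -
      obtain a b where ab: "q = (a, b)" "a \<in> ?X" "b \<in> ?Y"
        using q N(3) by blast
      \<comment> \<open>The solution is so far known only to have partial derivatives. They combine
        to a total derivative because the one in \<open>y\<close>, namely \<open>B \<psi>\<close>,
        is jointly continuous.\<close>
      have "((\<lambda>(x, y). \<psi> (x, y)) has_derivative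
          (\<lambda>(tx, ty). tx *\<^sub>R blinfun_apply (A (a, b)) (\<psi> (a, b))
            + blinfun_apply (blinfun_scaleR_left (blinfun_apply (B (a, b)) (\<psi> (a, b)))) ty))
          (at (a, b) within ?X \<times> ?Y)"
      proof (rule has_derivative_partialsI)
        show "((\<lambda>x. \<psi> (x, b)) has_derivative (\<lambda>tx. tx *\<^sub>R blinfun_apply (A (a, b)) (\<psi> (a, b))))
            (at a within ?X)"
          using x[OF ab(2,3)] by (simp add: has_vector_derivative_def)
        show "((\<lambda>y. \<psi> (x, y)) has_derivative
            blinfun_apply (blinfun_scaleR_left (blinfun_apply (B (x, y)) (\<psi> (x, y))))) (at y within ?Y)"
          if "x \<in> ?X" "y \<in> ?Y" for x y
          using y[OF that] by (simp add: has_vector_derivative_def)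
        have "continuous_on (?X \<times> ?Y) (\<lambda>q. blinfun_scaleR_left (blinfun_apply (B q) (\<psi> q)))"
          by (intro bounded_linear.continuous_on[OF bounded_linear_blinfun_scaleR_left]
              apply_continuous continuous_on_subset[OF c(2) XU] \<psi>(2))
        then show "continuous (at (a, b) within ?X \<times> ?Y)
            (\<lambda>(x, y). blinfun_scaleR_left (blinfun_apply (B (x, y)) (\<psi> (x, y))))"
          using ab by (simp add: continuous_on_eq_continuous_within split_beta')
      qed (use ab in auto)
      then have "(\<psi> has_derivative
          (\<lambda>h. fst h *\<^sub>R blinfun_apply (A q) (\<psi> q) + snd h *\<^sub>R blinfun_apply (B q) (\<psi> q)))
          (at q within ?X \<times> ?Y)"
        by (simp add: ab(1) split_beta')
      then have "(\<psi> has_derivative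
          (\<lambda>h. fst h *\<^sub>R blinfun_apply (A q) (\<psi> q) + snd h *\<^sub>R blinfun_apply (B q) (\<psi> q))) (at q within N)"
        by (rule has_derivative_subset[OF _ N(3)])
      then show ?thesis
        using at_within_open[OF q N(1)] by simp
    qed
    have "smooth_on N \<psi>"
      by (rule smooth_solution[OF N(1) smooth_on_subset[OF A NU] smooth_on_subset[OF B NU] deriv])
    with \<psi>(1) deriv show ?thesis
      unfolding p0 by blast
  qed
  with N(1,2) NU show ?thesis
    by blast
qed

section \<open>Integral curves and leaves\<close>

text \<open>A smooth field is Lipschitz on a closed ball because its two partial derivatives are
  bounded there.\<close>

lemma smooth_integral_curve_exists:
  fixes T :: "real \<times> real \<Rightarrow> real \<times> real"
  assumes U: "open U" and q: "q \<in> U" and T: "smooth_on U T"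
  shows "\<exists>r \<gamma>. r > 0 \<and> \<gamma> 0 = q \<and> (\<forall>t\<in>{-r<..<r}. \<gamma> t \<in> U \<and> (\<gamma> has_vector_derivative T (\<gamma> t)) (at t))"
proof -
  obtain d where d: "d > 0" "cball q d \<subseteq> U"
    using U q open_contains_cball by blast
  let ?T' = "\<lambda>p. frechet_derivative T (at p)"
  have "\<exists>B. \<forall>p\<in>cball q d. norm (?T' p v) \<le> B" for v
    using compact_imp_bounded[OF compact_continuous_image[OF
        continuous_on_subset[OF smooth_on_continuous_on[OF smooth_on_derivative[OF T]] d(2)]
        compact_cball], of v]
    unfolding bounded_iff by blast
  from this[of "(1, 0)"] this[of "(0, 1)"] obtain B1 B2
    where B: "\<And>p. p \<in> cball q d \<Longrightarrow> norm (?T' p (1, 0)) \<le> B1"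
      "\<And>p. p \<in> cball q d \<Longrightarrow> norm (?T' p (0, 1)) \<le> B2"
    by blast
  have B0: "0 \<le> B1" "0 \<le> B2"
    using order_trans[OF norm_ge_zero B(1)[of q]] order_trans[OF norm_ge_zero B(2)[of q]] d(1) by simp_all
  \<comment> \<open>The summand 1 makes the Lipschitz constant positive, as
    \<open>integral_curve_exists\<close> demands.\<close>
  have onorm: "onorm (?T' p) \<le> B1 + B2 + 1" if p: "p \<in> cball q d" for p
  proof (rule onorm_bound)
    fix v :: "real \<times> real"
    have "T differentiable (at p)"
      using smooth_on_differentiable[OF T] p d(2) by blast
    then have "norm (?T' p v) \<le> \<bar>fst v\<bar> * norm (?T' p (1, 0)) + \<bar>snd v\<bar> * norm (?T' p (0, 1))"
      by (subst frechet_derivative_plane) (auto intro: order_trans[OF norm_triangle_ineq])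
    also have "\<dots> \<le> norm v * B1 + norm v * B2"
      using norm_fst_le[of "fst v" "snd v"] norm_snd_le[of "snd v" "fst v"]
      by (intro add_mono mult_mono B[OF p] B0) auto
    also have "\<dots> \<le> (B1 + B2 + 1) * norm v"
      by (simp add: algebra_simps)
    finally show "norm (?T' p v) \<le> (B1 + B2 + 1) * norm v" .
  qed (use B0 in simp)
  have lip: "norm (T p - T p') \<le> (B1 + B2 + 1) * norm (p - p')" if "p \<in> cball q d" "p' \<in> cball q d" for p p'
  proof -
    have "(T has_derivative ?T' x) (at x within cball q d)" if "x \<in> cball q d" for x
      by (rule has_derivative_at_withinI[OF smooth_on_has_derivative[OF T subsetD[OF d(2) that]]])
    from differentiable_bound[of "cball q d" T ?T' "B1 + B2 + 1" p p', OF convex_cball this] onorm that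
    show ?thesis
      by blast
  qed
  have "0 < B1 + B2 + 1"
    using B0 by simp
  from integral_curve_exists[OF d(1) this lip] obtain r \<gamma>
    where r: "r > 0" "\<gamma> 0 = q" "\<And>t. t \<in> {-r..r} \<Longrightarrow> \<gamma> t \<in> cball q d"
      "\<And>t. t \<in> {-r..r} \<Longrightarrow> (\<gamma> has_vector_derivative T (\<gamma> t)) (at t within {-r..r})"
    by blast
  have "\<gamma> t \<in> U \<and> (\<gamma> has_vector_derivative T (\<gamma> t)) (at t)" if "t \<in> {-r<..<r}" for t
    using r(3,4)[of t] d(2) that at_within_Icc_at[of "-r" t r] by auto
  with r(1,2) show ?thesis
    by blast
qed

text \<open>A \<open>leaf\<close> is defined by paths on the unit interval; the substitution
  \<open>t * s\<close> produces one, for negative \<open>s\<close> as well. It rescales the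
  velocity, which is why \<open>\<omega>\<close> has to vanish on all multiples of
  \<open>T p\<close>.\<close>

lemma integral_curve_in_leaf:
  fixes T :: "real \<times> real \<Rightarrow> real \<times> real"
  assumes \<omega>: "\<And>p c. p \<in> U \<Longrightarrow> \<omega> p (c *\<^sub>R T p) = 0" and T: "continuous_on U T"
    and \<gamma>: "\<gamma> 0 = q" "\<And>t. t \<in> {-r<..<r} \<Longrightarrow> \<gamma> t \<in> U"
      "\<And>t. t \<in> {-r<..<r} \<Longrightarrow> (\<gamma> has_vector_derivative T (\<gamma> t)) (at t)"
    and s: "s \<in> {-r<..<r}"
  shows "\<gamma> s \<in> leaf \<omega> U q"
proof -
  let ?\<delta> = "\<lambda>t. \<gamma> (t * s)"
  have ts: "t * s \<in> {-r<..<r}" if "t \<in> {0..1}" for t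
  proof -
    have "\<bar>t * s\<bar> \<le> 1 * \<bar>s\<bar>"
      unfolding abs_mult using that by (intro mult_right_mono) auto
    with s show ?thesis
      by auto
  qed
  have deriv: "(?\<delta> has_vector_derivative s *\<^sub>R T (?\<delta> t)) (at t)" if "t \<in> {0..1}" for t
  proof -
    have "((\<lambda>t. t * s) has_vector_derivative s) (at t)"
      by (auto intro!: derivative_eq_intros)
    from vector_diff_chain_at[OF this \<gamma>(3)[OF ts[OF that]]] show ?thesis
      by (simp add: o_def)
  qed
  have "continuous_on {0..1} ?\<delta>"
    by (rule continuous_at_imp_continuous_on)
      (use deriv has_vector_derivative_continuous in blast)
  then have "continuous_on {0..1} (\<lambda>t. T (?\<delta> t))"
    by (rule continuous_on_compose2[OF T]) (use ts \<gamma>(2) in blast)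
  then have cont: "continuous_on {0..1} (\<lambda>t. s *\<^sub>R T (?\<delta> t))"
    by (intro continuous_on_scaleR continuous_on_const)
  have "?\<delta> C1_differentiable_on {0..1}"
    unfolding C1_differentiable_on_def
    by (intro exI[of _ "\<lambda>t. s *\<^sub>R T (?\<delta> t)"] conjI ballI cont deriv)
  moreover have "\<omega> (?\<delta> t) (vector_derivative ?\<delta> (at t)) = 0" if "t \<in> {0..1}" for t
    unfolding vector_derivative_at[OF deriv[OF that]] by (rule \<omega>[OF \<gamma>(2)[OF ts[OF that]]])
  ultimately show ?thesis
    unfolding leaf_def using \<gamma>(1,2) ts by (intro CollectI exI[of _ ?\<delta>]) auto
qed

section \<open>The web function and the geodesic equation of the web\<close>

lemma dd_rules:
  assumes "u differentiable (at p)" "v differentiable (at p)"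
  shows dd_add: "ddx (\<lambda>q. u q + v q) p = ddx u p + ddx v p" "ddy (\<lambda>q. u q + v q) p = ddy u p + ddy v p"
    and dd_diff: "ddx (\<lambda>q. u q - v q) p = ddx u p - ddx v p" "ddy (\<lambda>q. u q - v q) p = ddy u p - ddy v p"
    and dd_mult: "ddx (\<lambda>q. u q * v q) p = ddx u p * v p + u p * ddx v p"
      "ddy (\<lambda>q. u q * v q) p = ddy u p * v p + u p * ddy v p"
  using dd_eqI[OF has_derivative_add[OF has_derivative_dd[OF assms(1)] has_derivative_dd[OF assms(2)]]]
    dd_eqI[OF has_derivative_diff[OF has_derivative_dd[OF assms(1)] has_derivative_dd[OF assms(2)]]]
    dd_eqI[OF has_derivative_mult[OF has_derivative_dd[OF assms(1)] has_derivative_dd[OF assms(2)]]]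
  by simp_all

lemma dd_uminus:
  assumes "u differentiable (at p)"
  shows "ddx (\<lambda>q. - u q) p = - ddx u p" "ddy (\<lambda>q. - u q) p = - ddy u p"
  using dd_eqI[OF has_derivative_minus[OF has_derivative_dd[OF assms]]] by simp_all

lemma dd_const: "ddx (\<lambda>q. c) p = 0" "ddy (\<lambda>q. c) p = 0"
  by (simp_all add: ddx_def ddy_def)

lemma dd_divide:
  assumes "u differentiable (at p)" "v differentiable (at p)" "v p \<noteq> 0"
  shows "ddx (\<lambda>q. u q / v q) p = (ddx u p * v p - u p * ddx v p) / (v p)^2"
    "ddy (\<lambda>q. u q / v q) p = (ddy u p * v p - u p * ddy v p) / (v p)^2"
proof -
  note deriv = has_derivative_divide[OF has_derivative_dd[OF assms(1)] has_derivative_dd[OF assms(2)] assms(3)]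
  show "ddx (\<lambda>q. u q / v q) p = (ddx u p * v p - u p * ddx v p) / (v p)^2"
    unfolding dd_eqI(1)[OF deriv] using assms(3) by (simp add: field_simps power2_eq_square)
  show "ddy (\<lambda>q. u q / v q) p = (ddy u p * v p - u p * ddy v p) / (v p)^2"
    unfolding dd_eqI(2)[OF deriv] using assms(3) by (simp add: field_simps power2_eq_square)
qed

lemmas dd_simps = dd_rules dd_uminus dd_const differentiable_add differentiable_diff
  differentiable_mult differentiable_minus differentiable_const

text \<open>The leaves of the web are solutions of \<open>y'' = P y' + Q y'^2\<close> with the following coefficients, where
  \<open>\<mu>\<close> is determined by the basic invariant.\<close>

definition geodesic_P :: "(real \<times> real \<Rightarrow> real) \<Rightarrow> (real \<times> real \<Rightarrow> real) \<Rightarrow> real \<times> real \<Rightarrow> real"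
  where "geodesic_P f \<mu> p = ddx (ddx f) p / ddx f p - ddx f p * (web_H f p + \<mu> p)"

definition geodesic_Q :: "(real \<times> real \<Rightarrow> real) \<Rightarrow> (real \<times> real \<Rightarrow> real) \<Rightarrow> real \<times> real \<Rightarrow> real"
  where "geodesic_Q f \<mu> p = ddy f p * (web_H f p - \<mu> p) - ddy (ddy f) p / ddy f p"

section \<open>Derivatives of the web function and of the geodesic coefficients\<close>

locale web_function =
  fixes M :: "(real \<times> real) set" and f :: "real \<times> real \<Rightarrow> real"
  assumes open_M: "open M" and smooth_f: "smooth_on M f"
    and ddx_f: "\<And>p. p \<in> M \<Longrightarrow> ddx f p \<noteq> 0" and ddy_f: "\<And>p. p \<in> M \<Longrightarrow> ddy f p \<noteq> 0"
begin

abbreviation "H \<equiv> web_H f"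
abbreviation "X \<equiv> ddx f"
abbreviation "Y \<equiv> ddy f"

text \<open>Logarithmic derivatives of \<open>f_x\<close> and \<open>f_y\<close>. Together with
  \<open>H\<close> they turn all second derivatives of \<open>f\<close> into multiples of first
  ones, so later identities become polynomial in \<open>A\<close>, \<open>B\<close>,
  \<open>H\<close>, \<open>X\<close>, \<open>Y\<close> and derivatives of \<open>H\<close>.\<close>

definition A :: "real \<times> real \<Rightarrow> real" where "A p = ddx X p / X p"
definition B :: "real \<times> real \<Rightarrow> real" where "B p = ddy Y p / Y p"

lemma smooth_X: "smooth_on M X" and smooth_Y: "smooth_on M Y"
  by (intro smooth_on_ddx smooth_on_ddy smooth_f)+

lemma smooth_H: "smooth_on M H"
  unfolding web_H_def
  by (intro smooth_on_divide open_M smooth_on_mult smooth_on_ddy smooth_X smooth_Y) (simp add: ddx_f ddy_f)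

lemma smooth_AB: "smooth_on M A" "smooth_on M B"
  unfolding A_def[abs_def] B_def[abs_def]
  by (intro smooth_on_divide open_M smooth_on_ddy smooth_on_ddx smooth_X smooth_Y ddx_f ddy_f; assumption)+

lemma smooth_d:
  assumes "smooth_on M u"
  shows "smooth_on M (d1 f u)" "smooth_on M (d2 f u)"
  unfolding d1_def[abs_def] d2_def[abs_def]
  by (intro smooth_on_mult smooth_on_uminus smooth_on_divide smooth_on_const open_M smooth_on_ddx
      smooth_on_ddy assms smooth_f ddx_f ddy_f; assumption)+

lemma smooth_K: "smooth_on M (web_K f)"
  unfolding web_K_def[abs_def] by (intro smooth_on_diff open_M smooth_d smooth_H)

lemma dd_d:
  assumes "p \<in> M"
  shows "ddx u p = - X p * d1 f u p" "ddy u p = - Y p * d2 f u p"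
  using ddx_f[OF assms] ddy_f[OF assms] by (simp_all add: d1_def d2_def)

lemma dd_XY:
  assumes p: "p \<in> M"
  shows "ddx X p = A p * X p" "ddy X p = H p * X p * Y p" "ddx Y p = H p * X p * Y p" "ddy Y p = B p * Y p"
  using ddx_f[OF p] ddy_f[OF p] ddx_ddy_commute[OF open_M smooth_f p]
  by (simp_all add: web_H_def A_def B_def)

lemmas diffs = smooth_on_differentiable[OF smooth_X] smooth_on_differentiable[OF smooth_Y]
  smooth_on_differentiable[OF smooth_H] smooth_on_differentiable[OF smooth_AB(1)]
  smooth_on_differentiable[OF smooth_AB(2)] smooth_on_differentiable[OF smooth_K]
  smooth_on_differentiable[OF smooth_on_ddx[OF smooth_X]] smooth_on_differentiable[OF smooth_on_ddy[OF smooth_Y]]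

lemma ddx_HXY:
  assumes p: "p \<in> M"
  shows "ddx (\<lambda>q. H q * X q * Y q) p = X p * Y p * (H p * A p + X p * (H p ^ 2 - d1 f H p))"
    "ddy (\<lambda>q. H q * X q * Y q) p = X p * Y p * (H p * B p + Y p * (H p ^ 2 - d2 f H p))"
proof -
  have "ddx (\<lambda>q. H q * X q * Y q) p = (ddx H p * X p + H p * ddx X p) * Y p + H p * X p * ddx Y p"
    "ddy (\<lambda>q. H q * X q * Y q) p = (ddy H p * X p + H p * ddy X p) * Y p + H p * X p * ddy Y p"
    by (simp_all add: dd_simps diffs p)
  then show "ddx (\<lambda>q. H q * X q * Y q) p = X p * Y p * (H p * A p + X p * (H p ^ 2 - d1 f H p))"
    "ddy (\<lambda>q. H q * X q * Y q) p = X p * Y p * (H p * B p + Y p * (H p ^ 2 - d2 f H p))"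
    unfolding dd_d[OF p, of H] dd_XY[OF p] by (simp_all add: algebra_simps power2_eq_square)
qed

text \<open>The third derivative \<open>ddy (ddx X)\<close> is the \<open>x\<close>-derivative of
  \<open>ddy X = H X Y\<close>; hence nothing beyond first derivatives of \<open>H\<close>
  appears.\<close>

lemma ddy_A:
  assumes p: "p \<in> M"
  shows "ddy A p = X p * Y p * (H p ^ 2 - d1 f H p)"
proof -
  have "ddy (ddx X) p = ddx (ddy X) p"
    by (rule ddx_ddy_commute[OF open_M smooth_X p, symmetric])
  also have "\<dots> = ddx (\<lambda>q. H q * X q * Y q) p"
    by (rule dd_cong(1)[OF open_M p dd_XY(2) smooth_on_differentiable[OF smooth_on_ddy[OF smooth_X] p]])
  finally have 1: "ddy (ddx X) p = X p * Y p * (H p * A p + X p * (H p ^ 2 - d1 f H p))"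
    by (simp only: ddx_HXY(1)[OF p])
  have "ddy A p = (ddy (ddx X) p * X p - ddx X p * ddy X p) / (X p)^2"
    unfolding A_def[abs_def] by (rule dd_divide(2)[OF diffs(7)[OF p] diffs(1)[OF p] ddx_f[OF p]])
  also have "\<dots> = (X p * Y p * (H p * A p + X p * (H p ^ 2 - d1 f H p)) * X p
      - A p * X p * (H p * X p * Y p)) / (X p)^2"
    by (simp only: 1 dd_XY(1,2)[OF p])
  also have "\<dots> = X p * Y p * (H p ^ 2 - d1 f H p)"
    using ddx_f[OF p] by (simp add: field_simps power2_eq_square)
  finally show ?thesis .
qed

lemma ddx_B:
  assumes p: "p \<in> M"
  shows "ddx B p = X p * Y p * (H p ^ 2 - d2 f H p)"
proof -
  have "ddx (ddy Y) p = ddy (ddx Y) p"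
    by (rule ddx_ddy_commute[OF open_M smooth_Y p])
  also have "\<dots> = ddy (\<lambda>q. H q * X q * Y q) p"
    by (rule dd_cong(2)[OF open_M p dd_XY(3) smooth_on_differentiable[OF smooth_on_ddx[OF smooth_Y] p]])
  finally have 1: "ddx (ddy Y) p = X p * Y p * (H p * B p + Y p * (H p ^ 2 - d2 f H p))"
    by (simp only: ddx_HXY(2)[OF p])
  have "ddx B p = (ddx (ddy Y) p * Y p - ddy Y p * ddx Y p) / (Y p)^2"
    unfolding B_def[abs_def] by (rule dd_divide(1)[OF diffs(8)[OF p] diffs(2)[OF p] ddy_f[OF p]])
  also have "\<dots> = (X p * Y p * (H p * B p + Y p * (H p ^ 2 - d2 f H p)) * Y p
      - B p * Y p * (H p * X p * Y p)) / (Y p)^2"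
    by (simp only: 1 dd_XY(3,4)[OF p])
  also have "\<dots> = X p * Y p * (H p ^ 2 - d2 f H p)"
    using ddy_f[OF p] by (simp add: field_simps power2_eq_square)
  finally show ?thesis .
qed

end

locale web_function_mu = web_function +
  fixes \<mu> :: "real \<times> real \<Rightarrow> real"
  assumes smooth_mu: "smooth_on M \<mu>"
begin

abbreviation "P \<equiv> geodesic_P f \<mu>"
abbreviation "Q \<equiv> geodesic_Q f \<mu>"

lemma P_eq: "P = (\<lambda>p. A p - X p * (H p + \<mu> p))" and Q_eq: "Q = (\<lambda>p. Y p * (H p - \<mu> p) - B p)"
  by (simp_all add: geodesic_P_def geodesic_Q_def A_def B_def fun_eq_iff)

lemma smooth_P: "smooth_on M P" and smooth_Q: "smooth_on M Q"
  unfolding P_eq Q_eq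
  by (intro smooth_on_diff smooth_on_add smooth_on_mult open_M smooth_X smooth_Y smooth_H smooth_mu smooth_AB)+

lemmas mu_diffs = smooth_on_differentiable[OF smooth_mu] smooth_on_differentiable[OF smooth_d(1)[OF smooth_mu]]
  smooth_on_differentiable[OF smooth_d(2)[OF smooth_mu]]

text \<open>The squares of \<open>H\<close> from \<open>ddy A\<close> and from \<open>ddy X\<close>
  cancel, and the remaining derivatives of \<open>H\<close> combine to
  \<open>- web_K f\<close>.\<close>

lemma ddy_P:
  assumes p: "p \<in> M"
  shows "ddy P p = X p * Y p * (d2 f \<mu> p - web_K f p - H p * \<mu> p)"
proof -
  have "ddy P p = ddy A p - (ddy X p * (H p + \<mu> p) + X p * (ddy H p + ddy \<mu> p))"
    unfolding P_eq by (simp add: dd_simps diffs mu_diffs p)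
  also have "\<dots> = X p * Y p * (d2 f \<mu> p - web_K f p - H p * \<mu> p)"
    unfolding ddy_A[OF p] dd_XY[OF p] dd_d[OF p, of H] dd_d[OF p, of \<mu>] web_K_def
    by (simp add: algebra_simps power2_eq_square)
  finally show ?thesis .
qed

lemma ddx_Q:
  assumes p: "p \<in> M"
  shows "ddx Q p = X p * Y p * (d1 f \<mu> p - web_K f p - H p * \<mu> p)"
proof -
  have "ddx Q p = ddx Y p * (H p - \<mu> p) + Y p * (ddx H p - ddx \<mu> p) - ddx B p"
    unfolding Q_eq by (simp add: dd_simps diffs mu_diffs p)
  also have "\<dots> = X p * Y p * (d1 f \<mu> p - web_K f p - H p * \<mu> p)"
    unfolding ddx_B[OF p] dd_XY[OF p] dd_d[OF p, of H] dd_d[OF p, of \<mu>] web_K_def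
    by (simp add: algebra_simps power2_eq_square)
  finally show ?thesis .
qed

text \<open>The left side is three times the first Liouville invariant of the geodesic equation. The
  factor \<open>2 * ddy P - ddx Q\<close> is \<open>X * Y\<close> times an expression in first
  derivatives of \<open>\<mu>\<close>, and the \<open>A\<close> terms from differentiating
  \<open>X\<close> and from \<open>P\<close> cancel.\<close>

lemma flat1_eq:
  assumes p: "p \<in> M"
  shows "ddx (\<lambda>q. 2 * ddy P q - ddx Q q) p - P p * (2 * ddy P p - ddx Q p) = - ((X p)^2 * Y p * I1 f \<mu> p)"
proof -
  let ?E = "\<lambda>q. 2 * d2 f \<mu> q - d1 f \<mu> q - web_K f q - H q * \<mu> q"
  have Z: "2 * ddy P q - ddx Q q = X q * Y q * ?E q" if "q \<in> M" for q
    unfolding ddy_P[OF that] ddx_Q[OF that] by (simp add: algebra_simps)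
  have d: "(\<lambda>q. 2 * ddy P q - ddx Q q) differentiable (at p)"
    by (rule smooth_on_differentiable[of M])
      (intro smooth_on_diff smooth_on_mult smooth_on_const open_M smooth_on_ddx smooth_on_ddy smooth_P smooth_Q p)+
  have "ddx (\<lambda>q. 2 * ddy P q - ddx Q q) p = ddx (\<lambda>q. X q * Y q * ?E q) p"
    by (rule dd_cong(1)[OF open_M p Z d])
  also have "\<dots> = (ddx X p * Y p + X p * ddx Y p) * ?E p + X p * Y p *
      (2 * ddx (d2 f \<mu>) p - ddx (d1 f \<mu>) p - ddx (web_K f) p - (ddx H p * \<mu> p + H p * ddx \<mu> p))"
    by (simp add: dd_simps diffs mu_diffs p)
  finally show ?thesis
    unfolding Z[OF p] dd_XY[OF p] dd_d(1)[OF p, of H] dd_d(1)[OF p, of \<mu>] dd_d(1)[OF p, of "d1 f \<mu>"]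
      dd_d(1)[OF p, of "d2 f \<mu>"] dd_d(1)[OF p, of "web_K f"] I1_def fun_cong[OF P_eq, of p]
    by (simp add: web_K_def algebra_simps power2_eq_square)
qed

text \<open>The commutator of the two weighted derivatives, obtained from the symmetry of the mixed
  partials of \<open>\<mu>\<close>. The second Liouville invariant naturally produces
  \<open>d2\<close> after \<open>d1\<close>, while \<open>I2\<close> is written with the opposite
  order.\<close>

lemma d2_d1:
  assumes p: "p \<in> M"
  shows "d2 f (d1 f \<mu>) p = d1 f (d2 f \<mu>) p - H p * d2 f \<mu> p + H p * d1 f \<mu> p"
proof -
  have "ddx (ddy \<mu>) p = ddy (ddx \<mu>) p"
    by (rule ddx_ddy_commute[OF open_M smooth_mu p])
  moreover have "ddx (ddy \<mu>) p = ddx (\<lambda>q. - Y q * d2 f \<mu> q) p"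
    by (rule dd_cong(1)[OF open_M p dd_d(2) smooth_on_differentiable[OF smooth_on_ddy[OF smooth_mu] p]])
  moreover have "ddy (ddx \<mu>) p = ddy (\<lambda>q. - X q * d1 f \<mu> q) p"
    by (rule dd_cong(2)[OF open_M p dd_d(1) smooth_on_differentiable[OF smooth_on_ddx[OF smooth_mu] p]])
  moreover have "ddx (\<lambda>q. - Y q * d2 f \<mu> q) p = - ddx Y p * d2 f \<mu> p - Y p * ddx (d2 f \<mu>) p"
    "ddy (\<lambda>q. - X q * d1 f \<mu> q) p = - ddy X p * d1 f \<mu> p - X p * ddy (d1 f \<mu>) p"
    by (simp_all add: dd_simps diffs mu_diffs p)
  ultimately have "- (H p * X p * Y p) * d2 f \<mu> p - Y p * (- X p * d1 f (d2 f \<mu>) p)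
      = - (H p * X p * Y p) * d1 f \<mu> p - X p * (- Y p * d2 f (d1 f \<mu>) p)"
    unfolding dd_XY(2,3)[OF p] dd_d(1)[OF p, of "d2 f \<mu>"] dd_d(2)[OF p, of "d1 f \<mu>"] by simp
  then have "X p * Y p * d2 f (d1 f \<mu>) p = X p * Y p * (d1 f (d2 f \<mu>) p - H p * d2 f \<mu> p + H p * d1 f \<mu> p)"
    by (simp add: algebra_simps)
  then show ?thesis
    using ddx_f[OF p] ddy_f[OF p] by simp
qed

lemma flat2_eq:
  assumes p: "p \<in> M"
  shows "ddy (\<lambda>q. ddy P q - 2 * ddx Q q) p + Q p * (ddy P p - 2 * ddx Q p) = X p * (Y p)^2 * I2 f \<mu> p"
proof -
  let ?E = "\<lambda>q. d2 f \<mu> q - 2 * d1 f \<mu> q + web_K f q + H q * \<mu> q"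
  have Z: "ddy P q - 2 * ddx Q q = X q * Y q * ?E q" if "q \<in> M" for q
    unfolding ddy_P[OF that] ddx_Q[OF that] by (simp add: algebra_simps)
  have d: "(\<lambda>q. ddy P q - 2 * ddx Q q) differentiable (at p)"
    by (rule smooth_on_differentiable[of M])
      (intro smooth_on_diff smooth_on_mult smooth_on_const open_M smooth_on_ddx smooth_on_ddy smooth_P smooth_Q p)+
  have "ddy (\<lambda>q. ddy P q - 2 * ddx Q q) p = ddy (\<lambda>q. X q * Y q * ?E q) p"
    by (rule dd_cong(2)[OF open_M p Z d])
  also have "\<dots> = (ddy X p * Y p + X p * ddy Y p) * ?E p + X p * Y p *
      (ddy (d2 f \<mu>) p - 2 * ddy (d1 f \<mu>) p + ddy (web_K f) p + (ddy H p * \<mu> p + H p * ddy \<mu> p))"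
    by (simp add: dd_simps diffs mu_diffs p)
  finally show ?thesis
    unfolding Z[OF p] dd_XY[OF p] dd_d(2)[OF p, of H] dd_d(2)[OF p, of \<mu>] dd_d(2)[OF p, of "d1 f \<mu>"]
      dd_d(2)[OF p, of "d2 f \<mu>"] dd_d(2)[OF p, of "web_K f"] I2_def fun_cong[OF Q_eq, of p] d2_d1[OF p]
    by (simp add: web_K_def algebra_simps power2_eq_square)
qed

end

section \<open>Direction fields of the four foliations\<close>

definition directional :: "(real \<times> real \<Rightarrow> real \<times> real) \<Rightarrow> (real \<times> real \<Rightarrow> real) \<Rightarrow> real \<times> real \<Rightarrow> real"
  where "directional T u p = fst (T p) * ddx u p + snd (T p) * ddy u p"

text \<open>The integral curves of \<open>T\<close> satisfy \<open>y'' = P y' + Q y'^2\<close>; the equation is multiplied out so as to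
  make sense for vertical \<open>T\<close> as well.\<close>

definition geodesic_field ::
  "(real \<times> real \<Rightarrow> real) \<Rightarrow> (real \<times> real \<Rightarrow> real) \<Rightarrow> (real \<times> real \<Rightarrow> real \<times> real) \<Rightarrow> real \<times> real \<Rightarrow> bool"
  where "geodesic_field P Q T p \<longleftrightarrow>
    fst (T p) * directional T (\<lambda>q. snd (T q)) p - snd (T p) * directional T (\<lambda>q. fst (T q)) p
    = fst (T p) * snd (T p) * (P p * fst (T p) + Q p * snd (T p))"

lemma smooth_on_directional:
  assumes "open U" "smooth_on U T" "smooth_on U u"
  shows "smooth_on U (directional T u)"
  unfolding directional_def[abs_def]
  by (intro smooth_on_add smooth_on_mult smooth_on_fst smooth_on_snd smooth_on_ddx smooth_on_ddy assms)

locale web_function_inv = web_function +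
  fixes a :: "real \<times> real \<Rightarrow> real"
  assumes smooth_a: "smooth_on M a" and a_nz: "\<And>p. p \<in> M \<Longrightarrow> a p \<noteq> 0" and a_n1: "\<And>p. p \<in> M \<Longrightarrow> a p \<noteq> 1"
begin

lemma a_nz2: "p \<in> M \<Longrightarrow> a p - (a p)^2 \<noteq> 0"
  using a_nz a_n1 by (auto simp: power2_eq_square)

lemma smooth_mu0: "smooth_on M (mu0 f a)"
  unfolding mu0_def[abs_def]
  by (intro smooth_on_divide smooth_on_diff smooth_on_mult smooth_on_power open_M smooth_d smooth_a a_nz2)

sublocale web_function_mu M f "mu0 f a"
  by unfold_locales (rule smooth_mu0)

text \<open>Coordinate lines satisfy the equation because both sides vanish. For the third foliation
  \<open>\<mu>\<close> cancels from \<open>P * Y - Q * X\<close>, so the choice of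
  \<open>\<mu>\<close> matters only for the fourth one.\<close>

lemma geodesic_fields:
  assumes p: "p \<in> M"
  shows "geodesic_field P Q (\<lambda>q. (0, 1)) p" "geodesic_field P Q (\<lambda>q. (1, 0)) p"
    "geodesic_field P Q (\<lambda>q. (Y q, - X q)) p" "geodesic_field P Q (\<lambda>q. (Y q, - (a q * X q))) p"
proof -
  show "geodesic_field P Q (\<lambda>q. (0, 1)) p" "geodesic_field P Q (\<lambda>q. (1, 0)) p"
    by (simp_all add: geodesic_field_def directional_def dd_simps)
  have PQ: "P p = A p - X p * (H p + mu0 f a p)" "Q p = Y p * (H p - mu0 f a p) - B p"
    by (simp_all add: P_eq Q_eq)
  show "geodesic_field P Q (\<lambda>q. (Y q, - X q)) p"
    unfolding geodesic_field_def directional_def fst_conv snd_conv PQ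
    by (simp add: dd_simps diffs p dd_XY algebra_simps)
  \<comment> \<open>The definition of \<open>mu0\<close>, solved for \<open>d1 f a\<close>, is
    exactly the condition contributed by the fourth foliation.\<close>
  have mu: "d1 f a p = a p * d2 f a p + mu0 f a p * (a p - (a p)^2)"
    using a_nz2[OF p] by (simp add: mu0_def field_simps)
  have "a differentiable (at p)"
    by (rule smooth_on_differentiable[OF smooth_a p])
  then show "geodesic_field P Q (\<lambda>q. (Y q, - (a q * X q))) p"
    unfolding geodesic_field_def directional_def fst_conv snd_conv PQ
    by (simp add: dd_simps diffs p dd_XY dd_d[OF p, of a] mu power2_eq_square) (simp add: algebra_simps)
qed

lemma smooth_fields:
  "smooth_on M (\<lambda>q. (0, 1) :: real \<times> real)" "smooth_on M (\<lambda>q. (1, 0) :: real \<times> real)"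
  "smooth_on M (\<lambda>q. (Y q, - X q))" "smooth_on M (\<lambda>q. (Y q, - (a q * X q)))"
  by (intro smooth_on_const smooth_on_Pair smooth_on_uminus smooth_on_mult open_M smooth_X smooth_Y smooth_a)+

lemma omega3_eq: "p \<in> M \<Longrightarrow> omega3 f p v = ddx f p * fst v + ddy f p * snd v"
  unfolding omega3_def
  using frechet_derivative_dd[OF smooth_on_differentiable[OF smooth_f], of p v] by simp

lemma omega_zero_iff:
  assumes p: "p \<in> M"
  shows "omega1 f p v = 0 \<longleftrightarrow> (\<exists>c. v = c *\<^sub>R (0, 1))" "omega2 f p v = 0 \<longleftrightarrow> (\<exists>c. v = c *\<^sub>R (1, 0))"
    "omega3 f p v = 0 \<longleftrightarrow> (\<exists>c. v = c *\<^sub>R (Y p, - X p))"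
    "omega4 f a p v = 0 \<longleftrightarrow> (\<exists>c. v = c *\<^sub>R (Y p, - (a p * X p)))"
proof -
  note nz = ddx_f[OF p] ddy_f[OF p]
  show "omega1 f p v = 0 \<longleftrightarrow> (\<exists>c. v = c *\<^sub>R (0, 1))" "omega2 f p v = 0 \<longleftrightarrow> (\<exists>c. v = c *\<^sub>R (1, 0))"
    using nz by (cases v; simp add: omega1_def omega2_def)+
  have aux: "m * fst v + Y p * snd v = 0 \<longleftrightarrow> (\<exists>c. v = c *\<^sub>R (Y p, - m))" for m
  proof
    assume "m * fst v + Y p * snd v = 0"
    then have "snd v = (fst v / Y p) * (- m)"
      using nz by (simp add: field_simps)
    then have "v = (fst v / Y p) *\<^sub>R (Y p, - m)"
      using nz by (simp add: prod_eq_iff)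
    then show "\<exists>c. v = c *\<^sub>R (Y p, - m)"
      by blast
  qed auto
  show "omega3 f p v = 0 \<longleftrightarrow> (\<exists>c. v = c *\<^sub>R (Y p, - X p))"
    unfolding omega3_eq[OF p] by (rule aux)
  show "omega4 f a p v = 0 \<longleftrightarrow> (\<exists>c. v = c *\<^sub>R (Y p, - (a p * X p)))"
    unfolding aux[symmetric] by (auto simp: omega1_def omega2_def omega4_def algebra_simps)
qed

text \<open>Replaces each form by a nowhere zero smooth field spanning its kernel, so that the
  sufficiency proof can treat all four foliations alike.\<close>

lemma web4_direction:
  assumes "\<omega> \<in> set (web4 f a)"
  shows "\<exists>T. smooth_on M T \<and> (\<forall>p\<in>M. T p \<noteq> 0 \<and> geodesic_field P Q T p \<and>
    (\<forall>v. \<omega> p v = 0 \<longleftrightarrow> (\<exists>c. v = c *\<^sub>R T p)))"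
proof -
  consider "\<omega> = omega1 f" | "\<omega> = omega2 f" | "\<omega> = omega3 f" | "\<omega> = omega4 f a"
    using assms by (auto simp: web4_def)
  then show ?thesis
  proof cases
    case 1
    show ?thesis
      unfolding 1 by (rule exI[of _ "\<lambda>q. (0, 1)"])
        (use smooth_fields(1) geodesic_fields(1) omega_zero_iff(1) in \<open>auto simp: zero_prod_def\<close>)
  next
    case 2
    show ?thesis
      unfolding 2 by (rule exI[of _ "\<lambda>q. (1, 0)"])
        (use smooth_fields(2) geodesic_fields(2) omega_zero_iff(2) in \<open>auto simp: zero_prod_def\<close>)
  next
    case 3
    show ?thesis
      unfolding 3 by (rule exI[of _ "\<lambda>q. (Y q, - X q)"])
        (use smooth_fields(3) geodesic_fields(3) omega_zero_iff(3) ddx_f in \<open>auto simp: zero_prod_def\<close>)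
  next
    case 4
    show ?thesis
      unfolding 4 by (rule exI[of _ "\<lambda>q. (Y q, - (a q * X q))"])
        (use smooth_fields(4) geodesic_fields(4) omega_zero_iff(4) ddy_f in \<open>auto simp: zero_prod_def\<close>)
  qed
qed

end

section \<open>Flat projective structures\<close>

text \<open>A solution \<open>u\<close> of the second order system below is encoded by \<open>\<psi> = (u, u_x, u_y)\<close>.\<close>

type_synonym jet = "real \<times> real \<times> real"

definition system_x ::
  "(real \<times> real \<Rightarrow> real) \<Rightarrow> (real \<times> real \<Rightarrow> real) \<Rightarrow> (real \<times> real \<Rightarrow> real) \<Rightarrow> (real \<times> real \<Rightarrow> real) \<Rightarrow>
    real \<times> real \<Rightarrow> jet \<Rightarrow>\<^sub>L jet"
  where "system_x p q r s z = Blinfun (\<lambda>(u, ux, uy).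
    (ux, p z * ux + r z * u, q z * ux - p z * uy + s z * u))"

definition system_y ::
  "(real \<times> real \<Rightarrow> real) \<Rightarrow> (real \<times> real \<Rightarrow> real) \<Rightarrow> (real \<times> real \<Rightarrow> real) \<Rightarrow> (real \<times> real \<Rightarrow> real) \<Rightarrow>
    real \<times> real \<Rightarrow> jet \<Rightarrow>\<^sub>L jet"
  where "system_y p q s t z = Blinfun (\<lambda>(u, ux, uy).
    (uy, q z * ux - p z * uy + s z * u, - (q z * uy) + t z * u))"

lemma Blinfun_jet_apply:
  fixes h :: "jet \<Rightarrow> jet"
  assumes "linear h"
  shows "blinfun_apply (Blinfun h) = h"
  by (rule bounded_linear_Blinfun_apply) (simp add: assms linear_conv_bounded_linear[symmetric])

lemma system_apply:
  "blinfun_apply (system_x p q r s z) (u, ux, uy)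
    = (ux, p z * ux + r z * u, q z * ux - p z * uy + s z * u)"
  "blinfun_apply (system_y p q s t z) (u, ux, uy)
    = (uy, q z * ux - p z * uy + s z * u, - (q z * uy) + t z * u)"
  unfolding system_x_def system_y_def
  by (subst Blinfun_jet_apply; auto intro!: linearI simp: algebra_simps)+

text \<open>Constant matrices of which the two system matrices are combinations with the coefficient functions as
  weights; smoothness and derivatives of the systems are read off from this decomposition.\<close>

definition "jet_x = Blinfun (\<lambda>(u, ux, uy). (ux, 0, 0) :: jet)"
definition "jet_y = Blinfun (\<lambda>(u, ux, uy). (uy, 0, 0) :: jet)"
definition "jet_xx = Blinfun (\<lambda>(u, ux, uy). (0, ux, - uy) :: jet)"
definition "jet_u1 = Blinfun (\<lambda>(u, ux, uy). (0, u, 0) :: jet)"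
definition "jet_u2 = Blinfun (\<lambda>(u, ux, uy). (0, 0, u) :: jet)"
definition "jet_x2 = Blinfun (\<lambda>(u, ux, uy). (0, 0, ux) :: jet)"
definition "jet_y1 = Blinfun (\<lambda>(u, ux, uy). (0, - uy, 0) :: jet)"

lemma jet_apply:
  "blinfun_apply jet_x (u, ux, uy) = (ux, 0, 0)" "blinfun_apply jet_y (u, ux, uy) = (uy, 0, 0)"
  "blinfun_apply jet_xx (u, ux, uy) = (0, ux, - uy)" "blinfun_apply jet_u1 (u, ux, uy) = (0, u, 0)"
  "blinfun_apply jet_u2 (u, ux, uy) = (0, 0, u)" "blinfun_apply jet_x2 (u, ux, uy) = (0, 0, ux)"
  "blinfun_apply jet_y1 (u, ux, uy) = (0, - uy, 0)"
  unfolding jet_x_def jet_y_def jet_xx_def jet_u1_def jet_u2_def jet_x2_def jet_y1_def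
  by (subst Blinfun_jet_apply; auto intro!: linearI)+

lemma system_decomposition:
  "system_x p q r s = (\<lambda>z. jet_x + p z *\<^sub>R jet_xx + r z *\<^sub>R jet_u1 + q z *\<^sub>R jet_x2 + s z *\<^sub>R jet_u2)"
  "system_y p q s t = (\<lambda>z. jet_y + q z *\<^sub>R jet_xx + p z *\<^sub>R jet_y1 + s z *\<^sub>R jet_u1 + t z *\<^sub>R jet_u2)"
  by (auto intro!: ext blinfun_eqI simp: system_apply jet_apply blinfun.add_left blinfun.scaleR_left)

lemma has_derivative_scaleR_dd:
  "u differentiable (at z) \<Longrightarrow>
    ((\<lambda>z. u z *\<^sub>R E) has_derivative (\<lambda>h. (fst h * ddx u z + snd h * ddy u z) *\<^sub>R E)) (at z)"
  by (rule has_derivative_scaleR_left[OF has_derivative_dd])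

lemma system_derivatives:
  assumes "p differentiable (at z)" "q differentiable (at z)" "r differentiable (at z)"
    "s differentiable (at z)" "t differentiable (at z)"
  shows "frechet_derivative (system_x p q r s) (at z) (0, 1)
      = ddy p z *\<^sub>R jet_xx + ddy r z *\<^sub>R jet_u1 + ddy q z *\<^sub>R jet_x2 + ddy s z *\<^sub>R jet_u2"
    "frechet_derivative (system_y p q s t) (at z) (1, 0)
      = ddx q z *\<^sub>R jet_xx + ddx p z *\<^sub>R jet_y1 + ddx s z *\<^sub>R jet_u1 + ddx t z *\<^sub>R jet_u2"
proof -
  note scale = assms[THEN has_derivative_scaleR_dd]
  note add = has_derivative_add[OF has_derivative_add[OF has_derivative_add[OF
        has_derivative_add[OF has_derivative_const]]]]
  show "frechet_derivative (system_x p q r s) (at z) (0, 1)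
      = ddy p z *\<^sub>R jet_xx + ddy r z *\<^sub>R jet_u1 + ddy q z *\<^sub>R jet_x2 + ddy s z *\<^sub>R jet_u2"
    unfolding system_decomposition
    by (subst frechet_derivative_at[OF add[OF scale(1) scale(3) scale(2) scale(4)], symmetric]) simp
  show "frechet_derivative (system_y p q s t) (at z) (1, 0)
      = ddx q z *\<^sub>R jet_xx + ddx p z *\<^sub>R jet_y1 + ddx s z *\<^sub>R jet_u1 + ddx t z *\<^sub>R jet_u2"
    unfolding system_decomposition
    by (subst frechet_derivative_at[OF add[OF scale(2) scale(1) scale(4) scale(5)], symmetric]) simp
qed

definition is_solution ::
  "(real \<times> real \<Rightarrow> jet \<Rightarrow>\<^sub>L jet) \<Rightarrow> (real \<times> real \<Rightarrow> jet \<Rightarrow>\<^sub>L jet) \<Rightarrow> (real \<times> real) set \<Rightarrow> (real \<times> real \<Rightarrow> jet) \<Rightarrow> bool"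
  where "is_solution A B N \<psi> \<longleftrightarrow> (\<forall>z\<in>N. (\<psi> has_derivative
    (\<lambda>h. fst h *\<^sub>R blinfun_apply (A z) (\<psi> z) + snd h *\<^sub>R blinfun_apply (B z) (\<psi> z))) (at z))"

lemma flat_structure_solutions:
  assumes U: "open U" "z0 \<in> U" and P: "smooth_on U P" and Q: "smooth_on U Q"
    and flat1: "\<And>z. z \<in> U \<Longrightarrow> ddx (\<lambda>q. 2 * ddy P q - ddx Q q) z - P z * (2 * ddy P z - ddx Q z) = 0"
    and flat2: "\<And>z. z \<in> U \<Longrightarrow> ddy (\<lambda>q. ddy P q - 2 * ddx Q q) z + Q z * (ddy P z - 2 * ddx Q z) = 0"
  shows "\<exists>N r s t. open N \<and> z0 \<in> N \<and> N \<subseteq> U \<and> smooth_on N r \<and> smooth_on N s \<and> smooth_on N t \<and>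
    (\<forall>v. \<exists>\<psi>. \<psi> z0 = v \<and> smooth_on N \<psi> \<and>
      is_solution (system_x (\<lambda>z. P z / 3) (\<lambda>z. Q z / 3) r s) (system_y (\<lambda>z. P z / 3) (\<lambda>z. Q z / 3) s t) N \<psi>)"
proof -
  define p q where "p = (\<lambda>z. P z / 3)" and "q = (\<lambda>z. Q z / 3)"
  have P_eq: "P = (\<lambda>z. 3 * p z)" and Q_eq: "Q = (\<lambda>z. 3 * q z)"
    by (simp_all add: p_def q_def)
  have pq: "smooth_on U p" "smooth_on U q"
    unfolding p_def q_def by (intro smooth_on_divide smooth_on_const U P Q; simp)+
  \<comment> \<open>These three functions are read off from the compatibility identities
    \<open>c1\<close> and \<open>c2\<close> below: equating the coefficients of \<open>ux\<close>
    and \<open>uy\<close> leaves no other choice, and the two values obtained for \<open>s\<close>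
    agree.\<close>
  define r where "r = (\<lambda>z. 2 * (p z * p z) - ddx p z)"
  define s where "s = (\<lambda>z. ddy p z - ddx q z + p z * q z)"
  define t where "t = (\<lambda>z. ddy q z + 2 * (q z * q z))"
  have rst: "smooth_on U r" "smooth_on U s" "smooth_on U t"
    unfolding r_def s_def t_def
    by (intro smooth_on_add smooth_on_diff smooth_on_mult smooth_on_const U smooth_on_ddx smooth_on_ddy pq)+
  note diff = smooth_on_differentiable[OF pq(1)] smooth_on_differentiable[OF pq(2)]
    smooth_on_differentiable[OF smooth_on_ddx[OF pq(1)]] smooth_on_differentiable[OF smooth_on_ddx[OF pq(2)]]
    smooth_on_differentiable[OF smooth_on_ddy[OF pq(1)]] smooth_on_differentiable[OF smooth_on_ddy[OF pq(2)]]
  have dPQ: "ddy P z = 3 * ddy p z" "ddx Q z = 3 * ddx q z" if "z \<in> U" for z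
    unfolding P_eq Q_eq by (simp_all add: dd_simps diff that)
  let ?A = "system_x p q r s" and ?B = "system_y p q s t"
  have AB: "smooth_on U ?A" "smooth_on U ?B"
    unfolding system_decomposition by (intro smooth_on_add smooth_on_scaleR smooth_on_const U pq rst)+
  have compat: "blinfun_apply (frechet_derivative ?A (at z) (0, 1)) w + blinfun_apply (?A z) (blinfun_apply (?B z) w)
      = blinfun_apply (frechet_derivative ?B (at z) (1, 0)) w + blinfun_apply (?B z) (blinfun_apply (?A z) w)"
    if z: "z \<in> U" for z w
  proof -
    have comm: "ddx (ddy p) z = ddy (ddx p) z" "ddx (ddy q) z = ddy (ddx q) z"
      by (rule ddx_ddy_commute[OF U(1) pq(1) z] ddx_ddy_commute[OF U(1) pq(2) z])+
    have dr: "ddy r z = 4 * (p z * ddy p z) - ddy (ddx p) z"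
      and ds: "ddx s z = ddy (ddx p) z - ddx (ddx q) z + ddx p z * q z + p z * ddx q z"
        "ddy s z = ddy (ddy p) z - ddy (ddx q) z + ddy p z * q z + p z * ddy q z"
      and dt: "ddx t z = ddy (ddx q) z + 4 * (q z * ddx q z)"
      unfolding r_def s_def t_def by (simp_all add: dd_simps diff z comm)
    have val: "r z = 2 * (p z * p z) - ddx p z" "s z = ddy p z - ddx q z + p z * q z"
      "t z = ddy q z + 2 * (q z * q z)"
      by (simp_all add: r_def s_def t_def)
    \<comment> \<open>One third of the first flatness hypothesis, rewritten for
      \<open>p = P / 3\<close> and \<open>q = Q / 3\<close>.\<close>
    have 1: "2 * ddy (ddx p) z - ddx (ddx q) z + 3 * (p z * ddx q z) - 6 * (p z * ddy p z) = 0"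
    proof -
      have "ddx (\<lambda>q. 2 * ddy P q - ddx Q q) z = ddx (\<lambda>z. 2 * (3 * ddy p z) - 3 * ddx q z) z"
        by (rule dd_cong(1)[OF U(1) z])
          (auto simp: dPQ intro!: smooth_on_differentiable[OF _ z] smooth_on_diff smooth_on_mult smooth_on_const
            U smooth_on_ddx smooth_on_ddy P Q)
      also have "\<dots> = 6 * ddy (ddx p) z - 3 * ddx (ddx q) z"
        by (simp add: dd_simps diff z comm)
      finally show ?thesis
        using flat1[OF z] dPQ[OF z] fun_cong[OF P_eq, of z] by (simp add: algebra_simps)
    qed
    have 2: "ddy (ddy p) z - 2 * ddy (ddx q) z + 3 * (q z * ddy p z) - 6 * (q z * ddx q z) = 0"
    proof -
      have "ddy (\<lambda>q. ddy P q - 2 * ddx Q q) z = ddy (\<lambda>z. 3 * ddy p z - 2 * (3 * ddx q z)) z"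
        by (rule dd_cong(2)[OF U(1) z])
          (auto simp: dPQ intro!: smooth_on_differentiable[OF _ z] smooth_on_diff smooth_on_mult smooth_on_const
            U smooth_on_ddx smooth_on_ddy P Q)
      also have "\<dots> = 3 * ddy (ddy p) z - 6 * ddy (ddx q) z"
        by (simp add: dd_simps diff z comm)
      finally show ?thesis
        using flat2[OF z] dPQ[OF z] fun_cong[OF Q_eq, of z] by (simp add: algebra_simps)
    qed
    obtain u ux uy where w: "w = (u, ux, uy)"
      by (cases w)
    have D: "frechet_derivative ?A (at z) (0, 1)
      = ddy p z *\<^sub>R jet_xx + ddy r z *\<^sub>R jet_u1 + ddy q z *\<^sub>R jet_x2 + ddy s z *\<^sub>R jet_u2"
      "frechet_derivative ?B (at z) (1, 0)
      = ddx q z *\<^sub>R jet_xx + ddx p z *\<^sub>R jet_y1 + ddx s z *\<^sub>R jet_u1 + ddx t z *\<^sub>R jet_u2"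
      by (rule system_derivatives; rule smooth_on_differentiable[OF _ z]; rule pq rst)+
    \<comment> \<open>The terms in \<open>ux\<close> and \<open>uy\<close> cancel by the choice of
      \<open>r\<close> and \<open>s\<close>; what remains is a multiple of \<open>u\<close>, whose
      coefficient is relation \<open>1\<close>. The identity \<open>c2\<close> uses relation
      \<open>2\<close> in the same way.\<close>
    have c1: "ddy p z * ux + ddy r z * u + (p z * (q z * ux - p z * uy + s z * u) + r z * uy)
      = ddx q z * ux - ddx p z * uy + ddx s z * u
        + (q z * (p z * ux + r z * u) - p z * (q z * ux - p z * uy + s z * u) + s z * ux)"
    proof -
      have "ddx s z - ddy r z + q z * r z - 2 * (p z * s z) = 0"
        unfolding dr ds val using 1 by (simp add: algebra_simps)
      then have "u * (ddx s z - ddy r z + q z * r z - 2 * (p z * s z)) = 0"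
        by simp
      then show ?thesis
        unfolding val(1) by (simp add: algebra_simps val(2))
    qed
    have c2: "- (ddy p z * uy) + ddy q z * ux + ddy s z * u
        + (q z * (q z * ux - p z * uy + s z * u) - p z * (- (q z * uy) + t z * u) + s z * uy)
      = - (ddx q z * uy) + ddx t z * u + (- (q z * (q z * ux - p z * uy + s z * u)) + t z * ux)"
    proof -
      have "ddy s z - ddx t z + 2 * (q z * s z) - p z * t z = 0"
        unfolding dt ds val using 2 by (simp add: algebra_simps)
      then have "u * (ddy s z - ddx t z + 2 * (q z * s z) - p z * t z) = 0"
        by simp
      then show ?thesis
        unfolding val(3) by (simp add: algebra_simps val(2))
    qed
    show ?thesis
      unfolding w D blinfun.add_left blinfun.scaleR_left system_apply jet_apply
      using c1 c2 by simp
  qed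
  from compatible_linear_system_solvable[OF U AB compat]
  obtain N where N: "open N" "z0 \<in> N" "N \<subseteq> U"
    and sol: "\<forall>v. \<exists>\<psi>. \<psi> z0 = v \<and> smooth_on N \<psi> \<and> (\<forall>z\<in>N. (\<psi> has_derivative
      (\<lambda>h. fst h *\<^sub>R blinfun_apply (?A z) (\<psi> z) + snd h *\<^sub>R blinfun_apply (?B z) (\<psi> z))) (at z))"
    by blast
  show ?thesis
    unfolding is_solution_def p_def[symmetric] q_def[symmetric]
    using N sol rst[THEN smooth_on_subset, OF N(3)]
    by (intro exI[of _ N] exI[of _ r] exI[of _ s] exI[of _ t]) simp
qed

section \<open>Solutions restricted to the leaves\<close>

lemma leaf_mono: "U \<subseteq> V \<Longrightarrow> leaf \<omega> U q \<subseteq> leaf \<omega> V q"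
  unfolding leaf_def by blast

lemma is_solution_components:
  assumes sol: "is_solution (system_x p q r s) (system_y p q s t) N \<psi>" and z: "z \<in> N"
  shows "((\<lambda>z. fst (\<psi> z)) has_derivative
      (\<lambda>h. fst h * fst (snd (\<psi> z)) + snd h * snd (snd (\<psi> z)))) (at z)"
    "((\<lambda>z. fst (snd (\<psi> z))) has_derivative
      (\<lambda>h. fst h * (p z * fst (snd (\<psi> z)) + r z * fst (\<psi> z))
        + snd h * (q z * fst (snd (\<psi> z)) - p z * snd (snd (\<psi> z)) + s z * fst (\<psi> z)))) (at z)"
    "((\<lambda>z. snd (snd (\<psi> z))) has_derivative
      (\<lambda>h. fst h * (q z * fst (snd (\<psi> z)) - p z * snd (snd (\<psi> z)) + s z * fst (\<psi> z))
        + snd h * (- (q z * snd (snd (\<psi> z))) + t z * fst (\<psi> z)))) (at z)"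
proof -
  obtain u ux uy where \<psi>z: "\<psi> z = (u, ux, uy)"
    by (cases "\<psi> z")
  have d: "(\<psi> has_derivative (\<lambda>h. fst h *\<^sub>R (ux, p z * ux + r z * u, q z * ux - p z * uy + s z * u)
      + snd h *\<^sub>R (uy, q z * ux - p z * uy + s z * u, - (q z * uy) + t z * u))) (at z)"
    using bspec[OF sol[unfolded is_solution_def] z] by (simp only: \<psi>z system_apply)
  show "((\<lambda>z. fst (\<psi> z)) has_derivative
      (\<lambda>h. fst h * fst (snd (\<psi> z)) + snd h * snd (snd (\<psi> z)))) (at z)"
    using has_derivative_fst[OF d] by (simp add: \<psi>z)
  show "((\<lambda>z. fst (snd (\<psi> z))) has_derivative
      (\<lambda>h. fst h * (p z * fst (snd (\<psi> z)) + r z * fst (\<psi> z))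
        + snd h * (q z * fst (snd (\<psi> z)) - p z * snd (snd (\<psi> z)) + s z * fst (\<psi> z)))) (at z)"
    using has_derivative_fst[OF has_derivative_snd[OF d]] by (simp add: \<psi>z)
  show "((\<lambda>z. snd (snd (\<psi> z))) has_derivative
      (\<lambda>h. fst h * (q z * fst (snd (\<psi> z)) - p z * snd (snd (\<psi> z)) + s z * fst (\<psi> z))
        + snd h * (- (q z * snd (snd (\<psi> z))) + t z * fst (\<psi> z)))) (at z)"
    using has_derivative_snd[OF has_derivative_snd[OF d]] by (simp add: \<psi>z)
qed

definition jet_directional :: "(real \<times> real \<Rightarrow> real \<times> real) \<Rightarrow> (real \<times> real \<Rightarrow> jet) \<Rightarrow> real \<times> real \<Rightarrow> real"
  where "jet_directional T \<psi> z = fst (T z) * fst (snd (\<psi> z)) + snd (T z) * snd (snd (\<psi> z))"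

text \<open>Along a geodesic, \<open>u\<close> and its derivative in the direction of the geodesic satisfy a homogeneous
  linear system of ordinary differential equations.\<close>

lemma jet_directional_derivative:
  assumes sol: "is_solution (system_x (\<lambda>z. P z / 3) (\<lambda>z. Q z / 3) r s)
      (system_y (\<lambda>z. P z / 3) (\<lambda>z. Q z / 3) s t) N \<psi>" and z: "z \<in> N"
    and T: "smooth_on N T" and T0: "T z \<noteq> 0" and geod: "geodesic_field P Q T z"
    and \<alpha>_def: "\<alpha> = ((P z / 3 * (fst (T z))^2 + 2 * (Q z / 3) * fst (T z) * snd (T z)
        + directional T (\<lambda>z. fst (T z)) z) * fst (T z)
      + (- 2 * (P z / 3) * fst (T z) * snd (T z) - Q z / 3 * (snd (T z))^2
        + directional T (\<lambda>z. snd (T z)) z) * snd (T z)) / ((fst (T z))^2 + (snd (T z))^2)"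
    and \<beta>_def: "\<beta> = r z * (fst (T z))^2 + 2 * s z * fst (T z) * snd (T z) + t z * (snd (T z))^2"
  shows "\<exists>v'. (jet_directional T \<psi> has_derivative v') (at z) \<and>
    (\<forall>c. v' (c *\<^sub>R T z) = c * (\<alpha> * jet_directional T \<psi> z + \<beta> * fst (\<psi> z)))"
proof -
  define p q where "p = P z / 3" and "q = Q z / 3"
  obtain u ux uy where \<psi>z: "fst (\<psi> z) = u" "fst (snd (\<psi> z)) = ux" "snd (snd (\<psi> z)) = uy"
    by blast
  obtain t1 t2 where t12: "fst (T z) = t1" "snd (T z) = t2"
    by blast
  have Td: "T differentiable (at z)"
    by (rule smooth_on_differentiable[OF T z])
  have T1: "(\<lambda>z. fst (T z)) differentiable (at z)" and T2: "(\<lambda>z. snd (T z)) differentiable (at z)"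
    using Td has_derivative_fst has_derivative_snd unfolding differentiable_def by blast+
  define a1 a2 b1 b2 where ab: "a1 = ddx (\<lambda>z. fst (T z)) z" "a2 = ddy (\<lambda>z. fst (T z)) z"
    "b1 = ddx (\<lambda>z. snd (T z)) z" "b2 = ddy (\<lambda>z. snd (T z)) z"
  note comp = is_solution_components[OF sol z, unfolded \<psi>z]
  let ?v' = "\<lambda>h. t1 * (fst h * (p * ux + r z * u) + snd h * (q * ux - p * uy + s z * u))
      + (fst h * a1 + snd h * a2) * ux
      + (t2 * (fst h * (q * ux - p * uy + s z * u) + snd h * (- (q * uy) + t z * u))
      + (fst h * b1 + snd h * b2) * uy)"
  have "(jet_directional T \<psi> has_derivative ?v') (at z)"
    using has_derivative_add[OF has_derivative_mult[OF has_derivative_dd[OF T1] comp(2)]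
        has_derivative_mult[OF has_derivative_dd[OF T2] comp(3)]]
    unfolding jet_directional_def[abs_def] ab p_def q_def t12 \<psi>z .
  moreover have "?v' (c *\<^sub>R T z) = c * (\<alpha> * jet_directional T \<psi> z + \<beta> * fst (\<psi> z))" for c
  proof -
    \<comment> \<open>The coefficients of \<open>ux\<close> and \<open>uy\<close> in the second
      derivative of the solution along \<open>T\<close>.\<close>
    define V1 V2 where "V1 = p * t1^2 + 2 * q * t1 * t2 + (t1 * a1 + t2 * a2)"
      and "V2 = - 2 * p * t1 * t2 - q * t2^2 + (t1 * b1 + t2 * b2)"
    have g: "t1 * (t1 * b1 + t2 * b2) - t2 * (t1 * a1 + t2 * a2) = t1 * t2 * (3 * p * t1 + 3 * q * t2)"
      using geod unfolding geodesic_field_def directional_def t12 ab p_def q_def by simp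
    \<comment> \<open>The weights one third add up to the full \<open>P\<close> and \<open>Q\<close>
      here, so the geodesic equation says that \<open>(V1, V2)\<close> is parallel to
      \<open>T\<close>. Its factor is \<open>\<alpha>\<close>, written as a projection onto
      \<open>T\<close> so that vertical and horizontal directions need no separate cases.\<close>
    have par: "t1 * V2 = t2 * V1"
      using g unfolding V1_def V2_def by (simp add: algebra_simps power2_eq_square)
    have n0: "t1^2 + t2^2 \<noteq> 0"
      using T0 t12 by (auto simp: prod_eq_iff sum_power2_eq_zero_iff)
    have \<alpha>: "\<alpha> = (V1 * t1 + V2 * t2) / (t1^2 + t2^2)"
      unfolding \<alpha>_def V1_def V2_def t12 directional_def p_def q_def ab by simp
    have "(V1 * t1 + V2 * t2) * t1 = V1 * (t1^2 + t2^2)" "(V1 * t1 + V2 * t2) * t2 = V2 * (t1^2 + t2^2)"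
      using par by (simp_all add: algebra_simps power2_eq_square)
    then have \<alpha>T: "\<alpha> * t1 = V1" "\<alpha> * t2 = V2"
      unfolding \<alpha> using n0 by (simp_all add: field_simps)
    have "?v' (c *\<^sub>R T z) = c * (V1 * ux + V2 * uy + \<beta> * u)"
      unfolding V1_def V2_def \<beta>_def fst_scaleR snd_scaleR t12 real_scaleR_def
      by (simp add: algebra_simps power2_eq_square)
    also have "\<dots> = c * (\<alpha> * jet_directional T \<psi> z + \<beta> * fst (\<psi> z))"
      unfolding jet_directional_def t12 \<psi>z \<alpha>T[symmetric] by (simp add: algebra_simps)
    finally show ?thesis .
  qed
  ultimately show ?thesis
    by (intro exI[of _ ?v'] conjI allI)
qed

text \<open>Along a path in the leaf, the pair of the solution and its \<open>T\<close>-derivative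
  grows at most linearly in its own size, and it is zero at the start.\<close>

lemma solution_vanishes_on_leaf:
  assumes sol: "is_solution (system_x (\<lambda>z. P z / 3) (\<lambda>z. Q z / 3) r s)
      (system_y (\<lambda>z. P z / 3) (\<lambda>z. Q z / 3) s t) N \<psi>"
    and N: "open N" and P: "smooth_on N P" and Q: "smooth_on N Q"
    and rst: "smooth_on N r" "smooth_on N s" "smooth_on N t"
    and T: "smooth_on N T" and geod: "\<And>z. z \<in> N \<Longrightarrow> T z \<noteq> 0 \<and> geodesic_field P Q T z"
    and \<omega>: "\<And>z v. z \<in> N \<Longrightarrow> \<omega> z v = 0 \<Longrightarrow> \<exists>c. v = c *\<^sub>R T z"
    and init: "fst (\<psi> q) = 0" "jet_directional T \<psi> q = 0"
    and x: "x \<in> leaf \<omega> N q"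
  shows "fst (\<psi> x) = 0"
proof -
  obtain \<gamma> where \<gamma>: "x = \<gamma> 1" "\<gamma> C1_differentiable_on {0..1}" "\<gamma> ` {0..1} \<subseteq> N" "\<gamma> 0 = q"
    "\<forall>t\<in>{0..1}. \<omega> (\<gamma> t) (vector_derivative \<gamma> (at t)) = 0"
    using x unfolding leaf_def by blast
  obtain D where D: "\<And>t. t \<in> {0..1} \<Longrightarrow> (\<gamma> has_vector_derivative D t) (at t)" "continuous_on {0..1} D"
    using \<gamma>(2) unfolding C1_differentiable_on_def by blast
  have \<gamma>N: "\<gamma> t \<in> N" if "t \<in> {0..1}" for t
    using \<gamma>(3) that by blast
  \<comment> \<open>The speed of the path relative to \<open>T\<close>, given by a projection
    formula rather than chosen pointwise, which makes it continuous. It may vanish or change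
    sign.\<close>
  define c where "c t = (D t \<bullet> T (\<gamma> t)) / (T (\<gamma> t) \<bullet> T (\<gamma> t))" for t
  have Dc: "D t = c t *\<^sub>R T (\<gamma> t)" if t: "t \<in> {0..1}" for t
  proof -
    have "\<omega> (\<gamma> t) (D t) = 0"
      using bspec[OF \<gamma>(5) t] unfolding vector_derivative_at[OF D(1)[OF t]] .
    from \<omega>[OF \<gamma>N[OF t] this] obtain c' where "D t = c' *\<^sub>R T (\<gamma> t)"
      by blast
    then show ?thesis
      using geod[OF \<gamma>N[OF t]] by (simp add: c_def)
  qed
  define \<alpha> where "\<alpha> z = ((P z / 3 * (fst (T z))^2 + 2 * (Q z / 3) * fst (T z) * snd (T z)
        + directional T (\<lambda>z. fst (T z)) z) * fst (T z)
      + (- 2 * (P z / 3) * fst (T z) * snd (T z) - Q z / 3 * (snd (T z))^2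
        + directional T (\<lambda>z. snd (T z)) z) * snd (T z)) / ((fst (T z))^2 + (snd (T z))^2)" for z
  define \<beta> where "\<beta> z = r z * (fst (T z))^2 + 2 * s z * fst (T z) * snd (T z) + t z * (snd (T z))^2" for z
  have n0: "(fst (T z))^2 + (snd (T z))^2 \<noteq> 0" if "z \<in> N" for z
    using geod[OF that] by (auto simp: prod_eq_iff sum_power2_eq_zero_iff)
  have "smooth_on N \<alpha>"
    unfolding \<alpha>_def[abs_def]
    by (intro smooth_on_divide smooth_on_add smooth_on_diff smooth_on_mult smooth_on_power smooth_on_const
        smooth_on_fst smooth_on_snd smooth_on_directional N P Q T n0) simp_all
  moreover have "smooth_on N \<beta>"
    unfolding \<beta>_def[abs_def]
    by (intro smooth_on_add smooth_on_mult smooth_on_power smooth_on_const smooth_on_fst smooth_on_snd N rst T)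
  ultimately have \<alpha>\<beta>c: "continuous_on N \<alpha>" "continuous_on N \<beta>"
    by (simp_all add: smooth_on_continuous_on)
  have \<gamma>c: "continuous_on {0..1} \<gamma>"
    by (rule continuous_at_imp_continuous_on) (use D(1) has_vector_derivative_continuous in blast)
  note comp = continuous_on_compose2[OF _ \<gamma>c \<gamma>(3)]
  have Tc: "continuous_on {0..1} (\<lambda>t. T (\<gamma> t))"
    by (rule comp[OF smooth_on_continuous_on[OF T]])
  \<comment> \<open>The three summands account for the entry \<open>v\<close>, for
    \<open>\<alpha> * v\<close> and for \<open>\<beta> * u\<close> in the derivative of the
    pair.\<close>
  define \<kappa> where "\<kappa> t = \<bar>c t\<bar> * (1 + \<bar>\<alpha> (\<gamma> t)\<bar> + \<bar>\<beta> (\<gamma> t)\<bar>)" for t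
  have "continuous_on {0..1} c"
    unfolding c_def[abs_def]
    by (intro continuous_on_divide continuous_on_inner D(2) Tc) (use geod[OF \<gamma>N] in simp)
  then have "continuous_on {0..1} \<kappa>"
    unfolding \<kappa>_def[abs_def]
    by (intro continuous_on_mult continuous_on_add continuous_on_rabs continuous_on_const
        comp[OF \<alpha>\<beta>c(1)] comp[OF \<alpha>\<beta>c(2)])
  then have "bounded (\<kappa> ` {0..1})"
    by (intro compact_imp_bounded compact_continuous_image compact_Icc)
  then obtain C where C: "\<And>t. t \<in> {0..1} \<Longrightarrow> \<bar>\<kappa> t\<bar> \<le> C"
    unfolding bounded_iff ball_simps real_norm_def by blast
  let ?u = "\<lambda>z. fst (\<psi> z)" and ?v = "jet_directional T \<psi>"
  let ?W = "\<lambda>t. (?u (\<gamma> t), ?v (\<gamma> t))"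
  let ?W' = "\<lambda>t. (c t * ?v (\<gamma> t), c t * (\<alpha> (\<gamma> t) * ?v (\<gamma> t) + \<beta> (\<gamma> t) * ?u (\<gamma> t)))"
  have "?W 1 = 0"
  proof (rule linear_growth_zero[of ?W ?W' C])
    fix t :: real assume t: "t \<in> {0..1}"
    obtain v' where v': "(?v has_derivative v') (at (\<gamma> t))"
      "\<And>c. v' (c *\<^sub>R T (\<gamma> t)) = c * (\<alpha> (\<gamma> t) * ?v (\<gamma> t) + \<beta> (\<gamma> t) * ?u (\<gamma> t))"
      using jet_directional_derivative[OF sol \<gamma>N[OF t] T _ _ \<alpha>_def \<beta>_def] geod[OF \<gamma>N[OF t]] by blast
    have 1: "((\<lambda>t. ?v (\<gamma> t)) has_vector_derivative
        c t * (\<alpha> (\<gamma> t) * ?v (\<gamma> t) + \<beta> (\<gamma> t) * ?u (\<gamma> t))) (at t)"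
      using vector_derivative_diff_chain_within[OF D(1)[OF t] has_derivative_at_withinI[OF v'(1)]]
      by (simp add: o_def Dc[OF t] v'(2))
    have 2: "((\<lambda>t. ?u (\<gamma> t)) has_vector_derivative c t * ?v (\<gamma> t)) (at t)"
      using vector_derivative_diff_chain_within[OF D(1)[OF t]
          has_derivative_at_withinI[OF is_solution_components(1)[OF sol \<gamma>N[OF t]]]]
      by (simp add: o_def Dc[OF t] jet_directional_def algebra_simps)
    show "(?W has_vector_derivative ?W' t) (at t)"
      by (rule has_vector_derivative_Pair[OF 2 1])
    have W: "\<bar>?u (\<gamma> t)\<bar> \<le> norm (?W t)" "\<bar>?v (\<gamma> t)\<bar> \<le> norm (?W t)"
      using norm_fst_le[of "?u (\<gamma> t)" "?v (\<gamma> t)"] norm_snd_le[of "?v (\<gamma> t)" "?u (\<gamma> t)"] by simp_all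
    have "norm (?W' t) \<le> \<bar>c t * ?v (\<gamma> t)\<bar> + \<bar>c t * (\<alpha> (\<gamma> t) * ?v (\<gamma> t) + \<beta> (\<gamma> t) * ?u (\<gamma> t))\<bar>"
      using norm_Pair_le[of "c t * ?v (\<gamma> t)" "c t * (\<alpha> (\<gamma> t) * ?v (\<gamma> t) + \<beta> (\<gamma> t) * ?u (\<gamma> t))"] by simp
    also have "\<dots> = \<bar>c t\<bar> * (\<bar>?v (\<gamma> t)\<bar> + \<bar>\<alpha> (\<gamma> t) * ?v (\<gamma> t) + \<beta> (\<gamma> t) * ?u (\<gamma> t)\<bar>)"
      unfolding abs_mult[of "c t"] by (rule distrib_left[symmetric])
    also have "\<dots> \<le> \<bar>c t\<bar> * (norm (?W t) + (\<bar>\<alpha> (\<gamma> t)\<bar> * norm (?W t) + \<bar>\<beta> (\<gamma> t)\<bar> * norm (?W t)))"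
      by (intro mult_left_mono add_mono order_trans[OF abs_triangle_ineq] W)
        (simp_all add: abs_mult mult_left_mono W)
    also have "\<dots> = \<kappa> t * norm (?W t)"
      by (simp add: \<kappa>_def algebra_simps)
    also have "\<dots> \<le> C * norm (?W t)"
      by (intro mult_right_mono order_trans[OF abs_ge_self C[OF t]]) simp
    finally show "norm (?W' t) \<le> C * norm (?W t)" .
  qed (simp_all add: \<gamma>(4) init zero_prod_def)
  then show ?thesis
    by (simp add: \<gamma>(1) zero_prod_def)
qed

section \<open>Projective charts\<close>

text \<open>The inverse \<open>g\<close> has derivative \<open>G (g y)\<close> with \<open>G\<close>
  smooth, so its smoothness follows by induction on the order.\<close>

lemma planar_inverse_function:
  fixes \<Theta> :: "real \<times> real \<Rightarrow> real \<times> real"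
  assumes N: "open N" "p \<in> N" and \<Theta>: "smooth_on N \<Theta>" and id: "\<And>v. frechet_derivative \<Theta> (at p) v = v"
  shows "\<exists>U V g. open U \<and> p \<in> U \<and> U \<subseteq> N \<and> open V \<and> \<Theta> ` U = V \<and> (\<forall>q\<in>U. g (\<Theta> q) = q) \<and> smooth_on V g"
proof -
  let ?x = "\<lambda>q. frechet_derivative \<Theta> (at q) (1, 0)" and ?y = "\<lambda>q. frechet_derivative \<Theta> (at q) (0, 1)"
  define J where "J q = fst (?x q) * snd (?y q) - snd (?x q) * fst (?y q)" for q
  have xy: "smooth_on N ?x" "smooth_on N ?y"
    by (rule smooth_on_derivative[OF \<Theta>])+
  have J: "smooth_on N J"
    unfolding J_def[abs_def] by (intro smooth_on_diff smooth_on_mult smooth_on_fst smooth_on_snd N xy)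
  \<comment> \<open>Away from the zeros of the Jacobian determinant, Cramer's rule may be used at
    every point and not only at \<open>p\<close>.\<close>
  define N1 where "N1 = N \<inter> J -` (- {0})"
  have N1: "open N1" "p \<in> N1" "N1 \<subseteq> N"
    using continuous_open_preimage[OF smooth_on_continuous_on[OF J] N(1), of "- {0}"] N(2)
    by (auto simp: N1_def J_def id)
  define f' where "f' q = (blinfun_scaleR_left (?x q) o\<^sub>L fst_blinfun) + (blinfun_scaleR_left (?y q) o\<^sub>L snd_blinfun)" for q
  have f'_apply: "blinfun_apply (f' q) h = fst h *\<^sub>R ?x q + snd h *\<^sub>R ?y q" for q h
    by (simp add: f'_def blinfun.add_left)
  have deriv: "(\<Theta> has_derivative blinfun_apply (f' q)) (at q)" if "q \<in> N1" for q
  proof -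
    have q: "q \<in> N"
      using that N1(3) by blast
    have "blinfun_apply (f' q) = frechet_derivative \<Theta> (at q)"
      by (rule ext)
        (rule trans[OF f'_apply frechet_derivative_plane[OF smooth_on_differentiable[OF \<Theta> q], symmetric]])
    then show ?thesis
      using smooth_on_has_derivative[OF \<Theta> q] by simp
  qed
  have "continuous_on N1 f'"
    unfolding f'_def[abs_def]
    by (intro continuous_on_add bounded_bilinear.continuous_on[OF bounded_bilinear_blinfun_compose]
        bounded_linear.continuous_on[OF bounded_linear_blinfun_scaleR_left] continuous_on_const
        continuous_on_subset[OF smooth_on_continuous_on[OF xy(1)] N1(3)]
        continuous_on_subset[OF smooth_on_continuous_on[OF xy(2)] N1(3)])
  moreover have "id_blinfun o\<^sub>L f' p = id_blinfun"
    by (rule blinfun_eqI) (simp add: f'_apply id prod_eq_iff)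
  ultimately obtain U V g g' where UV: "open U" "U \<subseteq> N1" "p \<in> U" "open V" "\<Theta> p \<in> V" "homeomorphism U V \<Theta> g"
    and g': "\<And>y. y \<in> V \<Longrightarrow> (g has_derivative (g' y)) (at y)"
      "\<And>y. y \<in> V \<Longrightarrow> g' y = inv (blinfun_apply (f' (g y)))"
      "\<And>y. y \<in> V \<Longrightarrow> bij (blinfun_apply (f' (g y)))"
    using inverse_function_theorem[OF N1(1) deriv _ N1(2)] by blast
  \<comment> \<open>Cramer's rule for the inverse of the Jacobian matrix; unlike \<open>inv\<close>,
    this formula is visibly smooth in \<open>q\<close>.\<close>
  define G where "G q k = ((snd (?y q) * fst k - fst (?y q) * snd k) / J q, (fst (?x q) * snd k - snd (?x q) * fst k) / J q)"
    for q and k :: "real \<times> real"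
  have gU: "g y \<in> U" if "y \<in> V" for y
    using homeomorphism_image2[OF UV(6)] that by blast
  have gN1: "g ` V \<subseteq> N1"
    using gU UV(2) by blast
  have g'_eq: "g' y k = G (g y) k" if y: "y \<in> V" for y k
  proof -
    have "J (g y) \<noteq> 0"
      using gU[OF y] UV(2) by (auto simp: N1_def)
    then have "blinfun_apply (f' (g y)) (G (g y) k) = k"
      unfolding f'_apply G_def by (simp add: prod_eq_iff field_simps) (simp add: J_def algebra_simps)
    then show ?thesis
      unfolding g'(2)[OF y] by (rule inv_f_eq[OF bij_is_inj[OF g'(3)[OF y]]])
  qed
  have g_deriv: "(g has_derivative G (g y)) (at y)" if "y \<in> V" for y
  proof -
    have "g' y = G (g y)"
      by (rule ext) (rule g'_eq[OF that])
    with g'(1)[OF that] show ?thesis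
      by simp
  qed
  have G: "smooth_on N1 (\<lambda>q. G q k)" for k
    unfolding G_def
    by (intro smooth_on_Pair smooth_on_divide smooth_on_diff smooth_on_mult smooth_on_const smooth_on_fst
        smooth_on_snd N1(1) smooth_on_subset[OF xy(1) N1(3)] smooth_on_subset[OF xy(2) N1(3)]
        smooth_on_subset[OF J N1(3)]) (simp_all add: N1_def)
  have "Ck_on k V g" for k
  proof (induction k)
    case 0
    then show ?case
      using homeomorphism_cont2[OF UV(6)] by simp
  next
    case (Suc k)
    show ?case
    proof (rule Ck_on_Suc_has_derivativeI[OF UV(4) g_deriv])
      have "Ck_on k N1 (\<lambda>q. G q v)" for v
        using G by (simp add: smooth_on_def)
      then show "Ck_on k V (\<lambda>y. G (g y) v)" for v
        by (rule Ck_on_compose[OF UV(4) N1(1) gN1 Suc.IH])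
    qed
  qed
  then have "smooth_on V g"
    by (simp add: smooth_on_def)
  moreover have "\<Theta> ` U = V" "\<forall>q\<in>U. g (\<Theta> q) = q"
    using homeomorphism_image1[OF UV(6)] homeomorphism_apply1[OF UV(6)] by blast+
  ultimately show ?thesis
    using UV(1-4) N1(3) by (intro exI[of _ U] exI[of _ V] exI[of _ g]) auto
qed

lemma span_singleton_eq_iff:
  fixes v w :: "'a::real_vector"
  assumes "v \<noteq> 0" "w \<noteq> 0"
  shows "span {v} = span {w} \<longleftrightarrow> (\<exists>k. k \<noteq> 0 \<and> v = k *\<^sub>R w)"
proof
  assume "span {v} = span {w}"
  then have "v \<in> span {w}"
    using span_base[of v "{v}"] by simp
  then obtain k where "v = k *\<^sub>R w"
    by (auto simp: span_singleton)
  with assms(1) show "\<exists>k. k \<noteq> 0 \<and> v = k *\<^sub>R w"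
    by auto
next
  assume "\<exists>k. k \<noteq> 0 \<and> v = k *\<^sub>R w"
  then obtain k where k: "k \<noteq> 0" "v = k *\<^sub>R w"
    by blast
  have "c *\<^sub>R w = (c / k) *\<^sub>R v" "c *\<^sub>R v = (c * k) *\<^sub>R w" for c
    using k by simp_all
  then show "span {v} = span {w}"
    unfolding span_singleton by blast
qed

lemma smooth_on_vec3:
  assumes "open U" "smooth_on U u" "smooth_on U v" "smooth_on U w"
  shows "smooth_on U (\<lambda>q. vector [u q, v q, w q] :: real^3)"
proof -
  have "smooth_on U (\<lambda>q. u q *\<^sub>R axis 1 1 + v q *\<^sub>R axis 2 1 + w q *\<^sub>R axis 3 1 :: real^3)"
    by (intro smooth_on_add smooth_on_scaleR smooth_on_const assms)
  moreover have "(\<lambda>q. u q *\<^sub>R axis 1 1 + v q *\<^sub>R axis 2 1 + w q *\<^sub>R axis 3 1 :: real^3)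
      = (\<lambda>q. vector [u q, v q, w q])"
    by (simp add: fun_eq_iff vec_eq_iff forall_3 axis_def)
  ultimately show ?thesis
    by simp
qed

text \<open>The values prescribed at \<open>p\<close> make the derivative of the affine map
  \<open>(u1 / u0, u2 / u0)\<close> at \<open>p\<close> the identity, so the inverse function
  theorem applies to it.\<close>

lemma projective_chart:
  assumes N: "open N" "p \<in> N"
    and u: "smooth_on N u0" "smooth_on N u1" "smooth_on N u2"
    and at_p: "u0 p = 1" "u1 p = 0" "u2 p = 0" "ddx u1 p = 1" "ddy u1 p = 0" "ddx u2 p = 0" "ddy u2 p = 1"
  shows "\<exists>U. p \<in> U \<and> U \<subseteq> N \<and> (\<forall>q\<in>U. u0 q \<noteq> 0) \<and>
    diffeo_onto_proj U (\<lambda>q. span {vector [u1 q, u2 q, u0 q]})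
      ((\<lambda>q. span {vector [u1 q, u2 q, u0 q]}) ` U)"
proof -
  define F where "F q = (vector [u1 q, u2 q, u0 q] :: real^3)" for q
  let ?\<phi> = "\<lambda>q. span {F q}"
  have F_nth: "F q $ 1 = u1 q" "F q $ 2 = u2 q" "F q $ 3 = u0 q" for q
    by (simp_all add: F_def)
  define N0 where "N0 = N \<inter> u0 -` (- {0})"
  have N0: "open N0" "p \<in> N0" "N0 \<subseteq> N" and nz: "\<And>q. q \<in> N0 \<Longrightarrow> u0 q \<noteq> 0"
    using continuous_open_preimage[OF smooth_on_continuous_on[OF u(1)] N(1), of "- {0}"] N(2) at_p(1)
    by (auto simp: N0_def)
  note u' = u[THEN smooth_on_subset[OF _ N0(3)]]
  define \<Theta> where "\<Theta> q = (u1 q / u0 q, u2 q / u0 q)" for q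
  have \<Theta>: "smooth_on N0 \<Theta>"
    unfolding \<Theta>_def[abs_def] by (intro smooth_on_Pair smooth_on_divide N0(1) u' nz)
  have id: "frechet_derivative \<Theta> (at p) v = v" for v
  proof -
    have d: "u0 differentiable (at p)" "u1 differentiable (at p)" "u2 differentiable (at p)"
      using smooth_on_differentiable N(2) u by blast+
    have dd: "ddx (\<lambda>q. u1 q / u0 q) p = 1" "ddy (\<lambda>q. u1 q / u0 q) p = 0"
      "ddx (\<lambda>q. u2 q / u0 q) p = 0" "ddy (\<lambda>q. u2 q / u0 q) p = 1"
      by (simp_all add: dd_divide d at_p)
    have "(\<lambda>q. u1 q / u0 q) differentiable (at p)" "(\<lambda>q. u2 q / u0 q) differentiable (at p)"
      using d at_p(1) by (simp_all add: differentiable_divide)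
    from has_derivative_Pair[OF this[THEN has_derivative_dd]]
    have "(\<Theta> has_derivative (\<lambda>v. v)) (at p)"
      unfolding dd \<Theta>_def[abs_def] by simp
    from frechet_derivative_at[OF this] show ?thesis
      by metis
  qed
  obtain U V g where UV: "open U" "p \<in> U" "U \<subseteq> N0" "open V" "\<Theta> ` U = V"
    and g: "\<And>q. q \<in> U \<Longrightarrow> g (\<Theta> q) = q" "smooth_on V g"
    using planar_inverse_function[OF N0(1,2) \<Theta> id] by blast
  have F0: "F q \<noteq> 0" if "q \<in> U" for q
    using F_nth(3)[of q] nz[of q] UV(3) that by auto
  have ratio: "u0 q \<noteq> 0" "\<Theta> q = (v $ 1 / v $ 3, v $ 2 / v $ 3)" "v $ 3 \<noteq> 0"
    if h: "q \<in> U" "v \<noteq> 0" "span {v} = span {F q}" for q v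
  proof -
    show u0: "u0 q \<noteq> 0"
      using nz UV(3) h(1) by blast
    obtain k where k: "k \<noteq> 0" "v = k *\<^sub>R F q"
      using span_singleton_eq_iff[OF h(2) F0[OF h(1)]] h(3) by blast
    with u0 show "\<Theta> q = (v $ 1 / v $ 3, v $ 2 / v $ 3)" "v $ 3 \<noteq> 0"
      by (simp_all add: F_nth \<Theta>_def)
  qed
  have inj: "inj_on ?\<phi> U"
  proof (rule inj_onI)
    fix q q' assume q: "q \<in> U" "q' \<in> U" "span {F q} = span {F q'}"
    have "\<Theta> q = \<Theta> q'"
      using ratio(2)[OF q(1) F0[OF q(1)] refl] ratio(2)[OF q(2) F0[OF q(1)] q(3)] by simp
    then have "g (\<Theta> q) = g (\<Theta> q')"
      by (rule arg_cong)
    then show "q = q'"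
      unfolding g(1)[OF q(1)] g(1)[OF q(2)] .
  qed
  define r where "r v = (v $ 1 / v $ 3, v $ 2 / v $ 3)" for v :: "real^3"
  let ?D = "{v :: real^3. v $ 3 \<noteq> 0}"
  have D: "open ?D"
    by (intro open_Collect_neq continuous_intros)
  have r: "smooth_on ?D r"
    unfolding r_def[abs_def]
    by (intro smooth_on_Pair smooth_on_divide D smooth_on_bounded_linear[OF bounded_linear_vec_nth D smooth_on_ident] D) simp_all
  \<comment> \<open>The cone is the preimage of \<open>V\<close> under the affine coordinate map
    \<open>r\<close>. This gives openness of the image, and it gives smoothness of the inverse
    chart, which lifts to \<open>g\<close> after \<open>r\<close>.\<close>
  have cone: "cone_over (?\<phi> ` U) = ?D \<inter> r -` V"
  proof (intro set_eqI iffI)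
    fix v assume "v \<in> cone_over (?\<phi> ` U)"
    then obtain q where q: "v \<noteq> 0" "q \<in> U" "span {v} = span {F q}"
      unfolding cone_over_def by blast
    have "r v \<in> V"
      unfolding r_def ratio(2)[OF q(2,1,3), symmetric] UV(5)[symmetric] by (rule imageI[OF q(2)])
    with ratio(3)[OF q(2,1,3)] show "v \<in> ?D \<inter> r -` V"
      by simp
  next
    fix v assume v: "v \<in> ?D \<inter> r -` V"
    then obtain q where q: "q \<in> U" "r v = \<Theta> q"
      using UV(5) by blast
    have u0: "u0 q \<noteq> 0" and v3: "v $ 3 \<noteq> 0"
      using nz[OF subsetD[OF UV(3) q(1)]] v by simp_all
    have "v = (v $ 3 / u0 q) *\<^sub>R F q"
      using q(2) u0 v3 by (simp add: vec_eq_iff forall_3 F_nth r_def \<Theta>_def field_simps)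
    moreover have v0: "v \<noteq> 0"
      using v3 by auto
    moreover have "v $ 3 / u0 q \<noteq> 0"
      using u0 v3 by simp
    ultimately have "span {v} = span {F q}"
      using span_singleton_eq_iff[OF v0 F0[OF q(1)]] by blast
    with q(1) v0 show "v \<in> cone_over (?\<phi> ` U)"
      unfolding cone_over_def by blast
  qed
  have cone_open: "open (?D \<inter> r -` V)"
    by (rule continuous_open_preimage[OF smooth_on_continuous_on[OF r] D UV(4)])
  have "smooth_on (?D \<inter> r -` V) (\<lambda>v. inv_into U ?\<phi> (span {v}))"
  proof (rule smooth_on_cong[OF cone_open])
    show "smooth_on (?D \<inter> r -` V) (\<lambda>v. g (r v))"
      by (rule smooth_on_compose[OF cone_open UV(4) _ smooth_on_subset[OF r] g(2)]) auto
    fix v assume v: "v \<in> ?D \<inter> r -` V"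
    then obtain q where q: "v \<noteq> 0" "q \<in> U" "span {v} = span {F q}"
      unfolding cone[symmetric] cone_over_def by blast
    have "g (r v) = q"
      using g(1)[OF q(2)] ratio(2)[OF q(2,1,3)] by (simp add: r_def)
    also have "q = inv_into U ?\<phi> (span {v})"
      unfolding q(3) by (rule inv_into_f_f[OF inj q(2), symmetric])
    finally show "g (r v) = inv_into U ?\<phi> (span {v})" .
  qed
  then have from_proj: "smooth_from_proj (?\<phi> ` U) (inv_into U ?\<phi>)"
    unfolding smooth_from_proj_def cone .
  have "smooth_on U F"
    unfolding F_def[abs_def]
    by (intro smooth_on_vec3 UV(1) u[THEN smooth_on_subset]) (use UV(3) N0(3) in auto)
  then have into: "smooth_into_proj U ?\<phi>"
    unfolding smooth_into_proj_def using UV(1) F0 by (intro ballI exI[of _ U] exI[of _ F]) auto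
  have "proj_open (?\<phi> ` U)"
    unfolding proj_open_def cone proj_plane_def using cone_open F0 by blast
  then have "diffeo_onto_proj U ?\<phi> (?\<phi> ` U)"
    unfolding diffeo_onto_proj_def using UV(1) inj into from_proj by (simp add: bij_betw_def)
  then show ?thesis
    using UV(2,3) N0(3) nz unfolding F_def by (intro exI[of _ U]) auto
qed

section \<open>Sufficiency: the chart built from three solutions\<close>

lemma is_solution_add_scale:
  assumes "is_solution A B N \<psi>" "is_solution A B N \<eta>"
  shows "is_solution A B N (\<lambda>z. c *\<^sub>R \<psi> z + d *\<^sub>R \<eta> z)"
  unfolding is_solution_def
proof
  fix z assume z: "z \<in> N"
  have "((\<lambda>z. c *\<^sub>R \<psi> z + d *\<^sub>R \<eta> z) has_derivative
      (\<lambda>h. c *\<^sub>R (fst h *\<^sub>R blinfun_apply (A z) (\<psi> z) + snd h *\<^sub>R blinfun_apply (B z) (\<psi> z))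
        + d *\<^sub>R (fst h *\<^sub>R blinfun_apply (A z) (\<eta> z) + snd h *\<^sub>R blinfun_apply (B z) (\<eta> z)))) (at z)"
    by (rule has_derivative_add[OF has_derivative_scaleR_right[OF bspec[OF assms(1)[unfolded is_solution_def] z]]
          has_derivative_scaleR_right[OF bspec[OF assms(2)[unfolded is_solution_def] z]]])
  then show "((\<lambda>z. c *\<^sub>R \<psi> z + d *\<^sub>R \<eta> z) has_derivative
      (\<lambda>h. fst h *\<^sub>R blinfun_apply (A z) (c *\<^sub>R \<psi> z + d *\<^sub>R \<eta> z)
        + snd h *\<^sub>R blinfun_apply (B z) (c *\<^sub>R \<psi> z + d *\<^sub>R \<eta> z))) (at z)"
    by (simp add: blinfun.add_right blinfun.scaleR_right scaleR_add_right mult.commute[of _ c] mult.commute[of _ d] add_ac)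
qed

lemma exists_orthogonal_to_two:
  fixes v w :: "real^3"
  shows "\<exists>l. l \<noteq> 0 \<and> l \<bullet> v = 0 \<and> l \<bullet> w = 0"
proof -
  have "dim {v, w} \<le> card {v, w}"
    by (rule dim_le_card') simp
  also have "\<dots> < DIM(real^3)"
    by (auto simp: card_insert_if)
  finally obtain l where "l \<noteq> 0" "\<And>y. y \<in> span {v, w} \<Longrightarrow> orthogonal l y"
    using orthogonal_to_subspace_exists by blast
  then show ?thesis
    using span_base[of v "{v, w}"] span_base[of w "{v, w}"] by (auto simp: orthogonal_def)
qed

proposition (in web_function_inv) linearizable_if:
  assumes "\<And>p. p \<in> M \<Longrightarrow> I1_0 f a p = 0" "\<And>p. p \<in> M \<Longrightarrow> I2_0 f a p = 0"
  shows "linearizable M (web4 f a)"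
  unfolding linearizable_def
proof
  fix p assume p: "p \<in> M"
  have flat: "ddx (\<lambda>q. 2 * ddy P q - ddx Q q) z - P z * (2 * ddy P z - ddx Q z) = 0"
    "ddy (\<lambda>q. ddy P q - 2 * ddx Q q) z + Q z * (ddy P z - 2 * ddx Q z) = 0" if "z \<in> M" for z
    using flat1_eq[OF that] flat2_eq[OF that] assms[OF that] by (simp_all add: I1_0_def I2_0_def)
  obtain N r s t where N: "open N" "p \<in> N" "N \<subseteq> M" and rst: "smooth_on N r" "smooth_on N s" "smooth_on N t"
    and ex: "\<And>v. \<exists>\<psi>. \<psi> p = v \<and> smooth_on N \<psi> \<and>
      is_solution (system_x (\<lambda>z. P z / 3) (\<lambda>z. Q z / 3) r s) (system_y (\<lambda>z. P z / 3) (\<lambda>z. Q z / 3) s t) N \<psi>"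
    using flat_structure_solutions[OF open_M p smooth_P smooth_Q flat] by blast
  let ?sol = "is_solution (system_x (\<lambda>z. P z / 3) (\<lambda>z. Q z / 3) r s) (system_y (\<lambda>z. P z / 3) (\<lambda>z. Q z / 3) s t) N"
  obtain \<psi>0 where \<psi>0: "\<psi>0 p = (1, 0, 0)" "smooth_on N \<psi>0" "?sol \<psi>0"
    using ex by blast
  obtain \<psi>1 where \<psi>1: "\<psi>1 p = (0, 1, 0)" "smooth_on N \<psi>1" "?sol \<psi>1"
    using ex by blast
  obtain \<psi>2 where \<psi>2: "\<psi>2 p = (0, 0, 1)" "smooth_on N \<psi>2" "?sol \<psi>2"
    using ex by blast
  note dd1 = dd_eqI[OF is_solution_components(1)[OF \<psi>1(3) N(2)]]
    and dd2 = dd_eqI[OF is_solution_components(1)[OF \<psi>2(3) N(2)]]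
  let ?F = "\<lambda>q. vector [fst (\<psi>1 q), fst (\<psi>2 q), fst (\<psi>0 q)] :: real^3"
  let ?\<phi> = "\<lambda>q. span {?F q}"
  have "\<exists>U. p \<in> U \<and> U \<subseteq> N \<and> (\<forall>q\<in>U. fst (\<psi>0 q) \<noteq> 0) \<and> diffeo_onto_proj U ?\<phi> (?\<phi> ` U)"
    by (rule projective_chart[OF N(1,2)])
      (simp_all add: smooth_on_fst[OF N(1)] \<psi>0 \<psi>1 \<psi>2 dd1 dd2)
  then obtain U where U: "p \<in> U" "U \<subseteq> N" "\<And>q. q \<in> U \<Longrightarrow> fst (\<psi>0 q) \<noteq> 0" "diffeo_onto_proj U ?\<phi> (?\<phi> ` U)"
    by blast
  have UM: "U \<subseteq> M"
    using U(2) N(3) by (rule order_trans)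
  have "\<exists>L. proj_line L \<and> ?\<phi> ` leaf \<omega> U q \<subseteq> L" if \<omega>: "\<omega> \<in> set (web4 f a)" and q: "q \<in> U" for \<omega> q
  proof -
    obtain T where T: "smooth_on M T" and geod: "\<And>z. z \<in> M \<Longrightarrow> T z \<noteq> 0 \<and> geodesic_field P Q T z"
      and zero: "\<And>z v. z \<in> M \<Longrightarrow> \<omega> z v = 0 \<longleftrightarrow> (\<exists>c. v = c *\<^sub>R T z)"
      using web4_direction[OF \<omega>] by blast
    \<comment> \<open>Two linear conditions on three coefficients: the combination with weights
      \<open>l\<close> vanishes at \<open>q\<close> together with its derivative along
      \<open>T\<close>. The same \<open>l\<close> is the covector of the projective line.\<close>
    obtain l :: "real^3" where l: "l \<noteq> 0" "l \<bullet> ?F q = 0"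
      "l \<bullet> vector [jet_directional T \<psi>1 q, jet_directional T \<psi>2 q, jet_directional T \<psi>0 q] = 0"
      using exists_orthogonal_to_two by blast
    \<comment> \<open>The factor \<open>1 *\<^sub>R\<close> brings the sum of three terms into the
      shape of two nested applications of \<open>is_solution_add_scale\<close>.\<close>
    define \<psi> where "\<psi> = (\<lambda>z. 1 *\<^sub>R (l $ 1 *\<^sub>R \<psi>1 z + l $ 2 *\<^sub>R \<psi>2 z) + l $ 3 *\<^sub>R \<psi>0 z)"
    have \<psi>: "?sol \<psi>"
      unfolding \<psi>_def by (intro is_solution_add_scale \<psi>0 \<psi>1 \<psi>2)
    have fst_\<psi>: "fst (\<psi> z) = l \<bullet> ?F z" for z
      by (simp add: \<psi>_def inner_vec_def sum_3)
    have jet_\<psi>: "jet_directional T \<psi> q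
        = l \<bullet> vector [jet_directional T \<psi>1 q, jet_directional T \<psi>2 q, jet_directional T \<psi>0 q]"
      by (simp add: \<psi>_def inner_vec_def sum_3 jet_directional_def algebra_simps)
    let ?L = "{span {v} | v. v \<noteq> 0 \<and> l \<bullet> v = 0}"
    have "?\<phi> z \<in> ?L" if z: "z \<in> leaf \<omega> U q" for z
    proof -
      have zU: "z \<in> U"
        using z unfolding leaf_def by force
      have "fst (\<psi> z) = 0"
      proof (rule solution_vanishes_on_leaf[OF \<psi> N(1) smooth_on_subset[OF smooth_P N(3)]
            smooth_on_subset[OF smooth_Q N(3)] rst smooth_on_subset[OF T N(3)]])
        show "T z \<noteq> 0 \<and> geodesic_field P Q T z" if "z \<in> N" for z
          using geod N(3) that by blast
        show "\<exists>c. v = c *\<^sub>R T z" if "z \<in> N" "\<omega> z v = 0" for z v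
          using zero N(3) that by blast
        show "fst (\<psi> q) = 0" "jet_directional T \<psi> q = 0"
          by (simp_all only: fst_\<psi> jet_\<psi> l)
        show "z \<in> leaf \<omega> N q"
          using z leaf_mono[OF U(2)] by blast
      qed
      moreover have "?F z \<noteq> 0"
        using U(3)[OF zU] by (auto simp: vec_eq_iff forall_3)
      ultimately show ?thesis
        unfolding fst_\<psi> by blast
    qed
    then have "?\<phi> ` leaf \<omega> U q \<subseteq> ?L"
      by blast
    moreover have "proj_line ?L"
      unfolding proj_line_def using l(1) by blast
    ultimately show ?thesis
      by blast
  qed
  with U(1,4) UM show "\<exists>U \<phi> V. p \<in> U \<and> U \<subseteq> M \<and> diffeo_onto_proj U \<phi> V \<and>
      (\<forall>\<omega>\<in>set (web4 f a). \<forall>q\<in>U. \<exists>L. proj_line L \<and> \<phi> ` leaf \<omega> U q \<subseteq> L)"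
    by (intro exI[of _ U] exI[of _ ?\<phi>] exI[of _ "?\<phi> ` U"]) blast
qed

section \<open>Linearizable webs\<close>

text \<open>Lets the affine chart be taken where an arbitrary homogeneous coordinate
  \<open>k\<close> is nonzero, the other two indices serving as affine coordinates.\<close>

lemma other_indices_3: "\<exists>i j. i \<noteq> j \<and> i \<noteq> k \<and> j \<noteq> k \<and> (UNIV :: 3 set) = {i, j, k}" for k :: 3
proof -
  consider "k = 1" | "k = 2" | "k = 3"
    using exhaust_3[of k] by blast
  then show ?thesis
  proof cases
    case 1
    have "(UNIV :: 3 set) = {2, 3, 1}"
      unfolding UNIV_3 by blast
    with 1 show ?thesis
      by (intro exI[of _ 2] exI[of _ 3]) simp
  next
    case 2
    have "(UNIV :: 3 set) = {1, 3, 2}"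
      unfolding UNIV_3 by blast
    with 2 show ?thesis
      by (intro exI[of _ 1] exI[of _ 3]) simp
  next
    case 3
    have "(UNIV :: 3 set) = {1, 2, 3}"
      by (rule UNIV_3)
    with 3 show ?thesis
      by (intro exI[of _ 1] exI[of _ 2]) simp
  qed
qed

text \<open>The Jacobian of an affine chart does not vanish because the chart has a differentiable left inverse
  on the cone over its image.\<close>

lemma affine_coordinates:
  assumes diffeo: "diffeo_onto_proj U \<phi> V" and p: "p \<in> U"
  shows "\<exists>N R S. open N \<and> p \<in> N \<and> N \<subseteq> U \<and> smooth_on N R \<and> smooth_on N S \<and>
    (\<forall>q\<in>N. ddx R q * ddy S q - ddy R q * ddx S q \<noteq> 0) \<and>
    (\<forall>L. proj_line L \<longrightarrow> (\<exists>c0 c1 c2. (c0 \<noteq> 0 \<or> c1 \<noteq> 0 \<or> c2 \<noteq> 0) \<and>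
      (\<forall>q\<in>N. \<phi> q \<in> L \<longrightarrow> c0 + c1 * R q + c2 * S q = 0)))"
proof -
  have bij: "bij_betw \<phi> U V" and into: "smooth_into_proj U \<phi>"
    and from_proj: "smooth_on (cone_over V) (\<lambda>v. inv_into U \<phi> (span {v}))"
    using diffeo unfolding diffeo_onto_proj_def smooth_from_proj_def by blast+
  obtain N' F where N': "open N'" "p \<in> N'" "N' \<subseteq> U" and F: "smooth_on N' F"
    "\<And>q. q \<in> N' \<Longrightarrow> F q \<noteq> 0 \<and> \<phi> q = span {F q}"
    using bspec[OF into[unfolded smooth_into_proj_def] p] by (elim exE conjE) (erule that, auto)
  obtain k where k: "F p $ k \<noteq> 0"
    using F(2)[OF N'(2)] by (auto simp: vec_eq_iff)
  obtain i j where ij: "i \<noteq> j" "i \<noteq> k" "j \<noteq> k" "(UNIV :: 3 set) = {i, j, k}"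
    using other_indices_3 by blast
  have nth: "smooth_on N' (\<lambda>q. F q $ m)" for m
    by (rule smooth_on_bounded_linear[OF bounded_linear_vec_nth N'(1) F(1)])
  define N where "N = N' \<inter> (\<lambda>q. F q $ k) -` (- {0})"
  have N: "open N" "p \<in> N" "N \<subseteq> N'" and nz: "\<And>q. q \<in> N \<Longrightarrow> F q $ k \<noteq> 0"
    using continuous_open_preimage[OF smooth_on_continuous_on[OF nth] N'(1), of "- {0}" k] N'(2) k
    by (auto simp: N_def)
  \<comment> \<open>Rescales the lift so that its \<open>k\<close>-th coordinate is constantly 1;
    the other two coordinates become \<open>R\<close> and \<open>S\<close>.\<close>
  define c where "c q = 1 / F q $ k" for q
  define G where "G q = c q *\<^sub>R F q" for q
  have smooth_c: "smooth_on N c"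
    unfolding c_def by (intro smooth_on_divide smooth_on_const N(1) smooth_on_subset[OF nth N(3)] nz)
  have G: "smooth_on N G"
    unfolding G_def by (intro smooth_on_scaleR smooth_c N(1) smooth_on_subset[OF F(1) N(3)])
  have smooth_nth: "smooth_on N (\<lambda>q. G q $ m)" for m
    by (rule smooth_on_bounded_linear[OF bounded_linear_vec_nth N(1) G])
  have Gk: "G q $ k = 1" if "q \<in> N" for q
    using nz[OF that] by (simp add: G_def c_def)
  let ?R = "\<lambda>q. G q $ i" and ?S = "\<lambda>q. G q $ j"
  have inv_G: "G q \<in> cone_over V" "inv_into U \<phi> (span {G q}) = q" if q: "q \<in> N" for q
  proof -
    have qN': "q \<in> N'"
      using q N(3) by blast
    have qU: "q \<in> U"
      using qN' N'(3) by blast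
    have G0: "G q \<noteq> 0"
      using Gk[OF q] by auto
    have "c q \<noteq> 0"
      using nz[OF q] by (simp add: c_def)
    then have \<phi>: "span {G q} = \<phi> q"
      using span_singleton_eq_iff[OF G0, of "F q"] F(2)[OF qN'] unfolding G_def by blast
    have "\<phi> q \<in> V"
      using bij qU by (auto simp: bij_betw_def)
    then show "G q \<in> cone_over V"
      unfolding cone_over_def using G0 \<phi> by simp
    show "inv_into U \<phi> (span {G q}) = q"
      unfolding \<phi> by (rule inv_into_f_f[OF bij_betw_imp_inj_on[OF bij] qU])
  qed
  \<comment> \<open>If \<open>R\<close> and \<open>S\<close> are stationary in the direction
    \<open>h\<close>, then so is the lift \<open>G\<close>, whose third coordinate is constant.
    Composing with the left inverse recovers the identity, which forces
    \<open>h = 0\<close>.\<close>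
  have inj: "h = 0"
    if q: "q \<in> N" and R: "fst h * ddx ?R q + snd h * ddy ?R q = 0" and S: "fst h * ddx ?S q + snd h * ddy ?S q = 0"
    for q h
  proof -
    let ?G' = "frechet_derivative G (at q)"
    have G': "(G has_derivative ?G') (at q)"
      by (rule smooth_on_has_derivative[OF G q])
    have nth': "((\<lambda>q. G q $ m) has_derivative (\<lambda>h. ?G' h $ m)) (at q)" for m
      by (rule bounded_linear.has_derivative[OF bounded_linear_vec_nth G'])
    have "?G' h $ m = fst h * ddx (\<lambda>q. G q $ m) q + snd h * ddy (\<lambda>q. G q $ m) q" for m
      using fun_cong[OF has_derivative_unique[OF nth' has_derivative_dd[OF smooth_on_differentiable[OF smooth_nth q]]]]
      by simp
    then have "?G' h $ i = 0" "?G' h $ j = 0"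
      using R S by simp_all
    moreover have "?G' h $ k = 0"
    proof -
      have "((\<lambda>q. 1) has_derivative (\<lambda>h. ?G' h $ k)) (at q)"
        by (rule has_derivative_transform_within_open[OF nth' N(1) q Gk])
      from fun_cong[OF has_derivative_unique[OF this has_derivative_const]] show ?thesis
        by simp
    qed
    ultimately have "?G' h $ m = 0" if "m \<in> {i, j, k}" for m
      using that by blast
    then have "?G' h $ m = 0" for m
      using ij(4) UNIV_I[of m] by simp
    then have G'h: "?G' h = 0"
      by (simp add: vec_eq_iff)
    let ?\<psi> = "\<lambda>v. inv_into U \<phi> (span {v})"
    let ?\<psi>' = "frechet_derivative ?\<psi> (at (G q))"
    have \<psi>': "(?\<psi> has_derivative ?\<psi>') (at (G q))"
      by (rule smooth_on_has_derivative[OF from_proj inv_G(1)[OF q]])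
    have "((\<lambda>q. ?\<psi> (G q)) has_derivative (\<lambda>h. ?\<psi>' (?G' h))) (at q)"
      using diff_chain_at[OF G' \<psi>'] by (simp add: o_def)
    then have "((\<lambda>q. q) has_derivative (\<lambda>h. ?\<psi>' (?G' h))) (at q)"
      by (rule has_derivative_transform_within_open[OF _ N(1) q inv_G(2)])
    from fun_cong[OF has_derivative_unique[OF this has_derivative_ident], of h] show "h = 0"
      unfolding G'h using linear_0[OF has_derivative_linear[OF \<psi>']] by simp
  qed
  \<comment> \<open>If the determinant were zero, the gradients of \<open>R\<close> and
    \<open>S\<close>, turned by a right angle, would lie in the trivial kernel. All first partials
    would then vanish, and \<open>(1, 0)\<close> would lie in that kernel too.\<close>
  have J: "ddx ?R q * ddy ?S q - ddy ?R q * ddx ?S q \<noteq> 0" if q: "q \<in> N" for q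
  proof
    assume J0: "ddx ?R q * ddy ?S q - ddy ?R q * ddx ?S q = 0"
    have "(ddy ?R q, - ddx ?R q) = 0"
      by (rule inj[OF q]) (use J0 in \<open>simp_all add: algebra_simps\<close>)
    moreover have "(ddy ?S q, - ddx ?S q) = 0"
      by (rule inj[OF q]) (use J0 in \<open>simp_all add: algebra_simps\<close>)
    ultimately have "(1, 0) = (0 :: real \<times> real)"
      by (intro inj[OF q]) (simp_all add: zero_prod_def)
    then show False
      by (simp add: zero_prod_def)
  qed
  have line: "\<exists>c0 c1 c2. (c0 \<noteq> 0 \<or> c1 \<noteq> 0 \<or> c2 \<noteq> 0) \<and> (\<forall>q\<in>N. \<phi> q \<in> L \<longrightarrow> c0 + c1 * ?R q + c2 * ?S q = 0)"
    if L: "proj_line L" for L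
  proof -
    obtain l where l: "l \<noteq> 0" "L = {span {v} | v. v \<noteq> 0 \<and> l \<bullet> v = 0}"
      using L unfolding proj_line_def by blast
    have sum: "l \<bullet> v = l $ k * v $ k + l $ i * v $ i + l $ j * v $ j" for v
      unfolding inner_vec_def ij(4) using ij(1-3) by (simp add: algebra_simps)
    have "l $ k \<noteq> 0 \<or> l $ i \<noteq> 0 \<or> l $ j \<noteq> 0"
      using sum[of l] l(1) by auto
    moreover have "l $ k + l $ i * ?R q + l $ j * ?S q = 0" if q: "q \<in> N" "\<phi> q \<in> L" for q
    proof -
      have Fq: "F q \<noteq> 0" "\<phi> q = span {F q}"
        using F(2)[of q] q(1) N(3) by blast+
      obtain v where v: "v \<noteq> 0" "l \<bullet> v = 0" "span {F q} = span {v}"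
        using q(2) l(2) Fq(2) by blast
      then obtain d where "F q = d *\<^sub>R v"
        using span_singleton_eq_iff[OF Fq(1) v(1)] by blast
      then have "l \<bullet> G q = 0"
        by (simp add: G_def v(2))
      then show ?thesis
        using sum[of "G q"] Gk[OF q(1)] by simp
    qed
    ultimately show ?thesis
      by blast
  qed
  have "N \<subseteq> U"
    using N(3) N'(3) by (rule order_trans)
  with N(1,2) smooth_nth J line show ?thesis
    by (intro exI[of _ N] exI[of _ ?R] exI[of _ ?S]) blast
qed

section \<open>Straight leaves in affine coordinates\<close>

lemma directional_vanishes_along_curve:
  assumes h: "\<And>q. q \<in> N \<Longrightarrow> h differentiable (at q)"
    and \<gamma>: "\<And>t. t \<in> {-r<..<r} \<Longrightarrow> \<gamma> t \<in> N"
      "\<And>t. t \<in> {-r<..<r} \<Longrightarrow> (\<gamma> has_vector_derivative T (\<gamma> t)) (at t)"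
    and zero: "\<And>t. t \<in> {-r<..<r} \<Longrightarrow> h (\<gamma> t) = 0" and t: "t \<in> {-r<..<r}"
  shows "directional T h (\<gamma> t) = 0"
proof -
  have "((\<lambda>t. h (\<gamma> t)) has_vector_derivative directional T h (\<gamma> t)) (at t)"
    using vector_derivative_diff_chain_within[OF \<gamma>(2)[OF t]
        has_derivative_at_withinI[OF has_derivative_dd[OF h[OF \<gamma>(1)[OF t]]]]]
    by (simp add: o_def directional_def)
  then have "((\<lambda>t. 0) has_vector_derivative directional T h (\<gamma> t)) (at t)"
    by (rule has_vector_derivative_transform_within_open[OF _ open_greaterThanLessThan t zero])
  from vector_derivative_unique_at[OF this has_vector_derivative_const] show ?thesis .
qed

lemma directional_lincomb:
  assumes "u differentiable (at q)" "v differentiable (at q)"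
  shows "directional T (\<lambda>q. c0 + c1 * u q + c2 * v q) q = c1 * directional T u q + c2 * directional T v q"
  using assms by (simp add: directional_def dd_simps algebra_simps)

text \<open>Velocity and acceleration of the integral curves, seen in the \<open>(R, S)\<close>
  plane, are parallel: zero curvature in a form insensitive to the parametrization.\<close>

definition straight_field ::
  "(real \<times> real \<Rightarrow> real) \<Rightarrow> (real \<times> real \<Rightarrow> real) \<Rightarrow> (real \<times> real \<Rightarrow> real \<times> real) \<Rightarrow> real \<times> real \<Rightarrow> bool"
  where "straight_field R S T q \<longleftrightarrow> directional T R q * directional T (directional T S) q
    = directional T S q * directional T (directional T R) q"

text \<open>Differentiating the equation of the line twice along an integral curve shows that
  velocity and acceleration are both orthogonal to \<open>(c1, c2)\<close>, hence parallel to each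
  other.\<close>

lemma straight_field_if_leaf_in_line:
  assumes N: "open N" "N \<subseteq> U" "q \<in> N" and RS: "smooth_on N R" "smooth_on N S" and T: "smooth_on N T"
    and \<omega>: "\<And>p c. p \<in> N \<Longrightarrow> \<omega> p (c *\<^sub>R T p) = 0"
    and c: "c0 \<noteq> 0 \<or> c1 \<noteq> 0 \<or> c2 \<noteq> 0"
    and line: "\<And>z. z \<in> leaf \<omega> U q \<Longrightarrow> z \<in> N \<Longrightarrow> c0 + c1 * R z + c2 * S z = 0"
  shows "straight_field R S T q"
proof -
  obtain r \<gamma> where r: "r > 0" and \<gamma>: "\<gamma> 0 = q" "\<And>t. t \<in> {-r<..<r} \<Longrightarrow> \<gamma> t \<in> N"
    "\<And>t. t \<in> {-r<..<r} \<Longrightarrow> (\<gamma> has_vector_derivative T (\<gamma> t)) (at t)"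
    using smooth_integral_curve_exists[OF N(1,3) T] by blast
  have leaf: "\<gamma> t \<in> leaf \<omega> U q" if "t \<in> {-r<..<r}" for t
    using integral_curve_in_leaf[of N \<omega> T \<gamma> q r t, OF \<omega> smooth_on_continuous_on[OF T] \<gamma> that] leaf_mono[OF N(2)] by blast
  have 0: "0 \<in> {-r<..<r}"
    using r by simp
  note d = smooth_on_differentiable[OF RS(1)] smooth_on_differentiable[OF RS(2)]
  note d' = smooth_on_differentiable[OF smooth_on_directional[OF N(1) T RS(1)]]
    smooth_on_differentiable[OF smooth_on_directional[OF N(1) T RS(2)]]
  have z0: "c0 + c1 * R (\<gamma> t) + c2 * S (\<gamma> t) = 0" if "t \<in> {-r<..<r}" for t
    by (rule line[OF leaf[OF that] \<gamma>(2)[OF that]])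
  have z1: "0 + c1 * directional T R (\<gamma> t) + c2 * directional T S (\<gamma> t) = 0" if t: "t \<in> {-r<..<r}" for t
  proof -
    have "directional T (\<lambda>q. c0 + c1 * R q + c2 * S q) (\<gamma> t) = 0"
      by (rule directional_vanishes_along_curve[of N "\<lambda>q. c0 + c1 * R q + c2 * S q" r \<gamma> T t, OF _ \<gamma>(2,3) z0 t]) (simp add: dd_simps d)
    then show ?thesis
      using directional_lincomb[OF d[OF \<gamma>(2)[OF t]]] by simp
  qed
  have z2: "c1 * directional T (directional T R) q + c2 * directional T (directional T S) q = 0"
  proof -
    have "directional T (\<lambda>q. 0 + c1 * directional T R q + c2 * directional T S q) (\<gamma> 0) = 0"
      by (rule directional_vanishes_along_curve[of N
            "\<lambda>q. 0 + c1 * directional T R q + c2 * directional T S q" r \<gamma> T 0, OF _ \<gamma>(2,3) z1 0]) (simp add: dd_simps d')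
    then show ?thesis
      unfolding \<gamma>(1) directional_lincomb[OF d'[OF N(3)]] .
  qed
  have z0': "c0 + c1 * R q + c2 * S q = 0" and z1': "c1 * directional T R q + c2 * directional T S q = 0"
    using z0[OF 0] z1[OF 0] \<gamma>(1) by simp_all
  \<comment> \<open>Vanishing of both \<open>c1\<close> and \<open>c2\<close> would mean the line at
    infinity, which does not meet the affine chart.\<close>
  have c12: "c1 \<noteq> 0 \<or> c2 \<noteq> 0"
    using z0' c by auto
  let ?D = "directional T R q * directional T (directional T S) q - directional T S q * directional T (directional T R) q"
  have "c1 * ?D = (c1 * directional T R q + c2 * directional T S q) * directional T (directional T S) q
      - directional T S q * (c1 * directional T (directional T R) q + c2 * directional T (directional T S) q)"
    "c2 * ?D = directional T R q * (c1 * directional T (directional T R) q + c2 * directional T (directional T S) q)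
      - (c1 * directional T R q + c2 * directional T S q) * directional T (directional T R) q"
    by (simp_all add: algebra_simps)
  then have "c1 * ?D = 0" "c2 * ?D = 0"
    unfolding z1' z2 by simp_all
  with c12 show ?thesis
    unfolding straight_field_def by auto
qed

text \<open>Separates the second partials of \<open>u\<close> from the derivatives of the field; the
  geodesic condition involves only the latter.\<close>

lemma second_directional:
  assumes N: "open N" "q \<in> N" and u: "smooth_on N u" and T: "smooth_on N T"
  shows "directional T (directional T u) q
    = (fst (T q))^2 * ddx (ddx u) q + 2 * fst (T q) * snd (T q) * ddy (ddx u) q + (snd (T q))^2 * ddy (ddy u) q
      + directional T (\<lambda>q. fst (T q)) q * ddx u q + directional T (\<lambda>q. snd (T q)) q * ddy u q"
proof -
  have d: "(\<lambda>q. fst (T q)) differentiable (at q)" "(\<lambda>q. snd (T q)) differentiable (at q)"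
    "ddx u differentiable (at q)" "ddy u differentiable (at q)"
    by (rule smooth_on_differentiable[OF _ N(2)];
        intro smooth_on_fst smooth_on_snd smooth_on_ddx smooth_on_ddy N(1) T u)+
  have "directional T (directional T u) q
      = directional T (\<lambda>q. fst (T q) * ddx u q + snd (T q) * ddy u q) q"
    by (simp add: directional_def[abs_def])
  also have "\<dots> = fst (T q) * (ddx (\<lambda>q. fst (T q)) q * ddx u q + fst (T q) * ddx (ddx u) q
        + (ddx (\<lambda>q. snd (T q)) q * ddy u q + snd (T q) * ddx (ddy u) q))
      + snd (T q) * (ddy (\<lambda>q. fst (T q)) q * ddx u q + fst (T q) * ddy (ddx u) q
        + (ddy (\<lambda>q. snd (T q)) q * ddy u q + snd (T q) * ddy (ddy u) q))"
    unfolding directional_def[of T "\<lambda>q. fst (T q) * ddx u q + snd (T q) * ddy u q"] by (simp add: dd_simps d)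
  finally show ?thesis
    unfolding ddx_ddy_commute[OF N(1) u N(2)] by (simp add: directional_def algebra_simps power2_eq_square)
qed

lemma jacobian_independent:
  fixes c d :: real
  assumes "rx * sy - ry * sx \<noteq> 0" "c * rx + d * ry = 0" "c * sx + d * sy = 0"
  shows "c = 0" "d = 0"
proof -
  have "c * (rx * sy - ry * sx) = sy * (c * rx + d * ry) - ry * (c * sx + d * sy)"
    "d * (rx * sy - ry * sx) = rx * (c * sx + d * sy) - sx * (c * rx + d * ry)"
    by (simp_all add: algebra_simps)
  then have "c * (rx * sy - ry * sx) = 0" "d * (rx * sy - ry * sx) = 0"
    unfolding assms(2,3) by simp_all
  with assms(1) show "c = 0" "d = 0"
    by simp_all
qed

text \<open>The flat connection for which \<open>R\<close> and \<open>S\<close> are affine functions; the conclusions are the vanishing of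
  its curvature.\<close>

lemma affine_connection_compatible:
  assumes N: "open N" and RS: "smooth_on N R" "smooth_on N S"
    and J: "\<And>q. q \<in> N \<Longrightarrow> ddx R q * ddy S q - ddy R q * ddx S q \<noteq> 0"
    and g: "smooth_on N g1" "smooth_on N g2" "smooth_on N g3" "smooth_on N g4"
    and eq: "\<And>q u. q \<in> N \<Longrightarrow> u \<in> {R, S} \<Longrightarrow> ddx (ddx u) q = g1 q * ddx u q"
      "\<And>q u. q \<in> N \<Longrightarrow> u \<in> {R, S} \<Longrightarrow> ddy (ddx u) q = g2 q * ddx u q + g3 q * ddy u q"
      "\<And>q u. q \<in> N \<Longrightarrow> u \<in> {R, S} \<Longrightarrow> ddy (ddy u) q = g4 q * ddy u q"
    and q: "q \<in> N"
  shows "ddy g1 q = ddx g2 q + g2 q * g3 q" "ddx g3 q = g1 q * g3 q - g3 q * g3 q"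
    "ddx g4 q = ddy g3 q + g2 q * g3 q" "ddy g2 q = g4 q * g2 q - g2 q * g2 q"
proof -
  note gd = g[THEN smooth_on_differentiable[OF _ q]]
  \<comment> \<open>Each mixed third derivative of \<open>u\<close> is computed in two ways. The
    resulting relation between \<open>ddx u\<close> and \<open>ddy u\<close> has the same
    coefficients for \<open>R\<close> and \<open>S\<close>, so the nonzero Jacobian forces them to
    vanish.\<close>
  have rel: "(ddy g1 q - ddx g2 q - g2 q * g3 q) * ddx u q + (g1 q * g3 q - ddx g3 q - g3 q * g3 q) * ddy u q = 0"
    "(g4 q * g2 q - ddy g2 q - g2 q * g2 q) * ddx u q + (ddx g4 q - g2 q * g3 q - ddy g3 q) * ddy u q = 0"
    if u: "u \<in> {R, S}" for u
  proof -
    have su: "smooth_on N u"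
      using u RS by auto
    note d = smooth_on_differentiable[OF smooth_on_ddx[OF su] q] smooth_on_differentiable[OF smooth_on_ddy[OF su] q]
    note d2 = smooth_on_differentiable[OF smooth_on_ddx[OF smooth_on_ddx[OF su]] q]
      smooth_on_differentiable[OF smooth_on_ddy[OF smooth_on_ddx[OF su]] q]
      smooth_on_differentiable[OF smooth_on_ddx[OF smooth_on_ddy[OF su]] q]
      smooth_on_differentiable[OF smooth_on_ddy[OF smooth_on_ddy[OF su]] q]
    have yx: "ddx (ddy u) z = g2 z * ddx u z + g3 z * ddy u z" if "z \<in> N" for z
      using ddx_ddy_commute[OF N su that] eq(2)[OF that u] by simp
    have "ddy (ddx (ddx u)) q = ddx (ddy (ddx u)) q"
      by (rule ddx_ddy_commute[OF N smooth_on_ddx[OF su] q, symmetric])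
    moreover have "ddy (ddx (ddx u)) q = ddy (\<lambda>z. g1 z * ddx u z) q"
      by (rule dd_cong(2)[OF N q eq(1)[OF _ u] d2(1)])
    moreover have "ddx (ddy (ddx u)) q = ddx (\<lambda>z. g2 z * ddx u z + g3 z * ddy u z) q"
      by (rule dd_cong(1)[OF N q eq(2)[OF _ u] d2(2)])
    ultimately have "ddy g1 q * ddx u q + g1 q * ddy (ddx u) q
        = ddx g2 q * ddx u q + g2 q * ddx (ddx u) q + (ddx g3 q * ddy u q + g3 q * ddx (ddy u) q)"
      by (simp add: dd_simps d gd)
    then show "(ddy g1 q - ddx g2 q - g2 q * g3 q) * ddx u q + (g1 q * g3 q - ddx g3 q - g3 q * g3 q) * ddy u q = 0"
      unfolding yx[OF q] eq(1)[OF q u] eq(2)[OF q u] by (simp add: algebra_simps)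
    have "ddx (ddy (ddy u)) q = ddy (ddx (ddy u)) q"
      by (rule ddx_ddy_commute[OF N smooth_on_ddy[OF su] q])
    moreover have "ddx (ddy (ddy u)) q = ddx (\<lambda>z. g4 z * ddy u z) q"
      by (rule dd_cong(1)[OF N q eq(3)[OF _ u] d2(4)])
    moreover have "ddy (ddx (ddy u)) q = ddy (\<lambda>z. g2 z * ddx u z + g3 z * ddy u z) q"
      by (rule dd_cong(2)[OF N q yx d2(3)])
    ultimately have "ddx g4 q * ddy u q + g4 q * ddx (ddy u) q
        = ddy g2 q * ddx u q + g2 q * ddy (ddx u) q + (ddy g3 q * ddy u q + g3 q * ddy (ddy u) q)"
      by (simp add: dd_simps d gd)
    then show "(g4 q * g2 q - ddy g2 q - g2 q * g2 q) * ddx u q + (ddx g4 q - g2 q * g3 q - ddy g3 q) * ddy u q = 0"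
      unfolding yx[OF q] eq(2)[OF q u] eq(3)[OF q u] by (simp add: algebra_simps)
  qed
  from jacobian_independent[OF J[OF q] rel(1)[of R] rel(1)[of S]]
    jacobian_independent[OF J[OF q] rel(2)[of R] rel(2)[of S]]
  show "ddy g1 q = ddx g2 q + g2 q * g3 q" "ddx g3 q = g1 q * g3 q - g3 q * g3 q"
    "ddx g4 q = ddy g3 q + g2 q * g3 q" "ddy g2 q = g4 q * g2 q - g2 q * g2 q"
    by simp_all
qed

text \<open>By compatibility \<open>2 * ddy P - ddx Q = 3 * (g2 * g3 - ddy g3)\<close> and
  \<open>ddy P - 2 * ddx Q = 3 * (g2 * g3 - ddx g2)\<close>. Differentiating once more and
  exchanging partials of \<open>g3\<close> and \<open>g2\<close> gives both identities.\<close>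

lemma affine_connection_flat:
  assumes N: "open N" and g: "smooth_on N g1" "smooth_on N g2" "smooth_on N g3" "smooth_on N g4"
    and compat: "\<And>q. q \<in> N \<Longrightarrow> ddy g1 q = ddx g2 q + g2 q * g3 q"
      "\<And>q. q \<in> N \<Longrightarrow> ddx g3 q = g1 q * g3 q - g3 q * g3 q"
      "\<And>q. q \<in> N \<Longrightarrow> ddx g4 q = ddy g3 q + g2 q * g3 q"
      "\<And>q. q \<in> N \<Longrightarrow> ddy g2 q = g4 q * g2 q - g2 q * g2 q"
    and PQ: "\<And>q. q \<in> N \<Longrightarrow> P q = g1 q - 2 * g3 q" "\<And>q. q \<in> N \<Longrightarrow> Q q = 2 * g2 q - g4 q"
    and smooth: "smooth_on N P" "smooth_on N Q" and q: "q \<in> N"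
  shows "ddx (\<lambda>q. 2 * ddy P q - ddx Q q) q - P q * (2 * ddy P q - ddx Q q) = 0"
    "ddy (\<lambda>q. ddy P q - 2 * ddx Q q) q + Q q * (ddy P q - 2 * ddx Q q) = 0"
proof -
  note gd = smooth_on_differentiable[OF g(1)] smooth_on_differentiable[OF g(2)]
    smooth_on_differentiable[OF g(3)] smooth_on_differentiable[OF g(4)]
    smooth_on_differentiable[OF smooth_on_ddx[OF g(2)]] smooth_on_differentiable[OF smooth_on_ddy[OF g(3)]]
  have Py: "ddy P z = ddx g2 z + g2 z * g3 z - 2 * ddy g3 z" if z: "z \<in> N" for z
  proof -
    have "ddy P z = ddy (\<lambda>z. g1 z - 2 * g3 z) z"
      by (rule dd_cong(2)[OF N z PQ(1) smooth_on_differentiable[OF smooth(1) z]])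
    then show ?thesis
      by (simp add: dd_simps gd z compat)
  qed
  have Qx: "ddx Q z = 2 * ddx g2 z - ddy g3 z - g2 z * g3 z" if z: "z \<in> N" for z
  proof -
    have "ddx Q z = ddx (\<lambda>z. 2 * g2 z - g4 z) z"
      by (rule dd_cong(1)[OF N z PQ(2) smooth_on_differentiable[OF smooth(2) z]])
    then show ?thesis
      by (simp add: dd_simps gd z compat)
  qed
  have d: "(\<lambda>q. 2 * ddy P q - ddx Q q) differentiable (at q)" "(\<lambda>q. ddy P q - 2 * ddx Q q) differentiable (at q)"
    by (rule smooth_on_differentiable[OF _ q];
        intro smooth_on_diff smooth_on_mult smooth_on_const smooth_on_ddx smooth_on_ddy N smooth)+
  have Z: "2 * ddy P z - ddx Q z = 3 * (g2 z * g3 z - ddy g3 z)" if "z \<in> N" for z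
    unfolding Py[OF that] Qx[OF that] by (simp add: algebra_simps)
  have W: "ddy P z - 2 * ddx Q z = 3 * (g2 z * g3 z - ddx g2 z)" if "z \<in> N" for z
    unfolding Py[OF that] Qx[OF that] by (simp add: algebra_simps)
  have "ddx (ddy g3) q = ddy (ddx g3) q"
    by (rule ddx_ddy_commute[OF N g(3) q])
  also have "\<dots> = ddy (\<lambda>z. g1 z * g3 z - g3 z * g3 z) q"
    by (rule dd_cong(2)[OF N q compat(2) smooth_on_differentiable[OF smooth_on_ddx[OF g(3)] q]])
  also have "\<dots> = (ddx g2 q + g2 q * g3 q) * g3 q + g1 q * ddy g3 q - 2 * g3 q * ddy g3 q"
    by (simp add: dd_simps gd q compat)
  finally have xy3: "ddx (ddy g3) q = \<dots>" .
  have "ddx (\<lambda>q. 2 * ddy P q - ddx Q q) q = ddx (\<lambda>z. 3 * (g2 z * g3 z - ddy g3 z)) q"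
    by (rule dd_cong(1)[OF N q Z d(1)])
  also have "\<dots> = 3 * (ddx g2 q * g3 q + g2 q * ddx g3 q - ddx (ddy g3) q)"
    by (simp add: dd_simps gd q)
  finally show "ddx (\<lambda>q. 2 * ddy P q - ddx Q q) q - P q * (2 * ddy P q - ddx Q q) = 0"
    unfolding Z[OF q] xy3 compat(2)[OF q] PQ(1)[OF q] by (simp add: algebra_simps)
  have "ddy (ddx g2) q = ddx (ddy g2) q"
    by (rule ddx_ddy_commute[OF N g(2) q, symmetric])
  also have "\<dots> = ddx (\<lambda>z. g4 z * g2 z - g2 z * g2 z) q"
    by (rule dd_cong(1)[OF N q compat(4) smooth_on_differentiable[OF smooth_on_ddy[OF g(2)] q]])
  also have "\<dots> = (ddy g3 q + g2 q * g3 q) * g2 q + g4 q * ddx g2 q - 2 * g2 q * ddx g2 q"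
    by (simp add: dd_simps gd q compat)
  finally have yx2: "ddy (ddx g2) q = \<dots>" .
  have "ddy (\<lambda>q. ddy P q - 2 * ddx Q q) q = ddy (\<lambda>z. 3 * (g2 z * g3 z - ddx g2 z)) q"
    by (rule dd_cong(2)[OF N q W d(2)])
  also have "\<dots> = 3 * (ddy g2 q * g3 q + g2 q * ddy g3 q - ddy (ddx g2) q)"
    by (simp add: dd_simps gd q)
  finally show "ddy (\<lambda>q. ddy P q - 2 * ddx Q q) q + Q q * (ddy P q - 2 * ddx Q q) = 0"
    unfolding W[OF q] yx2 compat(4)[OF q] PQ(2)[OF q] by (simp add: algebra_simps)
qed

text \<open>The four families of straight lines determine \<open>P\<close> and \<open>Q\<close>: two of them make the vertical and
  horizontal lines straight, the other two give two independent linear equations.\<close>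

lemma (in web_function_inv) straight_web_flat:
  assumes N: "open N" "N \<subseteq> M" and RS: "smooth_on N R" "smooth_on N S"
    and J: "\<And>q. q \<in> N \<Longrightarrow> ddx R q * ddy S q - ddy R q * ddx S q \<noteq> 0"
    and straight: "\<And>q. q \<in> N \<Longrightarrow> straight_field R S (\<lambda>q. (0, 1)) q" "\<And>q. q \<in> N \<Longrightarrow> straight_field R S (\<lambda>q. (1, 0)) q"
      "\<And>q. q \<in> N \<Longrightarrow> straight_field R S (\<lambda>q. (Y q, - X q)) q"
      "\<And>q. q \<in> N \<Longrightarrow> straight_field R S (\<lambda>q. (Y q, - (a q * X q))) q"
    and q: "q \<in> N"
  shows "I1_0 f a q = 0" "I2_0 f a q = 0"
proof -
  define J' where "J' q = ddx R q * ddy S q - ddy R q * ddx S q" for q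
  have J': "J' q \<noteq> 0" if "q \<in> N" for q
    using J[OF that] by (simp add: J'_def)
  \<comment> \<open>Cramer's rule: the second partials of \<open>R\<close> and \<open>S\<close> are
    expressed through their first partials by common coefficients.\<close>
  define g1 where "g1 q = (ddx (ddx R) q * ddy S q - ddy R q * ddx (ddx S) q) / J' q" for q
  define g2 where "g2 q = (ddy (ddx R) q * ddy S q - ddy R q * ddy (ddx S) q) / J' q" for q
  define g3 where "g3 q = (ddx R q * ddy (ddx S) q - ddy (ddx R) q * ddx S q) / J' q" for q
  define g4 where "g4 q = (ddx R q * ddy (ddy S) q - ddy (ddy R) q * ddx S q) / J' q" for q
  have smooth_J': "smooth_on N J'"
    unfolding J'_def by (intro smooth_on_diff smooth_on_mult smooth_on_ddx smooth_on_ddy N(1) RS)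
  have g: "smooth_on N g1" "smooth_on N g2" "smooth_on N g3" "smooth_on N g4"
    unfolding g1_def g2_def g3_def g4_def
    by (intro smooth_on_divide smooth_on_diff smooth_on_mult smooth_on_ddx smooth_on_ddy N(1) RS smooth_J' J';
        assumption)+
  have dir: "directional (\<lambda>q. (1, 0)) u = ddx u" "directional (\<lambda>q. (0, 1)) u = ddy u" for u
    by (simp_all add: directional_def fun_eq_iff)
  \<comment> \<open>Straight horizontal and vertical lines: \<open>sx\<close> removes the
    \<open>ddy u\<close> component of \<open>ddx (ddx u)\<close>, and \<open>sy\<close> the
    \<open>ddx u\<close> component of \<open>ddy (ddy u)\<close>.\<close>
  have sx: "ddx R q * ddx (ddx S) q = ddx S q * ddx (ddx R) q"
    and sy: "ddy R q * ddy (ddy S) q = ddy S q * ddy (ddy R) q" if "q \<in> N" for q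
    using straight(1,2)[OF that] unfolding straight_field_def dir by simp_all
  have eq: "ddx (ddx u) q = g1 q * ddx u q" "ddy (ddx u) q = g2 q * ddx u q + g3 q * ddy u q"
    "ddy (ddy u) q = g4 q * ddy u q" if q: "q \<in> N" and u: "u \<in> {R, S}" for q u
  proof -
    have num: "J' q * ddx (ddx u) q = (ddx (ddx R) q * ddy S q - ddy R q * ddx (ddx S) q) * ddx u q"
      "J' q * ddy (ddx u) q = (ddy (ddx R) q * ddy S q - ddy R q * ddy (ddx S) q) * ddx u q
        + (ddx R q * ddy (ddx S) q - ddy (ddx R) q * ddx S q) * ddy u q"
      "J' q * ddy (ddy u) q = (ddx R q * ddy (ddy S) q - ddy (ddy R) q * ddx S q) * ddy u q"
      using u sx[OF q] sy[OF q] unfolding J'_def by (auto simp: algebra_simps)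
    have quot: "x = c / J' q * v + d / J' q * w" if "J' q * x = c * v + d * w" for x c d v w
    proof -
      have "x = (c * v + d * w) / J' q"
        using that J'[OF q] by (simp add: eq_divide_eq mult.commute)
      then show ?thesis
        by (simp add: add_divide_distrib)
    qed
    show "ddy (ddx u) q = g2 q * ddx u q + g3 q * ddy u q"
      unfolding g2_def g3_def by (rule quot[OF num(2)])
    show "ddx (ddx u) q = g1 q * ddx u q" "ddy (ddy u) q = g4 q * ddy u q"
      unfolding g1_def g4_def using num(1,3) J'[OF q] by (simp_all add: field_simps)
  qed
  \<comment> \<open>For a field that is both straight and geodesic, the two expressions for its
    acceleration must agree, so the discrepancies in \<open>P\<close> and \<open>Q\<close> satisfy a
    linear equation with the field as coefficients.\<close>
  have slope: "(P q - (g1 q - 2 * g3 q)) * fst (T q) + (Q q - (2 * g2 q - g4 q)) * snd (T q) = 0"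
    if T: "smooth_on M T" "straight_field R S T q" "geodesic_field P Q T q" "fst (T q) \<noteq> 0" "snd (T q) \<noteq> 0" and q: "q \<in> N" for T q
  proof -
    define t1 t2 e1 e2 where t: "t1 = fst (T q)" "t2 = snd (T q)"
      "e1 = directional T (\<lambda>q. fst (T q)) q" "e2 = directional T (\<lambda>q. snd (T q)) q"
    \<comment> \<open>Components of the second derivative along \<open>T\<close> in terms of
      \<open>ddx u\<close> and \<open>ddy u\<close>; straightness means that \<open>(U1, U2)\<close>
      is parallel to \<open>T\<close>.\<close>
    define U1 U2 where U: "U1 = t1^2 * g1 q + 2 * t1 * t2 * g2 q + e1" "U2 = t2^2 * g4 q + 2 * t1 * t2 * g3 q + e2"
    have second: "directional T (directional T u) q = U1 * ddx u q + U2 * ddy u q" if u: "u \<in> {R, S}" for u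
    proof -
      have "smooth_on N u"
        using u RS by auto
      from second_directional[OF N(1) q this smooth_on_subset[OF T(1) N(2)]] show ?thesis
        unfolding eq[OF q u] t[symmetric] U by (simp add: algebra_simps)
    qed
    have "(t1 * U2 - t2 * U1) * J' q = 0"
      using T(2) second[of R] second[of S]
      unfolding straight_field_def directional_def[of T R] directional_def[of T S] t[symmetric] J'_def
      by (simp add: algebra_simps)
    then have "t1 * U2 - t2 * U1 = 0"
      using J'[OF q] by simp
    moreover have "t1 * e2 - t2 * e1 = t1 * t2 * (P q * t1 + Q q * t2)"
      using T(3) unfolding geodesic_field_def t by simp
    ultimately have "t1 * t2 * ((P q - (g1 q - 2 * g3 q)) * t1 + (Q q - (2 * g2 q - g4 q)) * t2) = 0"
      unfolding U by (simp add: algebra_simps power2_eq_square)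
    then show ?thesis
      using T(4,5) unfolding t by simp
  qed
  have PQ: "P q = g1 q - 2 * g3 q" "Q q = 2 * g2 q - g4 q" if q: "q \<in> N" for q
  proof -
    have qM: "q \<in> M"
      using q N(2) by blast
    note nz = ddx_f[OF qM] ddy_f[OF qM] a_nz[OF qM] a_n1[OF qM]
    let ?e = "P q - (g1 q - 2 * g3 q)" and ?d = "Q q - (2 * g2 q - g4 q)"
    have 1: "?e * Y q + ?d * - X q = 0"
      using slope[OF smooth_fields(3) straight(3)[OF q] geodesic_fields(3)[OF qM] _ _ q] nz by simp
    have 2: "?e * Y q + ?d * - (a q * X q) = 0"
      using slope[OF smooth_fields(4) straight(4)[OF q] geodesic_fields(4)[OF qM] _ _ q] nz by simp
    \<comment> \<open>The determinant of the two equations. It is nonzero because \<open>a\<close>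
      avoids the value 1, that is, because the third and fourth foliations are transversal.\<close>
    have "Y q * - (a q * X q) - - X q * Y q = (1 - a q) * X q * Y q"
      by (simp add: algebra_simps)
    also have "\<dots> \<noteq> 0"
      using nz by simp
    finally have det: "Y q * - (a q * X q) - - X q * Y q \<noteq> 0" .
    show "P q = g1 q - 2 * g3 q" "Q q = 2 * g2 q - g4 q"
      using jacobian_independent[OF det 1 2] by simp_all
  qed
  note compat = affine_connection_compatible[OF N(1) RS J g eq]
  have qM: "q \<in> M"
    using q N(2) by blast
  note flat = affine_connection_flat[OF N(1) g compat PQ smooth_on_subset[OF smooth_P N(2)]
      smooth_on_subset[OF smooth_Q N(2)] q]
  have "(X q)^2 * Y q * I1_0 f a q = 0" "X q * (Y q)^2 * I2_0 f a q = 0"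
    using flat(1) flat(2) unfolding flat1_eq[OF qM] flat2_eq[OF qM] I1_0_def I2_0_def by simp_all
  then show "I1_0 f a q = 0" "I2_0 f a q = 0"
    using ddx_f[OF qM] ddy_f[OF qM] by simp_all
qed

section \<open>Necessity of the two equations\<close>

proposition (in web_function_inv) linearizable_only_if:
  assumes "linearizable M (web4 f a)" and p: "p \<in> M"
  shows "I1_0 f a p = 0" "I2_0 f a p = 0"
proof -
  obtain U \<phi> V where U: "p \<in> U" "U \<subseteq> M" "diffeo_onto_proj U \<phi> V"
    and lines: "\<forall>\<omega>\<in>set (web4 f a). \<forall>q\<in>U. \<exists>L. proj_line L \<and> \<phi> ` leaf \<omega> U q \<subseteq> L"
    using bspec[OF assms(1)[unfolded linearizable_def] p] by (elim exE conjE)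
  obtain N R S where N: "open N" "p \<in> N" "N \<subseteq> U" and RS: "smooth_on N R" "smooth_on N S"
    and J: "\<forall>q\<in>N. ddx R q * ddy S q - ddy R q * ddx S q \<noteq> 0"
    and affine: "\<forall>L. proj_line L \<longrightarrow> (\<exists>c0 c1 c2. (c0 \<noteq> 0 \<or> c1 \<noteq> 0 \<or> c2 \<noteq> 0) \<and>
      (\<forall>q\<in>N. \<phi> q \<in> L \<longrightarrow> c0 + c1 * R q + c2 * S q = 0))"
    using affine_coordinates[OF U(3,1)] by (elim exE conjE)
  have NM: "N \<subseteq> M"
    using N(3) U(2) by (rule order_trans)
  have straight: "straight_field R S T q"
    if \<omega>: "\<omega> \<in> set (web4 f a)" and T: "smooth_on M T" "\<And>p c. p \<in> M \<Longrightarrow> \<omega> p (c *\<^sub>R T p) = 0" and q: "q \<in> N"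
    for \<omega> T q
  proof -
    obtain L where L: "proj_line L" "\<phi> ` leaf \<omega> U q \<subseteq> L"
      using bspec[OF bspec[OF lines \<omega>] subsetD[OF N(3) q]] by (elim exE conjE)
    obtain c0 c1 c2 where c: "c0 \<noteq> 0 \<or> c1 \<noteq> 0 \<or> c2 \<noteq> 0"
      "\<forall>z\<in>N. \<phi> z \<in> L \<longrightarrow> c0 + c1 * R z + c2 * S z = 0"
      using affine[rule_format, OF L(1)] by (elim exE conjE)
    show ?thesis
    proof (rule straight_field_if_leaf_in_line[OF N(1,3) q RS smooth_on_subset[OF T(1) NM] _ c(1)])
      show "\<omega> p (c *\<^sub>R T p) = 0" if "p \<in> N" for p c
        by (rule T(2)[OF subsetD[OF NM that]])
      show "c0 + c1 * R z + c2 * S z = 0" if "z \<in> leaf \<omega> U q" "z \<in> N" for z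
        by (rule c(2)[rule_format, OF that(2) subsetD[OF L(2) imageI[OF that(1)]]])
    qed
  qed
  have "straight_field R S (\<lambda>q. (0, 1)) q" "straight_field R S (\<lambda>q. (1, 0)) q"
      "straight_field R S (\<lambda>q. (Y q, - X q)) q" "straight_field R S (\<lambda>q. (Y q, - (a q * X q))) q"
    if q: "q \<in> N" for q
  proof -
    show "straight_field R S (\<lambda>q. (0, 1)) q"
      by (rule straight[of "omega1 f", OF _ smooth_fields(1) _ q])
        (use omega_zero_iff(1) in \<open>auto simp: web4_def\<close>)
    show "straight_field R S (\<lambda>q. (1, 0)) q"
      by (rule straight[of "omega2 f", OF _ smooth_fields(2) _ q])
        (use omega_zero_iff(2) in \<open>auto simp: web4_def\<close>)
    show "straight_field R S (\<lambda>q. (Y q, - X q)) q"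
      by (rule straight[of "omega3 f", OF _ smooth_fields(3) _ q])
        (use omega_zero_iff(3) in \<open>auto simp: web4_def\<close>)
    show "straight_field R S (\<lambda>q. (Y q, - (a q * X q))) q"
      by (rule straight[of "omega4 f a", OF _ smooth_fields(4) _ q])
        (use omega_zero_iff(4) in \<open>auto simp: web4_def\<close>)
  qed
  from straight_web_flat[OF N(1) NM RS bspec[OF J] this N(2)]
  show "I1_0 f a p = 0" "I2_0 f a p = 0"
    by simp_all
qed

theorem theorem8:
  fixes M :: "(real \<times> real) set" and f a :: "real \<times> real \<Rightarrow> real"
  assumes "open M" and "connected M" and "M \<noteq> {}" and "simply_connected M"
    and "smooth_on M f" and "smooth_on M a"
    and "\<And>p. p \<in> M \<Longrightarrow> ddx f p \<noteq> 0"
    and "\<And>p. p \<in> M \<Longrightarrow> ddy f p \<noteq> 0"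
    and "\<And>p. p \<in> M \<Longrightarrow> a p \<noteq> 0"
    and "\<And>p. p \<in> M \<Longrightarrow> a p \<noteq> 1"
  shows "linearizable M (web4 f a) \<longleftrightarrow> (\<forall>p\<in>M. I1_0 f a p = 0) \<and> (\<forall>p\<in>M. I2_0 f a p = 0)"
proof -
  interpret web_function_inv M f a
    by unfold_locales fact+
  show ?thesis
    using linearizable_if linearizable_only_if by blast
qed

end
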